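(* Let $\alpha\in(0,\tfrac12)$ be irrational with nearest integer continued fraction expansion $(a_i,\varepsilon_i)$, with $R:=\liminf_{i\to\infty}a_i$ finite, and let $\gamma_*$, $R_*,R_{**},\theta_1,\theta_2$ be as in the context. Then $$M(\alpha,\gamma_* )\ \ge\ M_1:=\frac14\cdot\frac{\left(1-\frac{2}{R_*-\theta_2}\right)\left(1-\frac{1}{\max\{4,R_{**}\}}\left(1+\frac{\theta_1^2}{1-\theta_1}\right)\right)}{1+\frac{1}{\max\{4,R_{**}\}}\left(\theta_1-\frac{1}{R_*-\theta_2}\right)}.$$ Moreover this is best possible: if $R\ge3$ and, for $k\ge1$, $\alpha^{(k)}\in(0,\tfrac12)$ is the number whose nearest integer expansion is periodic with period block of signed partial quotients $(\varepsilon_ia_i)$ equal to $R_*$ repeated $k$ times, then $R_{**}$, $-R_*$, then $-R_{**}$ repeated $k$ times, then $M(\alpha^{(k)},\gamma_*(\alpha^{(k)}))\to M_1$ as $k\to\infty$; and if $R=2$ and $\alpha^{(k,A)}$ has periodic nearest integer expansion with period block $3$ repeated $k$ times, then $4,-3,-2,A$, then $M(\alpha^{(k,A)},\gamma_*(\alpha^{(k,A)}))\to M_1$ as $k,A\to\infty$.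
   Context: For real $x$, $\|x\|$ is the distance to the nearest integer and $\{x\}$ the fractional part. $M(\alpha,\gamma):=\liminf_{|n|\to\infty}|n|\,\|n\alpha-\gamma\|$ ($n\in\mathbb Z$). Nearest integer expansion of irrational $\alpha\in(0,\tfrac12)$: $a_0=0$, $\varepsilon_1=1$, $\alpha_0=\alpha$; for $i\ge0$, if $\|1/\alpha_i\|=\{1/\alpha_i\}$ then $a_{i+1}=\lfloor1/\alpha_i\rfloor$, $\varepsilon_{i+2}=1$, else $a_{i+1}=\lceil1/\alpha_i\rceil$, $\varepsilon_{i+2}=-1$; $\alpha_{i+1}=\|1/\alpha_i\|$; so $\alpha=a_0+\cfrac{\varepsilon_1}{a_1+\cfrac{\varepsilon_2}{a_2+\cdots}}$. Convergents: $p_{-1}=1,q_{-1}=0,p_0=a_0,q_0=1$, $p_i=a_ip_{i-1}+\varepsilon_ip_{i-2}$, $q_i=a_iq_{i-1}+\varepsilon_iq_{i-2}$; $D_i:=|q_i\alpha-p_i|$. $\lambda_i=0$ if $a_i$ is even, $\lambda_i=(-1)^j$ if $a_i$ is the $j$-th odd term among $a_1,a_2,\dots$; $\gamma_*:=\sum_{i\ge1}\tfrac12(a_i-1+\varepsilon_i+\lambda_i)D_{i-1}$. Let $R_*:=R$ if $R$ is odd and $R+1$ if $R$ is even; $R_{**}:=R$ if $R$ is even and $R+1$ if $R$ is odd. Let $\theta_1:=\tfrac12(\sqrt{R_*^2+4}-R_* )$, and $\theta_2:=\tfrac12(R_{**}-\sqrt{R_{**}^2-4})$ if $R\ge3$,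 $\theta_2:=\tfrac12$ if $R=2$. *)

theory Defs
  imports "HOL-Analysis.Analysis"
begin

definition nint_dist :: "real \<Rightarrow> real" where
  "nint_dist x = \<bar>x - of_int (round x)\<bar>"

text \<open>The filter expresses \<open>|n| \<rightarrow> \<infinity>\<close> over all integers, so both directions count.\<close>

definition inhom_M :: "real \<Rightarrow> real \<Rightarrow> ereal" where
  "inhom_M \<alpha> \<gamma> =
     Liminf (filtercomap (\<lambda>n::int. \<bar>n\<bar>) at_top)
       (\<lambda>n. ereal (of_int \<bar>n\<bar> * nint_dist (of_int n * \<alpha> - \<gamma>)))"

primrec nicf_rem :: "real \<Rightarrow> nat \<Rightarrow> real" where
  "nicf_rem \<alpha> 0 = \<alpha>"
| "nicf_rem \<alpha> (Suc i) = nint_dist (1 / nicf_rem \<alpha> i)"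

fun nicf_a :: "real \<Rightarrow> nat \<Rightarrow> int" where
  "nicf_a \<alpha> 0 = 0"
| "nicf_a \<alpha> (Suc i) =
     (if nint_dist (1 / nicf_rem \<alpha> i) = frac (1 / nicf_rem \<alpha> i)
      then \<lfloor>1 / nicf_rem \<alpha> i\<rfloor> else \<lceil>1 / nicf_rem \<alpha> i\<rceil>)"

text \<open>The signs are indexed from 1; the value at 0 is a dummy that is never used.\<close>

fun nicf_eps :: "real \<Rightarrow> nat \<Rightarrow> int" where
  "nicf_eps \<alpha> 0 = 1"
| "nicf_eps \<alpha> (Suc 0) = 1"
| "nicf_eps \<alpha> (Suc (Suc i)) =
     (if nint_dist (1 / nicf_rem \<alpha> i) = frac (1 / nicf_rem \<alpha> i) then 1 else - 1)"

text \<open>The initial values \<open>p\<^sub>-\<^sub>1 = 1\<close> and \<open>q\<^sub>-\<^sub>1 = 0\<close> are inlined in the equations for index 1.\<close>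

fun nicf_p :: "real \<Rightarrow> nat \<Rightarrow> int" where
  "nicf_p \<alpha> 0 = nicf_a \<alpha> 0"
| "nicf_p \<alpha> (Suc 0) = nicf_a \<alpha> 1 * nicf_p \<alpha> 0 + nicf_eps \<alpha> 1 * 1"
| "nicf_p \<alpha> (Suc (Suc i)) =
     nicf_a \<alpha> (Suc (Suc i)) * nicf_p \<alpha> (Suc i) + nicf_eps \<alpha> (Suc (Suc i)) * nicf_p \<alpha> i"

fun nicf_q :: "real \<Rightarrow> nat \<Rightarrow> int" where
  "nicf_q \<alpha> 0 = 1"
| "nicf_q \<alpha> (Suc 0) = nicf_a \<alpha> 1 * nicf_q \<alpha> 0 + nicf_eps \<alpha> 1 * 0"
| "nicf_q \<alpha> (Suc (Suc i)) =
     nicf_a \<alpha> (Suc (Suc i)) * nicf_q \<alpha> (Suc i) + nicf_eps \<alpha> (Suc (Suc i)) * nicf_q \<alpha> i"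

definition nicf_D :: "real \<Rightarrow> nat \<Rightarrow> real" where
  "nicf_D \<alpha> i = \<bar>of_int (nicf_q \<alpha> i) * \<alpha> - of_int (nicf_p \<alpha> i)\<bar>"

text \<open>For odd \<open>a\<^sub>i\<close> the exponent counts the odd terms among \<open>a\<^sub>1, \<dots>, a\<^sub>i\<close>, i.e. \<open>a\<^sub>i\<close> is
  the odd term with that number.\<close>

definition nicf_lam :: "real \<Rightarrow> nat \<Rightarrow> int" where
  "nicf_lam \<alpha> i =
     (if even (nicf_a \<alpha> i) then 0 else (- 1) ^ card {j \<in> {1..i}. odd (nicf_a \<alpha> j)})"

text \<open>The summation index is shifted by one: the term at \<open>i\<close> belongs to \<open>a\<close> with index \<open>i + 1\<close>.\<close>

definition gamma_star :: "real \<Rightarrow> real" where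
  "gamma_star \<alpha> =
     (\<Sum>i. 1 / 2 * of_int (nicf_a \<alpha> (Suc i) - 1 + nicf_eps \<alpha> (Suc i) + nicf_lam \<alpha> (Suc i))
            * nicf_D \<alpha> i)"

definition R_star :: "nat \<Rightarrow> nat" where
  "R_star R = (if odd R then R else R + 1)"

definition R_sstar :: "nat \<Rightarrow> nat" where
  "R_sstar R = (if even R then R else R + 1)"

definition theta1 :: "nat \<Rightarrow> real" where
  "theta1 R = 1 / 2 * (sqrt ((real (R_star R))\<^sup>2 + 4) - real (R_star R))"

text \<open>Only \<open>R \<ge> 2\<close> is relevant, since all partial quotients are at least 2.\<close>

definition theta2 :: "nat \<Rightarrow> real" where
  "theta2 R =
     (if R \<ge> 3 then 1 / 2 * (real (R_sstar R) - sqrt ((real (R_sstar R))\<^sup>2 - 4)) else 1 / 2)"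

definition M1 :: "nat \<Rightarrow> real" where
  "M1 R =
     1 / 4 *
     (((1 - 2 / (real (R_star R) - theta2 R)) *
       (1 - 1 / max 4 (real (R_sstar R)) * (1 + (theta1 R)\<^sup>2 / (1 - theta1 R)))) /
      (1 + 1 / max 4 (real (R_sstar R)) * (theta1 R - 1 / (real (R_star R) - theta2 R))))"

text \<open>Pure periodicity of the sequence \<open>\<epsilon>\<^sub>1 a\<^sub>1, \<epsilon>\<^sub>2 a\<^sub>2, \<dots>\<close> with the given period block.\<close>

definition periodic_nicf :: "int list \<Rightarrow> real \<Rightarrow> bool" where
  "periodic_nicf B \<alpha> \<longleftrightarrow>
     0 < \<alpha> \<and> \<alpha> < 1 / 2 \<and> \<alpha> \<notin> \<rat> \<and>
     (\<forall>i. nicf_eps \<alpha> (Suc i) * nicf_a \<alpha> (Suc i) = B ! (i mod length B))"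

definition block_ge3 :: "nat \<Rightarrow> nat \<Rightarrow> int list" where
  "block_ge3 R k =
     replicate k (int (R_star R)) @ [int (R_sstar R), - int (R_star R)]
       @ replicate k (- int (R_sstar R))"

definition block_2 :: "nat \<Rightarrow> nat \<Rightarrow> int list" where
  "block_2 k A = replicate k 3 @ [4, - 3, - 2, int A]"

end

theory Submission
  imports Defs
begin

text \<open>
  Telescoping \<open>D\<^sub>i\<^sub>-\<^sub>2 = a\<^sub>i D\<^sub>i\<^sub>-\<^sub>1 + \<epsilon>\<^sub>i\<^sub>+\<^sub>1 D\<^sub>i\<close> gives
  \<open>2\<gamma>\<^sub>* = 1 + \<alpha> + \<sigma>\<close> with \<open>\<sigma> = \<Sum> \<lambda>\<^sub>i D\<^sub>i\<^sub>-\<^sub>1\<close>, so up to a factor tending to 1 the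
  quantity \<open>|n| \<parallel>n\<alpha> - \<gamma>\<^sub>*\<parallel>\<close> is \<open>|N| |N\<alpha> - P - \<sigma>| / 4\<close> with \<open>N\<close> and \<open>P\<close> odd.
  Writing \<open>(N, P)\<close>, shifted by the partial sums of \<open>\<sigma>\<close>, in the basis of the \<open>k\<close>-th and
  \<open>(k-1)\<close>-st convergents gives coordinates \<open>(u, v)\<close> that are again both odd: this is what
  the \<open>\<lambda>\<^sub>i\<close> achieve. In these coordinates the product becomes
  \<open>|u - b v + r| |u x + v - t| / (1 + x b)\<close>, where \<open>(b, r)\<close> depends only on the partial
  quotients up to \<open>k\<close> and \<open>(x, t)\<close> only on the later ones.

  For a given point let \<open>k\<close> be the first index from which \<open>|v|\<close> does not decrease. The product
  is concave in \<open>u\<close> between its zeros, hence it is bounded below by its values at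
  \<open>u, v = \<plusminus>1\<close> for the indices \<open>k\<close> and \<open>k + 1\<close>. A contracting family of linear inequalities
  for \<open>(b, r)\<close> and the bounds \<open>x - t \<le> \<theta>\<^sub>2\<close>, \<open>x + t \<le> 2 / (R\<^sub>* - \<theta>\<^sub>2)\<close> show that these values
  are at least \<open>4 M\<^sub>1\<close> in the limit. The extremal configuration is an even partial quotient
  \<open>R\<^sub>*\<^sub>*\<close> preceded by many \<open>R\<^sub>*\<close> and followed by \<open>-R\<^sub>*, -R\<^sub>*\<^sub>*, -R\<^sub>*\<^sub>*, \<dots>\<close>, with
  \<open>(u, v) = (-1, 1)\<close>; the periodic examples contain it infinitely often.
\<close>

section \<open>Constants of the bound\<close>

text \<open>\<open>T\<close> is 4 times the bound: the value of (P - 1 - r)(1 - x - t) / (P - x), P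
  = A + b, at b = \<theta>, r = \<rho>, x = t = \<open>al\<close>. Here (\<theta>, \<rho>) is the
  fixed point of the step with quotient \<open>s\<close> and sign +, and \<open>al\<close> comes
  from a quotient \<open>s\<close> followed by a minus sign and a remainder \<eta> with zero tail.

  The obstacle lies in the past. Separate bounds for \<open>b\<close> and \<open>r\<close> do not
  give \<open>T\<close>, since the value increases with \<open>b\<close> and decreases with
  \<open>r\<close>, and a small \<open>b\<close> together with r = \<rho> would fall below
  \<open>T\<close>. Needed are upper bounds for r - k b, exact at (\<theta>, \<rho>), for certain
  slopes \<open>k\<close>. They must survive every admissible step, so the slopes have to be closed
  under the action of a step; the slopes 0 and \<kappa> then generate all others.

  The remaining corners split by size. For R \<le> 3 the bound T \<le> 1/5 allows plain numerical
  estimates. For R \<ge> 4 there is a serious rival to the extremal configuration, centred at an odd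
  quotient, and its value has to be compared with \<open>T\<close> exactly.\<close>

locale bound_params =
  fixes R :: nat
  assumes R2: "2 \<le> R"
begin

definition s :: real where "s = real (R_star R)"
definition A :: real where "A = max 4 (real (R_sstar R))"
definition \<theta> :: real where "\<theta> = theta1 R"
definition \<eta> :: real where "\<eta> = theta2 R"
definition \<rho> :: real where "\<rho> = \<theta> / (1 - \<theta>)"
definition al :: real where "al = 1 / (s - \<eta>)"
text \<open>The largest slope \<open>k\<close> for which \<open>r - k * b\<close> is controlled.
  From below it must reach the slopes used in the estimates, \<open>kM\<close> and, for R \<ge> 4,
  \<open>k2\<close>; from above it is limited by \<open>cc_A\<close>. The factors are round numbers
  meeting both demands: the factor 2, for instance, would violate the inequality of
  \<open>cc_A\<close> at R = 4.\<close>

definition \<kappa> :: real where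
  "\<kappa> = (if R \<le> 3 then 4 / 3 else if R = 4 then 7 / 4 else 2) * \<rho>"
definition G :: real where "G = (A - 1 + \<theta> - \<rho>) / (A + \<theta> - al)"
definition T :: real where "T = (1 - 2 * al) * G"

lemma small_R: "R \<le> 3 \<Longrightarrow> s = 3 \<and> A = 4"
proof -
  assume "R \<le> 3"
  then have "R = 2 \<or> R = 3" using R2 by auto
  then show ?thesis by (auto simp: s_def A_def R_star_def R_sstar_def)
qed

lemma large_R: "4 \<le> R \<Longrightarrow> s \<ge> 5 \<and> (A = s + 1 \<or> A = s - 1) \<and> A = real (R_sstar R)"
proof -
  assume a: "4 \<le> R"
  show ?thesis
  proof (cases "even R")
    case True
    then show ?thesis using a by (auto simp: s_def A_def R_star_def R_sstar_def)
  next
    case False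
    then have "R \<noteq> 4" by auto
    then have "5 \<le> R" using a by auto
    then show ?thesis using False by (auto simp: s_def A_def R_star_def R_sstar_def)
  qed
qed

lemma s3: "3 \<le> s" using small_R large_R by (cases "R \<le> 3") force+
lemma A4: "4 \<le> A" by (simp add: A_def)

lemma A_eq_sstar: "3 \<le> R \<Longrightarrow> A = real (R_sstar R)"
proof -
  assume "3 \<le> R"
  then have "4 \<le> R_sstar R" by (cases "R = 3") (auto simp: R_sstar_def)
  then show ?thesis by (simp add: A_def)
qed

lemma \<theta>_eq: "\<theta> * (s + \<theta>) = 1"
proof -
  have "(sqrt (s\<^sup>2 + 4))\<^sup>2 = s\<^sup>2 + 4" by simp
  moreover have "\<theta> = 1 / 2 * (sqrt (s\<^sup>2 + 4) - s)" by (simp add: \<theta>_def theta1_def s_def)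
  moreover have "1 / 2 * (w - s) * (s + 1 / 2 * (w - s)) = 1" if "w\<^sup>2 = s\<^sup>2 + 4" for w
    using that by (simp add: field_simps power2_eq_square)
  ultimately show ?thesis by metis
qed

lemma \<theta>_pos: "0 < \<theta>"
proof -
  have "sqrt (s\<^sup>2) < sqrt (s\<^sup>2 + 4)" by (subst real_sqrt_less_iff) simp
  then have "s < sqrt (s\<^sup>2 + 4)" using s3 by simp
  then show ?thesis by (simp add: \<theta>_def theta1_def s_def)
qed

lemma \<theta>_s: "\<theta> * s < 1"
proof -
  have "\<theta> * s + \<theta> * \<theta> = 1" using \<theta>_eq by (simp add: distrib_left)
  moreover have "0 < \<theta> * \<theta>" using \<theta>_pos by simp
  ultimately show ?thesis by linarith
qed

text \<open>Since c (s + c) increases for positive c and equals 1 at \<theta>, decimal bounds for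
  \<theta> are obtained by substitution.\<close>

lemma \<theta>_less: "c > 0 \<Longrightarrow> c * (s + c) > 1 \<Longrightarrow> \<theta> < c"
proof (rule ccontr)
  assume c: "c > 0" "c * (s + c) > 1" "\<not> \<theta> < c"
  then have "c * (s + c) \<le> \<theta> * (s + \<theta>)" using s3 by (intro mult_mono) auto
  then show False using c \<theta>_eq by simp
qed

lemma \<theta>_greater: "c * (s + c) < 1 \<Longrightarrow> \<theta> > c"
proof (rule ccontr)
  assume c: "c * (s + c) < 1" "\<not> \<theta> > c"
  then have "\<theta> * (s + \<theta>) \<le> c * (s + c)" using s3 \<theta>_pos by (intro mult_mono) auto
  then show False using c \<theta>_eq by simp
qed

lemma \<theta>_third: "\<theta> < 1 / 3"
proof -
  have "\<theta> * 3 \<le> \<theta> * s" using s3 \<theta>_pos by (intro mult_left_mono) auto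
  then show ?thesis using \<theta>_s by simp
qed

lemma \<theta>_small: "R \<le> 3 \<Longrightarrow> 3027 / 10000 < \<theta> \<and> \<theta> < 3028 / 10000"
  using \<theta>_less[of "3028 / 10000"] \<theta>_greater[of "3027 / 10000"] small_R by auto

lemma \<theta>_large: "4 \<le> R \<Longrightarrow> \<theta> < 1926 / 10000"
proof (rule \<theta>_less)
  assume "4 \<le> R"
  then have "s \<ge> 5" using large_R by auto
  then show "1926 / 10000 * (s + 1926 / 10000) > 1" by simp
qed simp

lemma \<rho>_eq: "\<rho> = \<theta> * (1 + \<rho>)"
  using \<theta>_third by (simp add: \<rho>_def field_simps)

lemma \<rho>_pos: "0 < \<rho>" using \<theta>_pos \<theta>_third by (simp add: \<rho>_def)

lemma \<rho>_s: "\<rho> * (s + \<theta>) = 1 + \<rho>"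
proof -
  have "\<rho> * (s + \<theta>) = (1 + \<rho>) * (\<theta> * (s + \<theta>))" by (subst \<rho>_eq) (simp add: algebra_simps)
  then show ?thesis using \<theta>_eq by simp
qed

lemma \<rho>_small: "R \<le> 3 \<Longrightarrow> 434 / 1000 < \<rho> \<and> \<rho> < 4344 / 10000"
  using \<theta>_small by (auto simp: \<rho>_def field_simps)

lemma \<rho>_large: "4 \<le> R \<Longrightarrow> \<rho> < 2386 / 10000"
  using \<theta>_large \<theta>_third by (auto simp: \<rho>_def field_simps)

lemma \<rho>_less: "\<rho> < 4344 / 10000"
  using \<rho>_small \<rho>_large by (cases "R \<le> 3") force+

lemma \<eta>_eq: "3 \<le> R \<Longrightarrow> \<eta> * (A - \<eta>) = 1"
proof -
  assume R: "3 \<le> R"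
  have "A\<^sup>2 \<ge> 4" using power_mono[of 2 A 2] A4 by simp
  then have "(sqrt (A\<^sup>2 - 4))\<^sup>2 = A\<^sup>2 - 4" by simp
  moreover have "\<eta> = 1 / 2 * (A - sqrt (A\<^sup>2 - 4))"
    using R A_eq_sstar by (simp add: \<eta>_def theta2_def)
  moreover have "1 / 2 * (A - w) * (A - 1 / 2 * (A - w)) = 1" if "w\<^sup>2 = A\<^sup>2 - 4" for w
    using that by (simp add: field_simps power2_eq_square)
  ultimately show ?thesis by metis
qed

lemma \<eta>_bounds: "0 < \<eta> \<and> \<eta> \<le> 1 / 2"
proof (cases "3 \<le> R")
  case False
  then have "\<eta> = 1 / 2" by (simp add: \<eta>_def theta2_def)
  then show ?thesis by simp
next
  case True
  have "A\<^sup>2 \<ge> 4" using power_mono[of 2 A 2] A4 by simp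
  moreover have "sqrt (A\<^sup>2 - 4) < sqrt (A\<^sup>2)" by (subst real_sqrt_less_iff) simp
  ultimately have l: "sqrt (A\<^sup>2 - 4) < A" using A4 by simp
  have "(A - 1)\<^sup>2 \<le> A\<^sup>2 - 4" using A4 by (simp add: power2_eq_square algebra_simps)
  then have "sqrt ((A - 1)\<^sup>2) \<le> sqrt (A\<^sup>2 - 4)" by (subst real_sqrt_le_iff)
  then have "A - 1 \<le> sqrt (A\<^sup>2 - 4)" using A4 by simp
  moreover have "\<eta> = 1 / 2 * (A - sqrt (A\<^sup>2 - 4))"
    using True A_eq_sstar by (simp add: \<eta>_def theta2_def)
  ultimately show ?thesis using l by simp
qed

lemma \<eta>_pos: "0 < \<eta>" and \<eta>_half: "\<eta> \<le> 1 / 2" using \<eta>_bounds by auto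

lemma \<eta>_small: "R \<le> 3 \<Longrightarrow> 26 / 100 < \<eta>"
proof (cases "R = 2")
  case True
  then have "\<eta> = 1 / 2" unfolding \<eta>_def theta2_def by simp
  then show ?thesis by simp
next
  case False
  assume "R \<le> 3"
  then have e: "\<eta> * (4 - \<eta>) = 1" using \<eta>_eq small_R R2 False by auto
  show ?thesis
  proof (rule ccontr)
    assume "\<not> ?thesis"
    then have n: "\<eta> \<le> 26 / 100" by simp
    have "(26 / 100 - \<eta>) * (374 / 100 - \<eta>) \<ge> 0" using n by (intro mult_nonneg_nonneg) auto
    moreover have "(26 / 100 - \<eta>) * (374 / 100 - \<eta>) = \<eta> * \<eta> - 4 * \<eta> + 9724 / 10000"
      by (simp add: field_simps)
    moreover have "4 * \<eta> - \<eta> * \<eta> = 1" using e by (simp add: algebra_simps)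
    ultimately show False by linarith
  qed
qed

lemma \<eta>_large: "4 \<le> R \<Longrightarrow> \<eta> < 27 / 100"
proof -
  assume R: "4 \<le> R"
  have e: "\<eta> * (A - \<eta>) = 1" using \<eta>_eq R by auto
  have "\<eta> * (4 - \<eta>) \<le> \<eta> * (A - \<eta>)" using \<eta>_pos A4 by (intro mult_left_mono) auto
  then have e': "\<eta> * (4 - \<eta>) \<le> 1" using e by simp
  show ?thesis
  proof (rule ccontr)
    assume n: "\<not> ?thesis"
    have "(\<eta> - 27 / 100) * (373 / 100 - \<eta>) \<ge> 0" using n \<eta>_half by (intro mult_nonneg_nonneg) auto
    moreover have "(\<eta> - 27 / 100) * (373 / 100 - \<eta>) = 4 * \<eta> - \<eta> * \<eta> - 10071 / 10000"
      by (simp add: field_simps)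
    moreover have "4 * \<eta> - \<eta> * \<eta> \<le> 1" using e' by (simp add: algebra_simps)
    ultimately show False by linarith
  qed
qed

lemma al_eq: "al * (s - \<eta>) = 1" using s3 \<eta>_half by (simp add: al_def)
lemma al_pos: "0 < al" using s3 \<eta>_half by (simp add: al_def)
lemma al_le: "al \<le> 2 / 5" using s3 \<eta>_half by (simp add: al_def field_simps)

text \<open>Both sides are reciprocals: \<rho> = 1 / (s + \<theta> - 1), and \<theta> + \<eta> <
  1.\<close>

lemma al_le_\<rho>: "al \<le> \<rho>"
proof -
  have "\<rho> * (s + \<theta> - 1) = 1" using \<rho>_s by (simp add: algebra_simps)
  moreover have "\<rho> * (s + \<theta> - 1) \<le> \<rho> * (s - \<eta>)"
    using \<theta>_third \<eta>_half \<rho>_pos by (intro mult_left_mono) auto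
  ultimately have "al * (s - \<eta>) \<le> \<rho> * (s - \<eta>)" using al_eq by simp
  then show ?thesis using s3 \<eta>_half by (simp add: mult_le_cancel_right)
qed

text \<open>The slope of the extremal estimate. With G = 1 - \<open>kM\<close>, the inequality P - 1
  - r \<ge> G (P - al) is an upper bound for r - \<open>kM\<close> b, and it is an equality for
  quotient \<open>A\<close>, b = \<theta>, r = \<rho>.\<close>

definition kM :: real where "kM = (1 - al + \<rho>) / (A + \<theta> - al)"

lemma den_pos: "3 < A + \<theta> - al" using A4 \<theta>_pos al_le by simp

lemma G_kM: "G = 1 - kM"
  using den_pos by (simp add: G_def kM_def field_simps)

lemma kM_eq: "kM * (A + \<theta> - al) = 1 - al + \<rho>" using den_pos by (simp add: kM_def)

lemma kM_pos: "0 < kM" using den_pos al_le \<rho>_pos by (simp add: kM_def)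

lemma kM_half: "kM < 1 / 2"
proof -
  have "1 - al + \<rho> < (A + \<theta> - al) * (1 / 2)" using den_pos al_pos \<rho>_less al_le A4 \<theta>_pos by simp
  then show ?thesis using den_pos by (simp add: kM_def field_simps)
qed

lemma G_bounds: "1 / 2 < G" "G < 1" using kM_pos kM_half G_kM by auto

lemma kM_ge: "1 \<le> kM * (A + \<theta>)"
proof -
  have "kM * (A + \<theta>) = 1 - al + \<rho> + kM * al" using kM_eq by (simp add: algebra_simps)
  moreover have "kM * al > 0" using kM_pos al_pos by simp
  ultimately show ?thesis using al_le_\<rho> by linarith
qed

lemma T_pos: "0 < T" using G_bounds al_le by (simp add: T_def)
lemma T_le: "T \<le> 1 - 2 * al"
  using G_bounds al_le mult_left_mono[of G 1 "1 - 2 * al"] by (simp add: T_def)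
lemma T_lt1: "T < 1" using T_le al_pos by simp

text \<open>Replaces exact comparisons in the non-extremal cases. There is little room: at R = 3 the
  value of \<open>T\<close> is about 0.195.\<close>

lemma T_small: "R \<le> 3 \<Longrightarrow> T \<le> 1 / 5"
proof -
  assume R: "R \<le> 3"
  have "al \<ge> 1 / (3 - 26 / 100)"
    using small_R[OF R] \<eta>_small[OF R] \<eta>_half unfolding al_def by (intro divide_left_mono) auto
  then have 1: "1 - 2 * al \<le> 2701 / 10000" by simp
  have "G \<le> 736 / 1000"
    using small_R[OF R] \<theta>_small[OF R] \<rho>_small[OF R] al_le den_pos
    by (simp add: G_def field_simps)
  then have "(1 - 2 * al) * G \<le> 2701 / 10000 * (736 / 1000)"
    using 1 G_bounds by (intro mult_mono) auto
  then show ?thesis by (simp add: T_def)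
qed

lemma M1_eq: "M1 R = T / 4"
proof -
  have a: "al = 1 / (real (R_star R) - theta2 R)" by (simp add: al_def s_def \<eta>_def)
  have t: "1 - \<theta> > 0" using \<theta>_third by simp
  have 1: "1 - 1 / A * (1 + \<theta>\<^sup>2 / (1 - \<theta>)) = (A - 1 + \<theta> - \<rho>) / A"
    using t A4 by (simp add: \<rho>_def field_simps power2_eq_square)
  have 2: "1 + 1 / A * (\<theta> - al) = (A + \<theta> - al) / A" using A4 by (simp add: field_simps)
  have "M1 R = 1 / 4 * (((1 - 2 * al) * (1 - 1 / A * (1 + \<theta>\<^sup>2 / (1 - \<theta>)))) / (1 + 1 / A * (\<theta> - al)))"
    by (simp add: M1_def al_def A_def \<theta>_def s_def \<eta>_def)
  also have "\<dots> = T / 4" unfolding 1 2 T_def G_def using A4 den_pos by simp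
  finally show ?thesis .
qed

lemma \<kappa>_ge: "4 / 3 * \<rho> \<le> \<kappa>" and \<kappa>_le: "\<kappa> \<le> 2 * \<rho>"
  using \<rho>_pos by (auto simp: \<kappa>_def)

lemma \<kappa>_pos: "0 < \<kappa>" using \<kappa>_ge \<rho>_pos by linarith

text \<open>\<open>r - k b \<le> \<rho> - k \<theta>\<close> is needed for the slopes \<open>k\<close> occurring in the estimates. An odd step
  maps the slope \<open>k\<close> to \<open>\<rho> - k \<theta>\<close>, which keeps the interval \<open>[0, \<kappa>]\<close> invariant.\<close>

definition cc :: real where "cc = \<rho> - \<kappa> * \<theta>"

lemma cc_bounds: "0 < cc" "cc \<le> \<kappa>"
proof -
  have "\<kappa> * \<theta> \<le> 2 * \<rho> * (1 / 3)" using \<kappa>_le \<theta>_third \<theta>_pos \<rho>_pos by (intro mult_mono) auto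
  then show "0 < cc" using \<rho>_pos by (simp add: cc_def)
  have "\<kappa> * \<theta> > 0" using \<kappa>_pos \<theta>_pos by simp
  then show "cc \<le> \<kappa>" using \<kappa>_ge \<rho>_pos by (simp add: cc_def)
qed

lemma cc_s: "cc * (s + \<theta>) = 1 + \<rho> - \<kappa>"
proof -
  have "cc * (s + \<theta>) = \<rho> * (s + \<theta>) - \<kappa> * (\<theta> * (s + \<theta>))" by (simp add: cc_def algebra_simps)
  then show ?thesis using \<rho>_s \<theta>_eq by simp
qed

text \<open>This is what the \<kappa>-constraint needs to survive an even quotient followed by a
  minus sign: (\<kappa> + r) / P \<le> \<open>cc\<close> follows from it by the bound for r -
  \<open>cc\<close> b. After division by \<rho> only the factor \<kappa> / \<rho> remains, whence
  the three cases.\<close>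

lemma cc_A: "\<rho> + \<kappa> \<le> cc * (A + \<theta>)"
proof -
  have gen: "1 + c \<le> (1 - c * \<theta>) * (A + \<theta>) \<Longrightarrow> \<kappa> = c * \<rho> \<Longrightarrow> ?thesis" for c
  proof -
    assume "1 + c \<le> (1 - c * \<theta>) * (A + \<theta>)" and k: "\<kappa> = c * \<rho>"
    then have "(1 + c) * \<rho> \<le> (1 - c * \<theta>) * (A + \<theta>) * \<rho>" using \<rho>_pos by (intro mult_right_mono) auto
    then show ?thesis by (simp add: cc_def k algebra_simps)
  qed
  consider "R \<le> 3" | "R = 4" | "5 \<le> R" by linarith
  then show ?thesis
  proof cases
    case 1
    have "(1 - 4 / 3 * (3028 / 10000)) * (4 + 3027 / 10000) \<le> (1 - 4 / 3 * \<theta>) * (A + \<theta>)"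
      using \<theta>_small[OF 1] A4 by (intro mult_mono) auto
    then show ?thesis using 1 by (intro gen[of "4 / 3"]) (auto simp: \<kappa>_def)
  next
    case 2
    then have "s = 5" unfolding s_def R_star_def by simp
    then have t: "1925 / 10000 < \<theta>" using \<theta>_greater[of "1925 / 10000"] by simp
    have "(1 - 7 / 4 * (1926 / 10000)) * (4 + 1925 / 10000) \<le> (1 - 7 / 4 * \<theta>) * (A + \<theta>)"
      using \<theta>_large t A4 2 by (intro mult_mono) auto
    moreover have "\<kappa> = 7 / 4 * \<rho>" unfolding \<kappa>_def using 2 by simp
    ultimately show ?thesis by (intro gen[of "7 / 4"]) auto
  next
    case 3
    then have "6 \<le> R_sstar R" by (cases "R = 5") (auto simp: R_sstar_def)
    then have "A \<ge> 6" by (simp add: A_def)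
    then have "(1 - 2 * (1926 / 10000)) * 6 \<le> (1 - 2 * \<theta>) * (A + \<theta>)"
      using \<theta>_large \<theta>_pos A4 3 by (intro mult_mono) auto
    then show ?thesis using 3 by (intro gen[of "2"]) (auto simp: \<kappa>_def)
  qed
qed

text \<open>The counterpart of \<open>cc_A\<close> for an odd quotient followed by a minus sign,
  with \<open>r\<close> replaced by its lower bound - \<rho>. In that situation P is at least
  13/5.\<close>

lemma cc_odd: "P \<ge> 13 / 5 \<Longrightarrow> \<kappa> - 1 + \<rho> \<le> cc * P"
proof (cases "R \<le> 3")
  case True
  assume P: "P \<ge> 13 / 5"
  have k: "\<kappa> = 4 / 3 * \<rho>" using True by (simp add: \<kappa>_def)
  have "\<rho> * (1 - 4 / 3 * \<theta>) \<ge> 434 / 1000 * (1 - 4 / 3 * (3028 / 10000))"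
    using \<rho>_small[OF True] \<theta>_small[OF True] by (intro mult_mono) auto
  then have "cc \<ge> 25 / 100" by (simp add: cc_def k algebra_simps)
  then have "cc * P \<ge> 25 / 100 * (13 / 5)" using P by (intro mult_mono) auto
  then show ?thesis using \<rho>_small[OF True] k by simp
next
  case False
  assume P: "P \<ge> 13 / 5"
  have "cc * P \<ge> 0" using P cc_bounds by simp
  then show ?thesis using \<kappa>_le \<rho>_large False by simp
qed

text \<open>Makes the slope \<open>kM\<close> accessible to \<open>region_line\<close>. The
  comparison rests on \<rho> (s + \<theta> - 1) = 1 and A \<ge> s - 1.\<close>

lemma kM_le_\<kappa>: "kM \<le> \<kappa>"
proof -
  have r: "\<rho> * (s + \<theta> - 1) = 1" using \<rho>_s by (simp add: algebra_simps)
  have As: "A \<ge> s - 1" using small_R large_R by (cases "R \<le> 3") force+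
  have "1 - al + \<rho> \<le> 4 / 3 * \<rho> * (A + \<theta> - al)" if "R \<le> 3"
  proof -
    have "A = s + 1" using small_R that by simp
    then have "\<rho> * (A + \<theta> - al) = 1 + \<rho> * (2 - al)" using r by (simp add: algebra_simps)
    moreover have "\<rho> * (2 - al) \<ge> \<rho> * 1" using al_le \<rho>_pos by (intro mult_left_mono) auto
    ultimately have "1 + \<rho> \<le> \<rho> * (A + \<theta> - al)" by linarith
    then show ?thesis using al_pos \<rho>_pos unfolding mult.assoc by linarith
  qed
  moreover have "1 - al + \<rho> \<le> 7 / 4 * \<rho> * (A + \<theta> - al)" if "4 \<le> R"
  proof -
    have "\<rho> * (A + \<theta> - al) \<ge> \<rho> * (s - 1 + \<theta> - al)"
      using As \<rho>_pos by (intro mult_left_mono) auto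
    then have "\<rho> * (A + \<theta> - al) \<ge> 1 - \<rho> * al" using r by (simp add: algebra_simps)
    moreover have "\<rho> * al \<le> 2386 / 10000 * (2 / 5)"
      using \<rho>_large[OF that] al_le al_pos by (intro mult_mono) auto
    ultimately show ?thesis using al_pos \<rho>_large[OF that] by (simp add: mult.assoc)
  qed
  moreover have "7 / 4 * \<rho> * (A + \<theta> - al) \<le> \<kappa> * (A + \<theta> - al)" if "4 \<le> R"
    using den_pos \<rho>_pos that by (intro mult_right_mono) (auto simp: \<kappa>_def)
  moreover have "4 / 3 * \<rho> * (A + \<theta> - al) \<le> \<kappa> * (A + \<theta> - al)"
    using den_pos \<kappa>_ge by (intro mult_right_mono) auto
  ultimately have "kM * (A + \<theta> - al) \<le> \<kappa> * (A + \<theta> - al)"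
    unfolding kM_eq by (cases "R \<le> 3") force+
  then show ?thesis using den_pos by (simp add: mult_le_cancel_right)
qed

lemma kM_bounds: "kM \<ge> 0 \<and> (R \<le> 3 \<longrightarrow> 264 / 1000 \<le> kM) \<and> (4 \<le> R \<longrightarrow> kM \<le> 32 / 100 \<and> 68 / 100 \<le> kM * (s + \<theta>))"
proof (intro conjI impI)
  show "kM \<ge> 0" using kM_pos by simp
  show "264 / 1000 \<le> kM" if "R \<le> 3"
  proof -
    have "264 / 1000 * (A + \<theta> - al) \<le> 1 - al + \<rho>"
      using small_R[OF that] \<theta>_small[OF that] \<rho>_small[OF that] al_le by (simp add: field_simps)
    then show ?thesis using den_pos by (simp add: kM_def pos_le_divide_eq)
  qed
  show k: "kM \<le> 32 / 100" if "4 \<le> R"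
  proof -
    have "1 - al + \<rho> \<le> 32 / 100 * (A + \<theta> - al)"
      using A4 \<theta>_pos \<rho>_large[OF that] al_pos by (simp add: field_simps)
    then show ?thesis using den_pos by (simp add: kM_def pos_divide_le_eq)
  qed
  show "68 / 100 \<le> kM * (s + \<theta>)" if "4 \<le> R"
  proof -
    have "A \<le> s + 1" using large_R[OF that] by auto
    then have "kM * (A + \<theta>) \<le> kM * (s + \<theta> + 1)" using kM_pos by (intro mult_left_mono) auto
    moreover have "kM * (s + \<theta> + 1) = kM * (s + \<theta>) + kM" by (simp add: algebra_simps)
    ultimately show ?thesis using kM_ge k[OF that] by linarith
  qed
qed

text \<open>The analogue of \<open>kM\<close> for odd quotients: P - 2 - r \<ge> (1 -
  \<open>k2\<close>)(P - \<eta>), with equality for quotient \<open>s\<close>, b = \<theta>, r =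
  \<rho>. Then (1 - \<open>k2\<close>)(1 - \<eta>) is the value of the rival configuration: a
  quotient \<open>s\<close> with the extremal past, followed by a minus sign, x = \<eta> and t =
  0.\<close>

definition k2 :: real where "k2 = (2 - \<eta> + \<rho>) / (s + \<theta> - \<eta>)"

lemma den2_pos: "2 < s + \<theta> - \<eta>" using s3 \<theta>_pos \<eta>_half by simp

lemma k2_eq: "k2 * (s + \<theta> - \<eta>) = 2 - \<eta> + \<rho>" using den2_pos by (simp add: k2_def)

lemma k2_pos: "0 < k2" using den2_pos \<eta>_half \<rho>_pos by (simp add: k2_def)

lemma k2_le_\<kappa>: "4 \<le> R \<Longrightarrow> k2 \<le> \<kappa>"
proof -
  assume R: "4 \<le> R"
  have r: "\<rho> * (s + \<theta> - \<eta>) = 1 + \<rho> * (1 - \<eta>)" using \<rho>_s by (simp add: algebra_simps)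
  have "2 - \<eta> + \<rho> \<le> \<kappa> * (s + \<theta> - \<eta>)"
  proof (cases "R = 4")
    case True
    then have "A = 4" unfolding A_def R_sstar_def by simp
    then have "\<eta> * (4 - \<eta>) = 1" using \<eta>_eq R by simp
    then have "4 * \<eta> = 1 + \<eta> * \<eta>" by (simp add: algebra_simps)
    moreover have "0 \<le> \<eta> * \<eta>" by simp
    ultimately have "\<eta> \<ge> 1 / 4" by linarith
    then have "(\<eta> - 1 / 4) * (1 - 7 / 4 * \<rho>) \<ge> 0" using \<rho>_large[OF R] by (intro mult_nonneg_nonneg) auto
    moreover have "7 / 4 * (1 + \<rho> * (1 - \<eta>)) - (2 - \<eta> + \<rho>) = (\<eta> - 1 / 4) * (1 - 7 / 4 * \<rho>) + 5 / 16 * \<rho>"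
      by (simp add: field_simps)
    ultimately have "2 - \<eta> + \<rho> \<le> 7 / 4 * (1 + \<rho> * (1 - \<eta>))" using \<rho>_pos by linarith
    moreover have "\<kappa> = 7 / 4 * \<rho>" unfolding \<kappa>_def using True by simp
    ultimately show ?thesis using r by (metis mult.assoc)
  next
    case False
    have "\<eta> * (1 - \<rho>) + \<rho> * (1 - \<eta>) \<ge> 0" using \<eta>_pos \<eta>_half \<rho>_pos \<rho>_less by (intro add_nonneg_nonneg mult_nonneg_nonneg) auto
    then have "2 - \<eta> + \<rho> \<le> 2 * (1 + \<rho> * (1 - \<eta>))" by (simp add: algebra_simps)
    then show ?thesis using r False R by (simp add: \<kappa>_def)
  qed
  then have "k2 * (s + \<theta> - \<eta>) \<le> \<kappa> * (s + \<theta> - \<eta>)" by (simp add: k2_eq)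
  then show ?thesis using den2_pos by (simp add: mult_le_cancel_right)
qed

text \<open>Lets even quotients share the slope \<open>k2\<close>: there only 1 - r is lost, which
  is at most 1 + \<rho> up to the error. The number 5/18 is the bound for |b| in
  \<open>b_range\<close>.\<close>

lemma k2_ge: "4 \<le> R \<Longrightarrow> P \<ge> A - 5 / 18 \<Longrightarrow> 1 + \<rho> \<le> k2 * P"
proof -
  assume R: "4 \<le> R" and P: "P \<ge> A - 5 / 18"
  have As: "A \<ge> s - 1" and s5: "s \<ge> 5" using large_R[OF R] by auto
  have 1: "s * (1 - \<eta>) \<ge> 5 * (73 / 100)" using s5 \<eta>_large[OF R] by (intro mult_mono) auto
  have 2: "(1 + \<rho>) * (\<theta> - \<eta>) \<le> 2 * (1926 / 10000)"
  proof -
    have "(1 + \<rho>) * (\<theta> - \<eta>) \<le> (1 + \<rho>) * \<theta>" using \<eta>_pos \<rho>_pos by (intro mult_left_mono) auto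
    also have "\<dots> \<le> 2 * (1926 / 10000)"
      using \<theta>_large[OF R] \<theta>_pos \<rho>_pos \<rho>_less by (intro mult_mono) auto
    finally show ?thesis .
  qed
  have "(1 + \<rho>) * (s + \<theta> - \<eta>) = s * (1 + \<rho>) + (1 + \<rho>) * (\<theta> - \<eta>)" by (simp add: algebra_simps)
  also have "\<dots> \<le> (2 - \<eta> + \<rho>) * (s - 23 / 18)"
  proof -
    have "(2 - \<eta> + \<rho>) * (s - 23 / 18) = s * (1 + \<rho>) + s * (1 - \<eta>) - 23 / 18 * (2 - \<eta> + \<rho>)"
      by (simp add: field_simps)
    moreover have "p + z \<le> p + q - 23 / 18 * (2 - \<eta> + \<rho>)"
      if "q \<ge> 5 * (73 / 100)" "z \<le> 2 * (1926 / 10000)" for p q z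
      using that \<eta>_pos \<rho>_large[OF R] by (simp add: field_simps)
    ultimately show ?thesis using 1 2 by metis
  qed
  also have "\<dots> \<le> (2 - \<eta> + \<rho>) * P" using P As \<eta>_half \<rho>_pos by (intro mult_left_mono) auto
  also have "\<dots> = k2 * P * (s + \<theta> - \<eta>)" by (simp add: k2_eq[symmetric])
  finally show ?thesis using den2_pos by (simp add: mult_le_cancel_right)
qed

text \<open>Compares the extremal value N2 / D2 with the rival N1 / D1. The equation for \<eta>
  makes N1 - N2 and D1 - D2 multiples of A + 1 - s and A - s. These are 0 and -1 if A = s - 1, where
  the claim is immediate, and 2 and 1 if A = s + 1.\<close>

lemma T_le_k2: "4 \<le> R \<Longrightarrow> T \<le> (1 - k2) * (1 - \<eta>)"
proof -
  assume R: "4 \<le> R"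
  have s5: "s \<ge> 5" and As: "A = s + 1 \<or> A = s - 1" using large_R[OF R] by auto
  have h: "\<eta> * (A - \<eta>) = 1" using \<eta>_eq R by simp
  define w where "w = \<theta> - \<rho>"
  define U where "U = s - \<eta>"
  have U4: "U > 4" using s5 \<eta>_half by (simp add: U_def)
  have alU: "al * U = 1" using al_eq by (simp add: U_def)
  define N2 where "N2 = (U - 2) * (A - 1 + w)"
  define D2 where "D2 = U * (A + \<theta>) - 1"
  define N1 where "N1 = (s - 2 + w) * (A - 1 - \<eta>)"
  define D1 where "D1 = (U + \<theta>) * (A - \<eta>)"
  have D2_eq: "D2 = U * (A + \<theta> - al)" using alU by (simp add: D2_def algebra_simps)
  have D2_pos: "0 < D2" unfolding D2_eq using U4 den_pos by simp
  have D1_pos: "0 < D1" unfolding D1_def using U4 \<theta>_pos A4 \<eta>_half by simp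
  have "U - 2 = U * (1 - 2 * al)" using alU by (simp add: algebra_simps)
  then have "N2 = U * (1 - 2 * al) * (A - 1 + w)" by (simp add: N2_def)
  then have TN: "T = N2 / D2"
    unfolding T_def G_def D2_eq w_def using U4 den_pos by simp
  have A\<eta>: "A - \<eta> > 0" using A4 \<eta>_half by simp
  have "(1 - \<eta>) * (A - \<eta>) = A - 1 - \<eta>" using h by (simp add: algebra_simps)
  then have "N1 / D1 = (s - 2 + w) * ((1 - \<eta>) * (A - \<eta>)) / ((U + \<theta>) * (A - \<eta>))"
    by (simp add: N1_def D1_def)
  also have "\<dots> = (s - 2 + w) / (U + \<theta>) * (1 - \<eta>)" using A\<eta> by simp
  also have "(s - 2 + w) / (U + \<theta>) = 1 - k2"
    using den2_pos by (simp add: k2_def U_def w_def field_simps)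
  finally have KN: "(1 - k2) * (1 - \<eta>) = N1 / D1" by simp
  have dN: "N1 = N2 + (w + \<eta>) * (A + 1 - s)" by (simp add: N1_def N2_def U_def algebra_simps)
  have "D1 - D2 = 1 + (\<theta> * (A - s) - U * \<eta>)" by (simp add: D1_def D2_def U_def algebra_simps)
  also have "\<dots> = \<eta> * (A - \<eta>) + (\<theta> * (A - s) - U * \<eta>)" using h by simp
  also have "\<dots> = (\<theta> + \<eta>) * (A - s)" by (simp add: U_def algebra_simps)
  finally have dD: "D1 = D2 + (\<theta> + \<eta>) * (A - s)" by simp
  have w0: "0 < N2" using TN T_pos D2_pos by (simp add: zero_less_divide_iff)
  have "N2 * D1 \<le> N1 * D2"
  proof (cases "A = s - 1")
    case True
    then have "N1 = N2" "D1 \<le> D2" using dN dD \<theta>_pos \<eta>_pos by auto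
    then show ?thesis using w0 by (simp add: mult_left_mono)
  next
    case False
    then have A: "A = s + 1" using As by simp
    \<comment> \<open>A rational upper bound for \<open>T\<close>. Together with \<eta> \<ge>
      1/(s+1) and \<theta> \<le> 1/s it turns the claim into a polynomial inequality in s, whose
      positivity is visible after division by s - 5.\<close>
    define m where "m = (1 - 2 / s) * (1 - 1 / (s + 2))"
    have "al \<ge> 1 / s" unfolding al_def using s5 \<eta>_pos \<eta>_half by (intro divide_left_mono) auto
    moreover have "kM \<ge> 1 / (s + 2)"
    proof -
      have "kM * (A + \<theta>) \<le> kM * (s + 2)" using A \<theta>_third kM_pos by (intro mult_left_mono) auto
      then have "1 \<le> kM * (s + 2)" using kM_ge by linarith
      then show ?thesis using s5 by (simp add: field_simps)
    qed
    ultimately have "T \<le> m"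
      unfolding T_def G_kM m_def using kM_half al_le s5 by (intro mult_mono) auto
    then have Nm: "N2 \<le> m * D2" using TN D2_pos by (simp add: field_simps)
    have "1 \<le> \<eta> * (s + 1)" using h A \<eta>_pos mult_pos_pos[of \<eta> \<eta>] by (simp add: algebra_simps)
    then have e1: "1 / (s + 1) \<le> \<eta>" using s5 by (simp add: field_simps)
    have e2: "\<theta> \<le> 1 / s" using \<theta>_s s5 by (simp add: field_simps)
    have "\<theta> * \<theta> / (1 - \<theta>) \<le> (1 / s * (1 / s)) / (1 - 1 / s)"
      using e2 \<theta>_pos s5 by (intro frac_le mult_mono) auto
    also have "\<dots> = 1 / (s * (s - 1))" using s5 by (simp add: field_simps)
    finally have e3: "w \<ge> - (1 / (s * (s - 1)))"
      using \<theta>_third by (simp add: w_def \<rho>_def field_simps)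
    have m2: "m \<le> 2" "0 \<le> m"
      unfolding m_def using s5 mult_mono[of "1 - 2 / s" 1 "1 - 1 / (s + 2)" 1] by auto
    have "0 \<le> (2 - m) / (s + 1) - 2 / (s * (s - 1)) - m / s"
    proof -
      have "(2 - m) / (s + 1) - 2 / (s * (s - 1)) - m / s
         = ((s\<^sup>2 + 5 * s + 2) * s * (s - 1) - 2 * s * (s + 1) * (s + 2) - (s - 2) * (s + 1) * (s + 1) * (s - 1))
           / (s * s * (s - 1) * (s + 1) * (s + 2))"
        using s5 by (simp add: m_def divide_simps) (simp add: algebra_simps power2_eq_square)
      moreover have "(s\<^sup>2 + 5 * s + 2) * s * (s - 1) - 2 * s * (s + 1) * (s + 2) - (s - 2) * (s + 1) * (s + 1) * (s - 1)
        = (s - 5) * (3 * s\<^sup>2 + 9 * s + 38) + 188" 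
        by (simp add: algebra_simps power2_eq_square power3_eq_cube)
      moreover have "0 \<le> (s - 5) * (3 * s\<^sup>2 + 9 * s + 38) + 188"
        using s5 by (intro add_nonneg_nonneg mult_nonneg_nonneg) auto
      ultimately show ?thesis using s5 by simp
    qed
    also have "\<dots> \<le> (2 - m) * \<eta> + 2 * w - m * \<theta>"
      using mult_left_mono[OF e1, of "2 - m"] mult_left_mono[OF e2, of m] e3 m2 by simp
    finally have "m * (\<theta> + \<eta>) \<le> 2 * (w + \<eta>)" by (simp add: algebra_simps)
    then have "N2 * (\<theta> + \<eta>) \<le> 2 * (w + \<eta>) * D2"
      using mult_right_mono[OF Nm, of "\<theta> + \<eta>"] mult_right_mono[of "m * (\<theta> + \<eta>)" "2 * (w + \<eta>)" D2]
        \<theta>_pos \<eta>_pos D2_pos by (simp add: algebra_simps)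
    then show ?thesis unfolding dN dD A by (simp add: algebra_simps)
  qed
  then show ?thesis unfolding TN KN using D1_pos D2_pos by (simp add: divide_simps mult.commute)
qed

end

section \<open>The four smallest lattice points\<close>

context bound_params
begin

definition region :: "real \<Rightarrow> real \<Rightarrow> real \<Rightarrow> bool" where
  "region e b r \<longleftrightarrow> \<bar>r\<bar> \<le> \<rho> + e \<and> r - \<kappa> * b \<le> cc + e"

text \<open>An interval invariant under the map from b to \<epsilon> / (a + b): the denominators are
  at least 2 - 2/5, at least 3 - 2/5 when \<epsilon> = -1, and at least 4 - 2/5 when R \<ge>
  4.\<close>

definition b_range :: "real \<Rightarrow> bool" where
  "b_range b \<longleftrightarrow> - (2 / 5) \<le> b \<and> b \<le> 5 / 8 \<and> (4 \<le> R \<longrightarrow> \<bar>b\<bar> \<le> 5 / 18)"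

text \<open>The sign is the one of the following quotient. The second alternative is the nearest
  integer rule that a quotient 2 is never followed by a minus sign.\<close>

definition admissible :: "int \<Rightarrow> real \<Rightarrow> bool" where
  "admissible a \<epsilon> \<longleftrightarrow> int R \<le> a \<and> (\<epsilon> = 1 \<or> \<epsilon> = - 1 \<and> 3 \<le> a)"

text \<open>The last two bounds are sharp, the first at (\<eta>, 0), the second at
  (\<open>al\<close>, \<open>al\<close>).\<close>

definition future :: "real \<Rightarrow> real \<Rightarrow> bool" where
  "future x t \<longleftrightarrow> 0 < x \<and> x \<le> 1 / 2 \<and> (3 \<le> R \<longrightarrow> x \<le> 2 / 5) \<and> 0 \<le> t \<and> t \<le> x \<and>
     x - t \<le> \<eta> \<and> x + t \<le> 2 * al"

text \<open>A slope between 0 and \<kappa> is a convex combination of the two, and \<rho> - k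
  \<theta> interpolates between \<rho> and \<open>cc\<close>.\<close>

lemma region_line:
  assumes "region e b r" "0 \<le> k" "k \<le> \<kappa>"
  shows "r - k * b \<le> \<rho> - k * \<theta> + e"
proof -
  define l where "l = k / \<kappa>"
  have l: "0 \<le> l" "l \<le> 1" "k = l * \<kappa>" using assms \<kappa>_pos by (auto simp: l_def)
  have 1: "(1 - l) * r \<le> (1 - l) * (\<rho> + e)"
    using assms(1) l by (intro mult_left_mono) (auto simp: region_def)
  have 2: "l * (r - \<kappa> * b) \<le> l * (cc + e)"
    using assms(1) l by (intro mult_left_mono) (auto simp: region_def)
  have "r - k * b = (1 - l) * r + l * (r - \<kappa> * b)" by (simp add: l(3) algebra_simps)
  also have "\<dots> \<le> (1 - l) * (\<rho> + e) + l * (cc + e)" using 1 2 by linarith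
  also have "\<dots> = \<rho> - k * \<theta> + e" by (simp add: l(3) cc_def algebra_simps)
  finally show ?thesis .
qed

lemma odd_ge_s: "int R \<le> a \<Longrightarrow> odd a \<Longrightarrow> s \<le> real_of_int a"
proof -
  assume a: "int R \<le> a" "odd a"
  then have "int (R_star R) \<le> a"
    by (cases "int R = a") (auto simp: R_star_def)
  then show ?thesis unfolding s_def by linarith
qed

lemma even_ge_A: "int R \<le> a \<Longrightarrow> even a \<Longrightarrow> 3 \<le> a \<Longrightarrow> A \<le> real_of_int a"
proof -
  assume a: "int R \<le> a" "even a" "3 \<le> a"
  then have "int (R_sstar R) \<le> a"
    by (cases "int R = a") (auto simp: R_sstar_def)
  moreover have "4 \<le> a" using a by presburger
  ultimately show ?thesis unfolding A_def by linarith
qed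

lemma b_range_step:
  assumes b: "- (2 / 5) \<le> b" "b \<le> 5 / 8" and adm: "admissible a \<epsilon>"
  shows "8 / 5 \<le> real_of_int a + b" "\<epsilon> = - 1 \<Longrightarrow> 13 / 5 \<le> real_of_int a + b"
    "b_range (\<epsilon> / (real_of_int a + b))"
proof -
  have a2: "2 \<le> real_of_int a" using adm R2 unfolding admissible_def by linarith
  show P: "8 / 5 \<le> real_of_int a + b" using a2 b by simp
  show P3: "13 / 5 \<le> real_of_int a + b" if "\<epsilon> = - 1"
    using that adm b unfolding admissible_def by linarith
  have P4: "18 / 5 \<le> real_of_int a + b" if "4 \<le> R"
    using that adm b unfolding admissible_def by linarith
  have u: "1 / (real_of_int a + b) \<le> 5 / 8" using P by (simp add: field_simps)
  have l: "1 / (real_of_int a + b) \<le> 2 / 5" if "\<epsilon> = - 1" using P3[OF that] by (simp add: field_simps)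
  have m: "1 / (real_of_int a + b) \<le> 5 / 18" if "4 \<le> R" using P4[OF that] by (simp add: field_simps)
  have p: "1 / (real_of_int a + b) > 0" using P by simp
  define z where "z = 1 / (real_of_int a + b)"
  have e: "\<epsilon> / (real_of_int a + b) = \<epsilon> * z" by (simp add: z_def)
  show "b_range (\<epsilon> / (real_of_int a + b))"
  proof (cases "\<epsilon> = 1")
    case True
    then show ?thesis using u m p unfolding b_range_def e z_def[symmetric] by auto
  next
    case False
    then have "\<epsilon> = - 1" using adm by (simp add: admissible_def)
    then show ?thesis using l m p unfolding b_range_def e z_def[symmetric] by auto
  qed
qed

text \<open>The linear constraints are chosen so that the extremal past, all partial quotients equal to
  \<open>R\<^sub>*\<close> with positive signs, whose state is \<open>(\<theta>\<^sub>1, \<rho>)\<close>, is a vertex of the limiting region.\<close>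

lemma region_step:
  assumes b: "- (2 / 5) \<le> b" "b \<le> 5 / 8" and adm: "admissible a \<epsilon>" and e: "0 \<le> e"
    and reg: "region e b r"
    and b': "b' = \<epsilon> / (real_of_int a + b)"
    and r': "r' = (if odd a then b' * (1 + r) else - b' * r)"
  shows "region (5 / 8 * e) b' r'"
proof -
  define P where "P = real_of_int a + b"
  have P: "8 / 5 \<le> P" and P3: "\<epsilon> = - 1 \<Longrightarrow> 13 / 5 \<le> P"
    using b_range_step[OF b adm] by (auto simp: P_def)
  have eP: "(X + e) / P \<le> X / P + 5 / 8 * e" for X
  proof -
    have "e / P \<le> e / (8 / 5)" using P e by (intro divide_left_mono) auto
    then show ?thesis by (simp add: add_divide_distrib)
  qed
  have bnd: "Y / P \<le> C + 5 / 8 * e" if "Y \<le> C * P + e" for Y C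
  proof -
    have "Y / P \<le> (C * P + e) / P" using that P by (intro divide_right_mono) auto
    also have "\<dots> \<le> C * P / P + 5 / 8 * e" by (rule eP)
    finally show ?thesis using P by simp
  qed
  have r: "r \<le> \<rho> + e" "- r \<le> \<rho> + e" using reg by (auto simp: region_def)
  have \<epsilon>: "\<epsilon> = 1 \<or> \<epsilon> = - 1" and aR: "int R \<le> a" using adm by (auto simp: admissible_def)
  have line\<rho>: "r - \<rho> * b \<le> \<rho> - \<rho> * \<theta> + e"
    using region_line[OF reg, of \<rho>] \<rho>_pos \<kappa>_ge by simp
  have linec: "r - cc * b \<le> \<rho> - cc * \<theta> + e"
    using region_line[OF reg, of cc] cc_bounds by simp
  have bP: "b' = \<epsilon> * (1 / P)" using b' by (simp add: P_def)
  have \<rho>P: "0 \<le> \<rho> * P" using \<rho>_pos P by simp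
  have cP: "0 \<le> cc * P" using cc_bounds P by simp
  show ?thesis
  proof (cases "odd a")
    case True
    have sa: "s \<le> real_of_int a" using odd_ge_s aR True by blast
    have "\<rho> * s \<le> \<rho> * real_of_int a" using sa \<rho>_pos by simp
    then have "1 + r \<le> \<rho> * P + e"
      using line\<rho> \<rho>_s by (simp add: P_def algebra_simps)
    then have 1: "(1 + r) / P \<le> \<rho> + 5 / 8 * e" by (rule bnd)
    have "- (1 + r) \<le> \<rho> * P + e" using r \<rho>P \<rho>_less by linarith
    then have "(- (1 + r)) / P \<le> \<rho> + 5 / 8 * e" by (rule bnd)
    then have 2: "\<bar>(1 + r) / P\<bar> \<le> \<rho> + 5 / 8 * e" using 1 unfolding abs_le_iff minus_divide_left by simp
    have r'': "r' = \<epsilon> * ((1 + r) / P)" using r' True bP by simp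
    have "cc * s \<le> cc * real_of_int a" using sa cc_bounds by simp
    then have "1 + r - \<kappa> \<le> cc * P + e"
      using linec cc_s by (simp add: P_def algebra_simps)
    then have 3: "(1 + r - \<kappa>) / P \<le> cc + 5 / 8 * e" by (rule bnd)
    have 4: "(\<kappa> - (1 + r)) / P \<le> cc + 5 / 8 * e" if "\<epsilon> = - 1"
      using cc_odd[OF P3[OF that]] r by (intro bnd) linarith
    have "r' - \<kappa> * b' = \<epsilon> * ((1 + r - \<kappa>) / P)" by (simp add: r'' bP diff_divide_distrib algebra_simps)
    then have "r' - \<kappa> * b' \<le> cc + 5 / 8 * e"
      using \<epsilon> 3 4 by (auto simp: minus_divide_left)
    moreover have "\<bar>r'\<bar> = \<bar>(1 + r) / P\<bar>" unfolding r'' abs_mult using \<epsilon> by auto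
    then have "\<bar>r'\<bar> \<le> \<rho> + 5 / 8 * e" using 2 by simp
    ultimately show ?thesis by (simp add: region_def)
  next
    case False
    have r'': "r' = - \<epsilon> * (r / P)" using r' False bP by simp
    have \<rho>P': "\<rho> \<le> \<rho> * P" using \<rho>_pos P by simp
    have "r / P \<le> \<rho> + 5 / 8 * e" using r \<rho>P' by (intro bnd) linarith
    moreover have "(- r) / P \<le> \<rho> + 5 / 8 * e" using r \<rho>P' by (intro bnd) linarith
    ultimately have "\<bar>r / P\<bar> \<le> \<rho> + 5 / 8 * e" unfolding abs_le_iff minus_divide_left by simp
    then have 2: "\<bar>r'\<bar> \<le> \<rho> + 5 / 8 * e" using \<epsilon> r'' by auto
    have "- r - \<kappa> \<le> cc * P + e" using r cP \<kappa>_ge \<rho>_pos by linarith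
    then have 3: "(- r - \<kappa>) / P \<le> cc + 5 / 8 * e" by (rule bnd)
    have 4: "(\<kappa> + r) / P \<le> cc + 5 / 8 * e" if "\<epsilon> = - 1"
    proof (rule bnd)
      have "A \<le> real_of_int a" using even_ge_A aR False adm that by (auto simp: admissible_def)
      then have "cc * A \<le> cc * real_of_int a" using cc_bounds by simp
      then show "\<kappa> + r \<le> cc * P + e" using cc_A linec by (simp add: P_def algebra_simps)
    qed
    have "r' - \<kappa> * b' = \<epsilon> * ((- r - \<kappa>) / P)" by (simp add: r'' bP diff_divide_distrib algebra_simps)
    then have "r' - \<kappa> * b' \<le> cc + 5 / 8 * e"
      using \<epsilon> 3 4 by (auto simp: minus_divide_left)
    then show ?thesis using 2 by (simp add: region_def)
  qed
qed

text \<open>The four functions are \<open>approx_val\<close> at (u, v) = (1, 1), (-1, 1), (1, -1),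
  (-1, -1) in this order, with the absolute values resolved; \<open>FB\<close> carries the extremal
  case.\<close>

definition FA where "FA b r x t = (1 - b + r) * (1 + x - t) / (1 + x * b)" for b r x t :: real
definition FB where "FB b r x t = (1 + b - r) * (1 - x - t) / (1 + x * b)" for b r x t :: real
definition FC where "FC b r x t = (1 + b + r) * (1 - x + t) / (1 + x * b)" for b r x t :: real
definition FD where "FD b r x t = (1 - b - r) * (1 + x + t) / (1 + x * b)" for b r x t :: real

end

text \<open>The pair \<open>(b, r)\<close> is the past before the quotient \<open>a\<close>,
  \<open>(b', r')\<close> the past after it, and \<open>(x, t)\<close> the future from there on.
  Corner values at the later index are thus expressed through the quotient just passed, whose parity
  decides the estimate.\<close>

locale one_step = bound_params +
  fixes e b r \<epsilon> x t :: real and a :: int and b' r' P :: real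
  assumes e: "0 \<le> e" "e \<le> 1 / 100" and bR: "b_range b" and reg: "region e b r"
    and adm: "admissible a \<epsilon>" and fut: "future x t"
    and b'_def: "b' = \<epsilon> / (real_of_int a + b)"
    and r'_def: "r' = (if odd a then b' * (1 + r) else - b' * r)"
    and P_def: "P = real_of_int a + b"
begin

lemma b_lo: "- (2 / 5) \<le> b" and b_hi: "b \<le> 5 / 8" and b_large: "4 \<le> R \<Longrightarrow> \<bar>b\<bar> \<le> 5 / 18"
  using bR by (auto simp: b_range_def)

lemma r_hi: "r \<le> \<rho> + e" and r_lo: "- r \<le> \<rho> + e" using reg by (auto simp: region_def)

lemma r_half: "r \<le> 4444 / 10000" "- r \<le> 4444 / 10000"
  using r_hi r_lo \<rho>_less e by auto

lemma x_pos: "0 < x" and x_half: "x \<le> 1 / 2" and x_R3: "3 \<le> R \<Longrightarrow> x \<le> 2 / 5"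
  and t_pos: "0 \<le> t" and t_le: "t \<le> x" and xt: "x - t \<le> \<eta>" and xt2: "x + t \<le> 2 * al"
  using fut by (auto simp: future_def)

lemma aR: "int R \<le> a" and \<epsilon>_cases: "\<epsilon> = 1 \<or> \<epsilon> = - 1" using adm by (auto simp: admissible_def)

lemma P_ge: "8 / 5 \<le> P" using b_range_step(1)[OF b_lo b_hi adm] by (simp add: P_def)

lemma b'P: "b' = \<epsilon> / P" by (simp add: b'_def P_def)

lemma den_eq: "1 + x * b' = (P + \<epsilon> * x) / P" using P_ge by (simp add: b'P field_simps)

lemma Pex_pos: "0 < P + \<epsilon> * x" using P_ge \<epsilon>_cases x_half x_pos by auto

lemma quot: "(c / P) * d / (1 + x * b') = c * d / (P + \<epsilon> * x)"
  using P_ge Pex_pos by (simp add: den_eq)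

lemma P_odd: "odd a \<Longrightarrow> s - 2 / 5 \<le> P" using odd_ge_s aR b_lo unfolding P_def by fastforce
lemma P_odd3: "odd a \<Longrightarrow> 13 / 5 \<le> P" using P_odd s3 by fastforce
lemma P_even: "even a \<Longrightarrow> a \<noteq> 2 \<Longrightarrow> A - 2 / 5 \<le> P"
proof -
  assume a: "even a" "a \<noteq> 2"
  have "3 \<le> a" using a aR R2 by linarith
  then show ?thesis using even_ge_A[OF aR] a b_lo unfolding P_def by simp
qed

lemma a_ge2: "2 \<le> a" using aR R2 by linarith
lemma neg_a: "\<epsilon> = - 1 \<Longrightarrow> a \<noteq> 2" using adm by (auto simp: admissible_def)

lemma even_sub: "even a \<Longrightarrow> b' - r' = \<epsilon> * (1 + r) / P" "even a \<Longrightarrow> b' + r' = \<epsilon> * (1 - r) / P"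
  by (simp_all add: r'_def b'P algebra_simps add_divide_distrib diff_divide_distrib)
lemma odd_sub: "odd a \<Longrightarrow> b' - r' = - \<epsilon> * r / P" "odd a \<Longrightarrow> b' + r' = \<epsilon> * (2 + r) / P"
  by (simp_all add: r'_def b'P algebra_simps add_divide_distrib diff_divide_distrib)

text \<open>Clearing the denominator P of \<open>b'\<close> and \<open>r'\<close> leaves P +
  \<epsilon> x below, and in the numerator a correction of P that is linear in \<open>r\<close>, so
  that the constraints on \<open>(b, r)\<close> apply directly.\<close>

lemma FA_eq: "FA b' r' x t = (P - \<epsilon> * (if even a then 1 + r else - r)) * (1 + x - t) / (P + \<epsilon> * x)"
proof -
  have "1 - b' + r' = 1 - (b' - r')" by simp
  also have "\<dots> = (P - \<epsilon> * (if even a then 1 + r else - r)) / P"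
    using even_sub odd_sub P_ge by (auto simp: diff_divide_distrib)
  finally show ?thesis by (simp only: FA_def quot)
qed

lemma FB_eq: "FB b' r' x t = (P + \<epsilon> * (if even a then 1 + r else - r)) * (1 - x - t) / (P + \<epsilon> * x)"
proof -
  have "1 + b' - r' = 1 + (b' - r')" by simp
  also have "\<dots> = (P + \<epsilon> * (if even a then 1 + r else - r)) / P"
    using even_sub odd_sub P_ge by (auto simp: diff_divide_distrib add_divide_distrib)
  finally show ?thesis by (simp only: FB_def quot)
qed

lemma FC_eq: "FC b' r' x t = (P + \<epsilon> * (if even a then 1 - r else 2 + r)) * (1 - x + t) / (P + \<epsilon> * x)"
proof -
  have "1 + b' + r' = 1 + (b' + r')" by simp
  also have "\<dots> = (P + \<epsilon> * (if even a then 1 - r else 2 + r)) / P"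
    using even_sub odd_sub P_ge by (auto simp: diff_divide_distrib add_divide_distrib)
  finally show ?thesis by (simp only: FC_def quot)
qed

lemma FD_eq: "FD b' r' x t = (P - \<epsilon> * (if even a then 1 - r else 2 + r)) * (1 + x + t) / (P + \<epsilon> * x)"
proof -
  have "1 - b' - r' = 1 - (b' + r')" by simp
  also have "\<dots> = (P - \<epsilon> * (if even a then 1 - r else 2 + r)) / P"
    using even_sub odd_sub P_ge by (auto simp: diff_divide_distrib add_divide_distrib)
  finally show ?thesis by (simp only: FD_def quot)
qed

text \<open>Decimal form of the constraint with slope \<kappa> = 4/3 \<rho>; 271/1000 collects
  26/100 for \<open>cc\<close>, 1/100 for \<open>e\<close> and 1/1000 for rounding the
  slope.\<close>

lemma line_small: "R \<le> 3 \<Longrightarrow> r \<le> 271 / 1000 + 579 / 1000 * b"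
proof -
  assume R: "R \<le> 3"
  have k: "\<kappa> = 4 / 3 * \<rho>" using R by (simp add: \<kappa>_def)
  have k1: "578 / 1000 \<le> \<kappa>" "\<kappa> \<le> 5793 / 10000" using \<rho>_small[OF R] k by auto
  have "\<kappa> * \<theta> \<ge> 578 / 1000 * (3027 / 10000)" using k1 \<theta>_small[OF R] by (intro mult_mono) auto
  then have c: "cc \<le> 26 / 100" using \<rho>_small[OF R] by (simp add: cc_def)
  have "(\<kappa> - 579 / 1000) * b \<le> 1 / 1000"
  proof -
    have "(\<kappa> - 579 / 1000) * b \<le> \<bar>\<kappa> - 579 / 1000\<bar> * \<bar>b\<bar>" by (metis abs_ge_self abs_mult)
    also have "\<bar>\<kappa> - 579 / 1000\<bar> \<le> 1 / 1000" unfolding abs_le_iff using k1 by linarith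
    then have "\<bar>\<kappa> - 579 / 1000\<bar> * \<bar>b\<bar> \<le> 1 / 1000 * 1" using b_lo b_hi by (intro mult_mono) auto
    finally show ?thesis by simp
  qed
  moreover have "r - \<kappa> * b \<le> cc + e" using reg by (simp add: region_def)
  moreover have "(\<kappa> - 579 / 1000) * b = \<kappa> * b - 579 / 1000 * b" by (simp add: algebra_simps)
  ultimately show ?thesis using c e by linarith
qed

lemma T_scale: "(T - e) * Q \<le> (G - e) * (1 - 2 * al) * Q" if "0 \<le> Q" for Q
proof -
  have "e * (1 - 2 * al) \<le> e * 1" using e al_pos by (intro mult_left_mono) auto
  then have "T - e \<le> (G - e) * (1 - 2 * al)" by (simp add: T_def algebra_simps)
  then show ?thesis using that by (rule mult_right_mono)
qed

lemma Ge_pos: "0 < G - e" using G_bounds e by simp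

text \<open>The sharp estimate. \<open>region_line\<close> at slope \<open>kM\<close> makes
  \<open>b\<close> cancel, and the choice of \<open>kM\<close> makes \<open>A\<close> the worst even
  quotient.\<close>

lemma main_ineq:
  assumes "even a" "a \<noteq> 2"
  shows "(G - e) * (P - al) \<le> P - 1 - r"
proof -
  have "3 \<le> a" using assms a_ge2 by linarith
  then have "A \<le> real_of_int a" using even_ge_A aR assms by blast
  then have "kM * (A - al) \<le> kM * (real_of_int a - al)" using kM_pos by (intro mult_left_mono) auto
  moreover have "kM * (A - al) = 1 - al + \<rho> - kM * \<theta>" using kM_eq by (simp add: algebra_simps)
  moreover have "r - kM * b \<le> \<rho> - kM * \<theta> + e"
    using region_line[OF reg, of kM] kM_pos kM_le_\<kappa> by simp
  moreover have "kM * (P - al) = kM * (real_of_int a - al) + kM * b" by (simp add: P_def algebra_simps)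
  ultimately have "1 - al + r - e \<le> kM * (P - al)" by linarith
  moreover have "e * 1 \<le> e * (P - al)" using e P_ge al_le by (intro mult_left_mono) auto
  moreover have "(G - e) * (P - al) = (P - al) - kM * (P - al) - e * (P - al)"
    by (simp add: G_kM algebra_simps)
  ultimately show ?thesis by linarith
qed

lemma al_P: "odd a \<Longrightarrow> 1 - 2 / 5 * al \<le> al * P"
proof -
  assume "odd a"
  have "al * (s - \<eta>) + al * (\<eta> - 2 / 5) \<le> al * P"
    using mult_left_mono[OF P_odd[OF \<open>odd a\<close>], of al] al_pos by (simp add: algebra_simps)
  moreover have "al * (\<eta> - 2 / 5) \<ge> - (2 / 5) * al" using al_pos \<eta>_pos by (simp add: algebra_simps)
  ultimately show ?thesis using al_eq by linarith
qed

text \<open>This corner is not critical: the factor 1 + x - t may be replaced by 1. Only the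
  quotient 2, possible just for small R, needs numerical bounds.\<close>

lemma FA_ge: "T - e \<le> FA b' r' x t"
proof -
  define N where "N = P - \<epsilon> * (if even a then 1 + r else - r)"
  have red: ?thesis if "(T - e) * (P + \<epsilon> * x) \<le> N" "0 \<le> N"
  proof -
    have "N * 1 \<le> N * (1 + x - t)" using that t_le by (intro mult_left_mono) auto
    then have "(T - e) * (P + \<epsilon> * x) \<le> N * (1 + x - t)" using that by linarith
    then show ?thesis unfolding FA_eq using Pex_pos by (simp add: N_def pos_le_divide_eq)
  qed
  have red3: ?thesis if "T \<le> c" "c * (P + \<epsilon> * x) \<le> N" "0 \<le> N" for c
  proof (rule red)
    have "(T - e) * (P + \<epsilon> * x) \<le> c * (P + \<epsilon> * x)"
      using that e Pex_pos by (intro mult_right_mono) auto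
    then show "(T - e) * (P + \<epsilon> * x) \<le> N" using that by linarith
  qed (fact that)
  show ?thesis
  proof (cases "\<epsilon> = 1")
    case eps: True
    show ?thesis
    proof (cases "even a")
      case True
      have N: "N = P - 1 - r" using eps True by (simp add: N_def)
      have N0: "0 \<le> N" using N P_ge r_half by simp
      show ?thesis
      proof (cases "a = 2")
        case a2: True
        then have R: "R \<le> 3" using aR by simp
        have "P = 2 + b" using a2 by (simp add: P_def)
        then have "1 / 5 * (P + \<epsilon> * x) \<le> N"
          using N line_small[OF R] eps x_half b_lo by (simp add: field_simps)
        then show ?thesis using T_small[OF R] N0 by (intro red3)
      next
        case False
        have "(1 - 2 * al) * (P + x) \<le> P - al"
        proof -
          have "al * (8 / 5) \<le> al * (P + x)" using P_ge x_pos al_pos by (intro mult_left_mono) auto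
          moreover have "x \<le> 2 * al" using xt2 t_pos by simp
          moreover have "al * (x + P - x) \<ge> al * (8 / 5)" using P_ge al_pos by (intro mult_left_mono) auto
          moreover have "al * P \<ge> al * (8 / 5)" using P_ge al_pos by (intro mult_left_mono) auto
          moreover have "(1 - 2 * al) * (P + x) = P + x - 2 * (al * (P + x))" by (simp add: algebra_simps)
          ultimately show ?thesis using al_pos by linarith
        qed
        then have "(G - e) * ((1 - 2 * al) * (P + x)) \<le> (G - e) * (P - al)"
          using Ge_pos by (intro mult_left_mono) auto
        moreover have "(T - e) * (P + x) \<le> (G - e) * ((1 - 2 * al) * (P + x))"
          using T_scale[of "P + x"] P_ge x_pos unfolding mult.assoc by linarith
        ultimately have "(T - e) * (P + \<epsilon> * x) \<le> N"
          using main_ineq[OF True False] N eps by simp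
        then show ?thesis using N0 by (intro red)
      qed
    next
      case False
      have N: "N = P + r" using eps False by (simp add: N_def)
      have "al * x \<ge> 0" using al_pos x_pos by simp
      then have "(1 - 2 * al) * (P + x) \<le> P + r"
        using al_P[OF False] al_le r_half x_half by (simp add: algebra_simps)
      then show ?thesis using N P_odd3[OF False] r_half eps by (intro red3[OF T_le]) auto
    qed
  next
    case False
    then have eps: "\<epsilon> = - 1" using \<epsilon>_cases by simp
    show ?thesis
    proof (cases "even a")
      case True
      have N: "N = P + 1 + r" using eps True by (simp add: N_def)
      then show ?thesis using T_lt1 r_half x_pos P_ge eps by (intro red3[of 1]) auto
    next
      case False
      have N: "N = P - r" using eps False by (simp add: N_def)
      have "al * x \<le> al * (1 / 2)" using al_pos x_half by (intro mult_left_mono) auto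
      then have "(1 - 2 * al) * (P - x) \<le> P - r"
        using al_P[OF False] al_le r_half x_pos by (simp add: algebra_simps)
      then show ?thesis using N P_odd3[OF False] r_half eps by (intro red3[OF T_le]) auto
    qed
  qed
qed

text \<open>The extremal case is an even quotient followed by a minus sign. In the other cases 1 - x
  - t \<ge> 1 - 2 al is used alone, and it remains to bound the other factor by G - e.\<close>

lemma FB_ge: "T - e \<le> FB b' r' x t"
proof -
  define N where "N = P + \<epsilon> * (if even a then 1 + r else - r)"
  have xt1: "0 \<le> 1 - x - t" "1 - 2 * al \<le> 1 - x - t" using xt2 al_le by auto
  have red: ?thesis if "(T - e) * (P + \<epsilon> * x) \<le> N * (1 - x - t)"
    unfolding FB_eq using that Pex_pos by (simp add: N_def pos_le_divide_eq)
  have red2: ?thesis if "(G - e) * (P + \<epsilon> * x) \<le> N"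
  proof (rule red)
    have "(T - e) * (P + \<epsilon> * x) \<le> (G - e) * (1 - 2 * al) * (P + \<epsilon> * x)"
      using T_scale Pex_pos by simp
    also have "\<dots> = (G - e) * (P + \<epsilon> * x) * (1 - 2 * al)" by simp
    also have "\<dots> \<le> (G - e) * (P + \<epsilon> * x) * (1 - x - t)"
      using xt1 Ge_pos Pex_pos by (intro mult_left_mono) auto
    also have "\<dots> \<le> N * (1 - x - t)" using that xt1 by (intro mult_right_mono) auto
    finally show "(T - e) * (P + \<epsilon> * x) \<le> N * (1 - x - t)" .
  qed
  have Ge1: "(G - e) * Q \<le> Q" if "0 \<le> Q" for Q
    using mult_right_mono[of "G - e" 1 Q] that G_bounds e by simp
  have Gk: "(G - e) * Q = Q - kM * Q - e * Q" for Q by (simp add: G_kM algebra_simps)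
  show ?thesis
  proof (cases "\<epsilon> = 1")
    case eps: True
    show ?thesis
    proof (cases "even a")
      case True
      then have "N = P + 1 + r" using eps by (simp add: N_def)
      then have "P + \<epsilon> * x \<le> N" using eps r_half x_half by simp
      moreover have "(G - e) * (P + \<epsilon> * x) \<le> P + \<epsilon> * x" using Pex_pos by (intro Ge1) auto
      ultimately show ?thesis by (intro red2) linarith
    next
      case False
      then have N: "N = P - r" using eps by (simp add: N_def)
      have k: "\<rho> + x \<le> kM * (s + \<theta> + x)"
      proof (cases "R \<le> 3")
        case True
        have "264 / 1000 * (33027 / 10000 + x) \<le> kM * (s + \<theta> + x)"
          using kM_bounds True small_R[OF True] \<theta>_small[OF True] x_pos by (intro mult_mono) auto
        then show ?thesis using \<rho>_small[OF True] x_half by (simp add: field_simps)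
      next
        case R: False
        have "kM * x \<ge> 0" using kM_pos x_pos by simp
        then show ?thesis using kM_bounds R \<rho>_large x_R3 by (simp add: distrib_left)
      qed
      have "s \<le> real_of_int a" using odd_ge_s aR False by blast
      then have "kM * s \<le> kM * real_of_int a" using kM_pos by (intro mult_left_mono) auto
      moreover have "r - kM * b \<le> \<rho> - kM * \<theta> + e"
        using region_line[OF reg, of kM] kM_pos kM_le_\<kappa> by simp
      moreover have "kM * (P + x) = kM * real_of_int a + kM * b + kM * x" by (simp add: P_def algebra_simps)
      moreover have "kM * (s + \<theta> + x) = kM * s + kM * \<theta> + kM * x" by (simp add: algebra_simps)
      moreover have "e * 1 \<le> e * (P + x)" using e P_ge x_pos by (intro mult_left_mono) auto
      ultimately have "(G - e) * (P + x) \<le> P - r" using k Gk[of "P + x"] by linarith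
      then show ?thesis using N eps by (intro red2) auto
    qed
  next
    case False
    then have eps: "\<epsilon> = - 1" using \<epsilon>_cases by simp
    show ?thesis
    proof (cases "even a")
      case True
      then have N: "N = P - 1 - r" using eps by (simp add: N_def)
      \<comment> \<open>Here 1 - x - t and P - x must be treated together. Since t \<le> x,
        replacing x by (x + t)/2 only increases P - x; afterwards x + t is the only variable, and
        its worst value is 2 al.\<close>
      have "(1 - 2 * al) * (P - x) \<le> (1 - x - t) * (P - al)"
      proof -
        have "(1 - 2 * al) * (P - x) \<le> (1 - 2 * al) * (P - (x + t) / 2)"
          using t_le al_le by (intro mult_left_mono) auto
        moreover have "(1 - x - t) * (P - al) - (1 - 2 * al) * (P - (x + t) / 2) = (2 * al - (x + t)) * (P - 1 / 2)"
          by (simp add: field_simps)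
        moreover have "(2 * al - (x + t)) * (P - 1 / 2) \<ge> 0" using xt2 P_ge by (intro mult_nonneg_nonneg) auto
        ultimately show ?thesis by linarith
      qed
      then have "(G - e) * ((1 - 2 * al) * (P - x)) \<le> (G - e) * ((1 - x - t) * (P - al))"
        using Ge_pos by (intro mult_left_mono) auto
      moreover have "(G - e) * (P - al) * (1 - x - t) \<le> (P - 1 - r) * (1 - x - t)"
        using main_ineq[OF True neg_a[OF eps]] xt1 by (intro mult_right_mono) auto
      moreover have "(T - e) * (P - x) \<le> (G - e) * (1 - 2 * al) * (P - x)"
        using P_ge x_half by (intro T_scale) auto
      ultimately have "(T - e) * (P - x) \<le> N * (1 - x - t)" unfolding N by (simp only: mult.assoc mult.commute[of "P - al"])
      then show ?thesis using eps by (intro red) auto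
    next
      case False
      then have N: "N = P + r" using eps by (simp add: N_def)
      have "- r \<le> kM * (P - x) + x"
      proof (cases "R \<le> 3")
        case True
        have "264 / 1000 * (26 / 10 - x) \<le> kM * (P - x)"
          using kM_bounds True P_odd3[OF False] x_half by (intro mult_mono) auto
        then show ?thesis using r_half x_pos by (simp add: field_simps)
      next
        case R: False
        have "kM * (s - 2 / 5) \<le> kM * P" using kM_pos P_odd[OF False] by (intro mult_left_mono) auto
        moreover have "kM * (s + \<theta>) = kM * (s - 2 / 5) + kM * (\<theta> + 2 / 5)" by (simp add: algebra_simps)
        moreover have "kM * (\<theta> + 2 / 5) \<le> 32 / 100 * (6 / 10)"
          using kM_bounds R \<theta>_large \<theta>_pos by (intro mult_mono) auto
        moreover have "kM * x \<le> 1 * x" using kM_bounds R x_pos by (intro mult_right_mono) auto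
        moreover have "- r \<le> 25 / 100" using r_lo \<rho>_large R e by simp
        moreover have "68 / 100 \<le> kM * (s + \<theta>)" using kM_bounds R by simp
        ultimately show ?thesis by (simp add: right_diff_distrib)
      qed
      moreover have "0 \<le> e * (P - x)" using e P_ge x_half by simp
      ultimately have "(G - e) * (P - x) \<le> P + r" using Gk[of "P - x"] by linarith
      then show ?thesis using N eps by (intro red2) auto
    qed
  qed
qed

lemma k2_lt: "4 \<le> R \<Longrightarrow> k2 < 48 / 100" using k2_le_\<kappa> \<kappa>_le \<rho>_large by fastforce

lemma second_main:
  assumes R: "4 \<le> R" and a: "odd a"
  shows "(1 - k2 - e) * (P - \<eta>) \<le> P - 2 - r"
proof -
  have "s \<le> real_of_int a" using odd_ge_s aR a by blast
  then have "k2 * s \<le> k2 * real_of_int a" using k2_pos by (intro mult_left_mono) auto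
  moreover have "r - k2 * b \<le> \<rho> - k2 * \<theta> + e"
    using region_line[OF reg, of k2] k2_pos k2_le_\<kappa>[OF R] by simp
  moreover have "k2 * s + k2 * \<theta> - k2 * \<eta> = 2 - \<eta> + \<rho>" using k2_eq by (simp add: algebra_simps)
  moreover have "e * 1 \<le> e * (P - \<eta>)" using e P_ge \<eta>_half by (intro mult_left_mono) auto
  moreover have "(1 - k2 - e) * (P - \<eta>) = P - \<eta> - (k2 * real_of_int a + k2 * b - k2 * \<eta>) - e * (P - \<eta>)"
    by (simp add: P_def algebra_simps)
  ultimately show ?thesis by linarith
qed

lemma P_even_large:
  assumes R: "4 \<le> R" and a: "even a"
  shows "1 + \<rho> \<le> k2 * P"
proof (rule k2_ge[OF R])
  have "A \<le> real_of_int a" using even_ge_A aR a R by force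
  then show "A - 5 / 18 \<le> P" using b_large[OF R] unfolding P_def by linarith
qed

lemma even_main:
  assumes R: "4 \<le> R" and a: "even a"
  shows "(1 - k2 - e) * (P - \<eta>) \<le> P - 1 + r" "(1 - k2 - e) * P \<le> P - 1 + r"
proof -
  have kP: "1 + \<rho> \<le> k2 * P" by (rule P_even_large[OF assms])
  have e1: "e * 1 \<le> e * P" using e P_ge by (intro mult_left_mono) auto
  have "(1 - k2 - e) * P = P - k2 * P - e * P" by (simp add: algebra_simps)
  then show 1: "(1 - k2 - e) * P \<le> P - 1 + r" using kP e1 r_lo by linarith
  have "(1 - k2 - e) * (P - \<eta>) \<le> (1 - k2 - e) * P"
    using k2_lt[OF R] e \<eta>_pos by (intro mult_left_mono) auto
  then show "(1 - k2 - e) * (P - \<eta>) \<le> P - 1 + r" using 1 by linarith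
qed

lemma T_k2: "4 \<le> R \<Longrightarrow> T - e \<le> (1 - k2 - e) * (1 - \<eta>)"
proof -
  assume R: "4 \<le> R"
  have "e * (1 - \<eta>) \<le> e * 1" using e \<eta>_pos by (intro mult_left_mono) auto
  moreover have "(1 - k2 - e) * (1 - \<eta>) = (1 - k2) * (1 - \<eta>) - e * (1 - \<eta>)" by (simp add: algebra_simps)
  ultimately show ?thesis using T_le_k2[OF R] by linarith
qed

text \<open>In the excluded case, and for \<open>a = 2\<close> in \<open>FD_ge\<close>, the lattice point in question is also one
  of the four smallest points of the preceding index, so that no estimate is needed there.\<close>

lemma FC_ge:
  assumes "\<not> (a = 3 \<and> \<epsilon> = - 1)"
  shows "T - e \<le> FC b' r' x t"
proof -
  define N where "N = P + \<epsilon> * (if even a then 1 - r else 2 + r)"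
  have y: "0 \<le> 1 - x + t" "1 / 2 \<le> 1 - x + t" "1 - x \<le> 1 - x + t" using t_pos x_half by auto
  have red: ?thesis if "(T - e) * (P + \<epsilon> * x) \<le> N * (1 - x + t)"
    unfolding FC_eq using that Pex_pos by (simp add: N_def pos_le_divide_eq)
  have large: ?thesis if R: "4 \<le> R" and N: "(1 - k2 - e) * (P - \<eta>) \<le> N" and eps: "\<epsilon> = - 1"
  proof (rule red)
    have k: "0 \<le> 1 - k2 - e" using k2_lt[OF R] e by simp
    have "(T - e) * (P - x) \<le> (1 - k2 - e) * (1 - \<eta>) * (P - x)"
      using T_k2[OF R] P_ge x_half by (intro mult_right_mono) auto
    also have "\<dots> \<le> (1 - k2 - e) * ((1 - x + t) * (P - \<eta>))"
    proof -
      \<comment> \<open>Replacing x by x - t increases the left side and leaves one variable, whose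
        worst value is \<eta>.\<close>
      have "(1 - \<eta>) * (P - x) \<le> (1 - \<eta>) * (P - (x - t))"
        using t_pos \<eta>_half by (intro mult_left_mono) auto
      moreover have "(1 - x + t) * (P - \<eta>) - (1 - \<eta>) * (P - (x - t)) = (P - 1) * (\<eta> - (x - t))"
        by (simp add: algebra_simps)
      moreover have "0 \<le> (P - 1) * (\<eta> - (x - t))" using P_ge xt by (intro mult_nonneg_nonneg) auto
      ultimately have "(1 - \<eta>) * (P - x) \<le> (1 - x + t) * (P - \<eta>)" by linarith
      then show ?thesis using k unfolding mult.assoc by (rule mult_left_mono)
    qed
    also have "\<dots> = (1 - k2 - e) * (P - \<eta>) * (1 - x + t)" by simp
    also have "\<dots> \<le> N * (1 - x + t)" using N y by (intro mult_right_mono) auto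
    finally show "(T - e) * (P + \<epsilon> * x) \<le> N * (1 - x + t)" using eps by simp
  qed
  show ?thesis
  proof (cases "\<epsilon> = 1")
    case eps: True
    have "P + x \<le> N" using eps r_half x_half by (simp add: N_def)
    then have "(1 - 2 * al) * (P + x) \<le> (1 - x + t) * N"
      using xt2 t_pos y P_ge x_pos by (intro mult_mono) auto
    moreover have "(T - e) * (P + x) \<le> (1 - 2 * al) * (P + x)"
      using T_le e P_ge x_pos by (intro mult_right_mono) auto
    ultimately show ?thesis using eps by (intro red) (simp add: mult.commute)
  next
    case False
    then have eps: "\<epsilon> = - 1" using \<epsilon>_cases by simp
    show ?thesis
    proof (cases "4 \<le> R")
      case True
      then show ?thesis
        using second_main even_main eps by (intro large) (auto simp: N_def)
    next
      case False
      then have R: "R \<le> 3" by simp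
      \<comment> \<open>The factor 2/5 makes up for 1 - x + t \<ge> 1/2 against T \<le> 1/5. With
        quotient 3 the inequality fails near (\<theta>, \<rho>), hence the excluded case.\<close>
      have "2 / 5 * P \<le> N"
      proof (cases "even a")
        case True
        then have "18 / 5 \<le> P" using P_even neg_a[OF eps] A4 by fastforce
        then show ?thesis using True eps r_half by (simp add: N_def)
      next
        case odd: False
        then have "a \<noteq> 3" "odd a" using assms eps by auto
        then have "5 \<le> a" using a_ge2 by presburger
        then have "23 / 5 \<le> P" using b_lo unfolding P_def by linarith
        then show ?thesis using odd eps r_half by (simp add: N_def)
      qed
      moreover have "(T - e) * (P - x) \<le> 1 / 5 * P"
        using T_small[OF R] T_pos e x_pos x_half P_ge by (intro mult_mono) auto
      moreover have "N * (1 / 2) \<le> N * (1 - x + t)"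
        using y calculation P_ge by (intro mult_left_mono) auto
      ultimately show ?thesis using eps by (intro red) simp
    qed
  qed
qed

lemma FD_ge:
  assumes "a \<noteq> 2"
  shows "T - e \<le> FD b' r' x t"
proof -
  define N where "N = P - \<epsilon> * (if even a then 1 - r else 2 + r)"
  have red: ?thesis if "(T - e) * (P + \<epsilon> * x) \<le> N * (1 + x + t)"
    unfolding FD_eq using that Pex_pos by (simp add: N_def pos_le_divide_eq)
  show ?thesis
  proof (cases "\<epsilon> = 1")
    case eps: True
    have red2: ?thesis if "c * P \<le> N" "T - e \<le> c" "0 \<le> c" for c
    proof (rule red)
      have "(T - e) * (P + x) \<le> c * (P + x)" using that P_ge x_pos by (intro mult_right_mono) auto
      also have "\<dots> \<le> c * (P * (1 + x + t))"
      proof -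
        have "x * 1 \<le> x * P" "0 \<le> P * t" using x_pos P_ge t_pos by (auto intro!: mult_left_mono)
        then show ?thesis using that by (intro mult_left_mono) (auto simp: algebra_simps)
      qed
      also have "\<dots> = c * P * (1 + x + t)" by simp
      also have "\<dots> \<le> N * (1 + x + t)" using that x_pos t_pos by (intro mult_right_mono) auto
      finally show "(T - e) * (P + \<epsilon> * x) \<le> N * (1 + x + t)" using eps by simp
    qed
    show ?thesis
    proof (cases "4 \<le> R")
      case R: True
      have k: "0 \<le> 1 - k2 - e" using k2_lt[OF R] e by simp
      have "(1 - k2 - e) * (1 - \<eta>) * P \<le> N"
      proof -
        have "(1 - \<eta>) * P \<le> P - \<eta>" using mult_left_mono[of 1 P \<eta>] \<eta>_pos P_ge by (simp add: algebra_simps)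
        then have "(1 - k2 - e) * ((1 - \<eta>) * P) \<le> (1 - k2 - e) * (P - \<eta>)" using k by (rule mult_left_mono)
        also have "\<dots> \<le> N"
          using second_main[OF R] even_main[OF R] eps by (auto simp: N_def)
        finally show ?thesis by (simp add: mult.assoc)
      qed
      then show ?thesis using T_k2[OF R] k \<eta>_half by (intro red2) auto
    next
      case False
      then have R: "R \<le> 3" by simp
      have "1 / 5 * P \<le> N"
      proof (cases "even a")
        case True
        then have "18 / 5 \<le> P" using P_even assms A4 by fastforce
        then show ?thesis using True eps r_half by (simp add: N_def)
      next
        case odd: False
        then have "3 \<le> a" using a_ge2 by presburger
        then have "3 + b \<le> P" unfolding P_def by linarith
        then show ?thesis using odd eps line_small[OF R] b_lo by (simp add: N_def)
      qed
      then show ?thesis using T_small[OF R] e by (intro red2[of "1 / 5"]) auto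
    qed
  next
    case False
    then have eps: "\<epsilon> = - 1" using \<epsilon>_cases by simp
    have N: "P - x \<le> N" "0 \<le> N" using eps r_half x_half x_pos P_ge by (auto simp: N_def)
    have "N * 1 \<le> N * (1 + x + t)" using N x_pos t_pos by (intro mult_left_mono) auto
    moreover have "(T - e) * (P - x) \<le> 1 * (P - x)"
      using T_lt1 e P_ge x_half by (intro mult_right_mono) auto
    ultimately show ?thesis using N eps by (intro red) simp
  qed
qed

text \<open>Fixes the sign of the first factor at all four corners, so that
  \<open>approx_val\<close> agrees there with \<open>FA\<close>, \<open>FB\<close>,
  \<open>FC\<close>, \<open>FD\<close>; the same inequalities are part of
  \<open>good_state\<close>.\<close>

lemma factors_nonneg: "\<bar>b' - r'\<bar> \<le> 1" "\<bar>b' + r'\<bar> \<le> 1"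
proof -
  have *: "\<bar>\<epsilon> * z / P\<bar> \<le> 1" if "\<bar>z\<bar> \<le> P" for z
    using \<epsilon>_cases that P_ge by (auto simp: abs_mult)
  have odd2: "2 + r \<le> P" if "odd a"
  proof (cases "4 \<le> R")
    case True
    have "s \<le> real_of_int a" using odd_ge_s aR that by blast
    then have "5 \<le> real_of_int a" using large_R[OF True] by linarith
    then show ?thesis using r_half b_lo by (simp add: P_def)
  next
    case False
    have "3 \<le> a" using that a_ge2 by presburger
    then have "3 + b \<le> P" unfolding P_def by linarith
    then show ?thesis using line_small b_lo False by simp
  qed
  show "\<bar>b' - r'\<bar> \<le> 1"
    using even_sub(1) odd_sub(1) *[of "1 + r"] *[of "- r"] r_half P_ge by (cases "even a") auto
  show "\<bar>b' + r'\<bar> \<le> 1"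
    using even_sub(2) odd_sub(2) *[of "1 - r"] *[of "2 + r"] r_half P_ge odd2 by (cases "even a") auto
qed

end

section \<open>Reduction to the four smallest lattice points\<close>

lemma nint_dist_cases:
  assumes "z \<notin> \<rat>"
  shows "nint_dist z = frac z \<and> frac z < 1 / 2 \<or> nint_dist z = 1 - frac z \<and> 1 / 2 < frac z"
proof -
  have fz: "frac z \<noteq> 1 / 2"
  proof
    assume "frac z = 1 / 2"
    then have "z = of_int \<lfloor>z\<rfloor> + 1 / 2" by (simp add: frac_def)
    moreover have "of_int \<lfloor>z\<rfloor> + 1 / 2 \<in> (\<rat> :: real set)"
      by (intro Rats_add Rats_divide Rats_of_int) auto
    ultimately have "z \<in> \<rat>" by metis
    then show False using assms by simp
  qed
  have zi: "z \<notin> \<int>" using assms Ints_subset_Rats by blast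
  show ?thesis
  proof (cases "frac z \<ge> 1 / 2")
    case True
    then have "round z = \<lceil>z\<rceil>" by (simp add: round_altdef)
    also have "\<dots> = \<lfloor>z\<rfloor> + 1" using zi by (simp add: ceiling_altdef) (metis Ints_of_int)
    finally show ?thesis using True fz frac_lt_1[of z] by (simp add: nint_dist_def frac_def)
  next
    case False
    then have "round z = \<lfloor>z\<rfloor>" by (simp add: round_altdef)
    then show ?thesis using False frac_ge_0[of z] by (simp add: nint_dist_def frac_def)
  qed
qed

lemma nint_dist_irrational:
  assumes "z \<notin> \<rat>"
  shows "0 < nint_dist z" "nint_dist z < 1 / 2" "nint_dist z \<notin> \<rat>"
proof -
  show "nint_dist z \<notin> \<rat>"
  proof
    assume "nint_dist z \<in> \<rat>"
    then have "z - of_int (round z) \<in> \<rat>" unfolding nint_dist_def by (simp add: Rats_abs_iff)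
    then have "z - of_int (round z) + of_int (round z) \<in> \<rat>" by (intro Rats_add Rats_of_int)
    then show False using assms by simp
  qed
  then have "nint_dist z \<noteq> 0" by (metis Rats_0)
  then show "0 < nint_dist z" by (simp add: nint_dist_def)
  show "nint_dist z < 1 / 2" using nint_dist_cases[OF assms] by auto
qed

lemma nint_dist_int_add:
  assumes "0 < z" "z < 1 / 2" "\<sigma> = 1 \<or> \<sigma> = - 1"
  shows "nint_dist (real_of_int m + \<sigma> * z) = z"
    "frac (real_of_int m + \<sigma> * z) = z \<longleftrightarrow> \<sigma> = 1"
    "\<sigma> = 1 \<Longrightarrow> \<lfloor>real_of_int m + \<sigma> * z\<rfloor> = m" "\<sigma> = - 1 \<Longrightarrow> \<lceil>real_of_int m + \<sigma> * z\<rceil> = m"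
proof -
  have "round (real_of_int m + \<sigma> * z) = m"
    unfolding round_def using assms by (intro floor_unique) auto
  then show "nint_dist (real_of_int m + \<sigma> * z) = z" unfolding nint_dist_def using assms by auto
  have f: "frac (real_of_int m + \<sigma> * z) = (if \<sigma> = 1 then z else 1 - z)"
  proof (cases "\<sigma> = 1")
    case True
    then have "\<lfloor>real_of_int m + \<sigma> * z\<rfloor> = m" using assms by (intro floor_unique) auto
    then show ?thesis using True by (simp add: frac_def)
  next
    case False
    then have "\<sigma> = - 1" using assms by blast
    moreover have "\<lfloor>real_of_int m - z\<rfloor> = m - 1" using assms by (intro floor_unique) auto
    ultimately show ?thesis by (simp add: frac_def)
  qed
  then show "frac (real_of_int m + \<sigma> * z) = z \<longleftrightarrow> \<sigma> = 1" using assms by auto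
  show "\<lfloor>real_of_int m + \<sigma> * z\<rfloor> = m" if "\<sigma> = 1" using that assms by (intro floor_unique) auto
  show "\<lceil>real_of_int m + \<sigma> * z\<rceil> = m" if "\<sigma> = - 1" using that assms by (intro ceiling_unique) auto
qed

lemma nint_dist_le: "nint_dist z \<le> \<bar>z - of_int m\<bar>"
  unfolding nint_dist_def using round_diff_minimal[of z m] by simp

text \<open>All state variables are multiplied by \<open>-1\<close> to the number of odd partial quotients seen so
  far (up to a global sign). With this normalisation the alternating \<open>\<lambda>\<^sub>i\<close> disappear and only
  the parity of the partial quotient enters the recursions.\<close>

definition approx_val :: "real \<Rightarrow> real \<Rightarrow> real \<Rightarrow> real \<Rightarrow> real \<Rightarrow> real \<Rightarrow> real" where
  "approx_val b r x t u v = \<bar>u - b * v + r\<bar> * \<bar>u * x + v - t\<bar> / (1 + x * b)"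

definition next_u :: "int \<Rightarrow> real \<Rightarrow> real \<Rightarrow> real" where
  "next_u a \<epsilon> v = (if odd a then - \<epsilon> * v else \<epsilon> * v)"

text \<open>For odd \<open>a\<close> and odd coordinates the number u + a v is even; subtracting the
  1 contributed by the nonzero term of \<sigma> restores oddness. The sign change is the
  normalisation by the number of odd quotients.\<close>

definition next_v :: "int \<Rightarrow> real \<Rightarrow> real \<Rightarrow> real" where
  "next_v a u v = (if odd a then - (u + real_of_int a * v - 1) else u + real_of_int a * v)"

locale cf_step =
  fixes b r x t b' r' x' t' \<epsilon> :: real and a :: int
  assumes xs: "0 < x" "x < 1 / 2" "0 < x'" "x' < 1 / 2"
    and t's: "0 \<le> t'" "t' \<le> x'"
    and bs: "- (2 / 5) \<le> b" "b \<le> 5 / 8" "- (2 / 5) \<le> b'" "b' \<le> 5 / 8"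
    and \<epsilon>: "\<epsilon> = 1 \<or> \<epsilon> = - 1" and a2: "2 \<le> a"
    and x_eq: "x * (real_of_int a + \<epsilon> * x') = 1"
    and b'_eq: "b' = \<epsilon> / (real_of_int a + b)"
    and r'_eq: "r' = (if odd a then b' * (1 + r) else - b' * r)"
    and t_eq: "t = (if odd a then x * (1 - t') else x * t')"
begin

definition g :: real where "g = (if odd a then - 1 else 1)"
definition od :: real where "od = (if odd a then 1 else 0)"

lemma g_cases: "g = 1 \<or> g = - 1" by (simp add: g_def)

lemma ab_pos: "0 < real_of_int a + b"
proof -
  have "2 \<le> real_of_int a" using a2 by simp
  then show ?thesis using bs by linarith
qed

lemma X_step: "next_u a \<epsilon> v - b' * next_v a u v + r' = - g * b' * (u - b * v + r)"
proof -
  have e: "\<epsilon> = b' * (real_of_int a + b)" using ab_pos by (simp add: b'_eq)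
  show ?thesis
    by (simp add: next_u_def next_v_def r'_eq g_def e algebra_simps)
qed

lemma Y_step: "u * x + v - t = x * g * (next_u a \<epsilon> v * x' + next_v a u v - t')"
proof -
  have "x * real_of_int a = 1 - x * \<epsilon> * x'" using x_eq by (simp add: algebra_simps)
  then have "x * (real_of_int a * v) = (1 - x * \<epsilon> * x') * v" by (metis mult.assoc)
  then show ?thesis
    by (simp add: next_u_def next_v_def t_eq g_def algebra_simps)
qed

lemma den_pos': "0 < 1 + x * b" "0 < 1 + x' * b'"
proof -
  have "x * (- (2 / 5)) \<le> x * b" "x' * (- (2 / 5)) \<le> x' * b'"
    using xs bs by (intro mult_left_mono; simp)+
  then show "0 < 1 + x * b" "0 < 1 + x' * b'" using xs by auto
qed

text \<open>The first factor is multiplied by |b'|, the second is divided by x, and x (1 + x' b') =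
  |b'| (1 + x b), so the three changes cancel.\<close>

lemma approx_val_step:
  "approx_val b' r' x' t' (next_u a \<epsilon> v) (next_v a u v) = approx_val b r x t u v"
proof -
  define Y where "Y = next_u a \<epsilon> v * x' + next_v a u v - t'"
  have b0: "\<bar>b'\<bar> > 0" using ab_pos \<epsilon> by (auto simp: b'_eq)
  have d: "x * (1 + x' * b') = \<bar>b'\<bar> * (1 + x * b)"
  proof -
    have be: "\<bar>b'\<bar> = 1 / (real_of_int a + b)" using ab_pos \<epsilon> by (auto simp: b'_eq abs_if)
    have "x * (1 + x' * b') * (real_of_int a + b) = x * (real_of_int a + b + \<epsilon> * x')"
    proof -
      have "b' * (real_of_int a + b) = \<epsilon>" using ab_pos by (simp add: b'_eq)
      then have "x * x' * (b' * (real_of_int a + b)) = x * x' * \<epsilon>" by simp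
      then show ?thesis by (simp add: algebra_simps)
    qed
    also have "\<dots> = 1 + x * b" using x_eq by (simp add: algebra_simps)
    finally show ?thesis unfolding be using ab_pos by (simp add: field_simps)
  qed
  have "approx_val b r x t u v = \<bar>u - b * v + r\<bar> * (x * \<bar>Y\<bar>) / (1 + x * b)"
    unfolding approx_val_def Y_step Y_def using g_cases xs by (auto simp: abs_mult)
  also have "\<dots> = \<bar>b'\<bar> * \<bar>u - b * v + r\<bar> * (x * \<bar>Y\<bar>) / (\<bar>b'\<bar> * (1 + x * b))"
    using b0 by simp
  also have "\<dots> = \<bar>b'\<bar> * \<bar>u - b * v + r\<bar> * \<bar>Y\<bar> / (1 + x' * b')"
    unfolding d[symmetric] using xs by simp
  also have "\<dots> = approx_val b' r' x' t' (next_u a \<epsilon> v) (next_v a u v)"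
    unfolding approx_val_def X_step Y_def using g_cases by (auto simp: abs_mult)
  finally show ?thesis by simp
qed

end

definition good_state :: "real \<Rightarrow> real \<Rightarrow> real \<Rightarrow> real \<Rightarrow> real \<Rightarrow> bool" where
  "good_state c b r x t \<longleftrightarrow> \<bar>b - r\<bar> \<le> 1 \<and> \<bar>b + r\<bar> \<le> 1 \<and>
     (\<forall>\<sigma> \<sigma>'. (\<sigma> = 1 \<or> \<sigma> = - 1) \<longrightarrow> (\<sigma>' = 1 \<or> \<sigma>' = - 1) \<longrightarrow> c \<le> approx_val b r x t \<sigma> \<sigma>')"

lemma good_state_mono: "good_state c' b r x t \<Longrightarrow> c \<le> c' \<Longrightarrow> good_state c b r x t"
  unfolding good_state_def using order_trans[of c c'] by blast

lemma good_state_signs: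
  assumes "good_state c b r x t" "\<sigma> = 1 \<or> \<sigma> = - 1"
  shows "0 \<le> 1 - b + \<sigma> * r" "0 \<le> 1 + b - \<sigma> * r"
  using assms by (auto simp: good_state_def)

text \<open>Along the ray through a corner both linear forms are, up to sign, affine in n with
  nonnegative slope and nonnegative value at n = 1, so the product grows with n.\<close>

lemma good_state_scale:
  assumes good: "good_state c b r x t" and n: "1 \<le> n"
    and \<sigma>: "\<sigma> = 1 \<or> \<sigma> = - 1" and \<sigma>': "\<sigma>' = 1 \<or> \<sigma>' = - 1"
    and bx: "- 1 < b" "b < 1" "0 < x" "x < 1 / 2" "0 \<le> t" "t \<le> x" "0 < 1 + x * b"
  shows "c \<le> approx_val b r x t (\<sigma> * n) (\<sigma>' * n)"
proof -
  define p where "p = 1 - \<sigma> * \<sigma>' * b"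
  define q where "q = 1 + \<sigma> * \<sigma>' * x"
  have p: "0 \<le> p" "0 \<le> p + \<sigma> * r" using good_state_signs[OF good, of 1] good_state_signs[OF good, of "- 1"] \<sigma> \<sigma>' bx
    by (auto simp: p_def)
  have q: "0 \<le> q" "0 \<le> q - \<sigma>' * t" using \<sigma> \<sigma>' bx by (auto simp: q_def)
  have pn: "p \<le> p * n" "q \<le> q * n" using p q n by (auto simp: mult_le_cancel_left1)
  have X: "\<bar>\<sigma> * m - b * (\<sigma>' * m) + r\<bar> = \<bar>p * m + \<sigma> * r\<bar>" for m
    using \<sigma> \<sigma>' by (auto simp: p_def abs_if algebra_simps)
  have Y: "\<bar>\<sigma> * m * x + \<sigma>' * m - t\<bar> = \<bar>q * m - \<sigma>' * t\<bar>" for m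
    using \<sigma> \<sigma>' by (auto simp: q_def abs_if algebra_simps)
  have "c \<le> approx_val b r x t (\<sigma> * 1) (\<sigma>' * 1)"
    using good \<sigma> \<sigma>' unfolding good_state_def mult_1_right by blast
  also have "\<dots> \<le> approx_val b r x t (\<sigma> * n) (\<sigma>' * n)"
    unfolding approx_val_def X Y using p q pn bx
    by (intro divide_right_mono mult_mono) auto
  finally show ?thesis .
qed

text \<open>A quadratic with leading coefficient -x lies above its chord; the identity in the proof
  gives the exact excess.\<close>

lemma concave_product:
  fixes p q x n w w1 :: real
  assumes w: "n \<le> w" "w \<le> w1" and x: "0 \<le> x"
    and end1: "c \<le> (n + p) * (q - n * x)" and end2: "c \<le> (w1 + p) * (q - w1 * x)"
  shows "c \<le> (w + p) * (q - w * x)"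
proof (cases "n = w1")
  case True
  then show ?thesis using assms by simp
next
  case False
  then have d: "0 < w1 - n" using w by simp
  have "(w1 - n) * ((w + p) * (q - w * x)) =
     (w1 - w) * ((n + p) * (q - n * x)) + (w - n) * ((w1 + p) * (q - w1 * x))
     + x * (w - n) * (w1 - w) * (w1 - n)"
    by (simp add: algebra_simps)
  moreover have "(w1 - w) * c \<le> (w1 - w) * ((n + p) * (q - n * x))"
    using w end1 by (intro mult_left_mono) auto
  moreover have "(w - n) * c \<le> (w - n) * ((w1 + p) * (q - w1 * x))"
    using w end2 by (intro mult_left_mono) auto
  moreover have "0 \<le> x * (w - n) * (w1 - w) * (w1 - n)" using w x by simp
  moreover have "(w1 - n) * c = (w1 - w) * c + (w - n) * c" by (simp add: algebra_simps)
  ultimately have "(w1 - n) * c \<le> (w1 - n) * ((w + p) * (q - w * x))" by linarith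
  then show ?thesis using d by simp
qed

context cf_step
begin

text \<open>Put m = |v| and w = -u times the sign of v; the value is |w + p| |q - w x| / (1 + x b).
  The bound on |u| excludes -m < w < m, the bound on the next |v| excludes B - m < w < B + m. For w
  \<le> -m and for w \<ge> B + m the value is monotone, between m and B - m it is concave. The
  endpoints w = -m, m are corners of this index scaled by m, the endpoints B - m, B + m are such
  corners of the next index.\<close>

lemma approx_val_ge:
  assumes good: "good_state c b r x t" and good': "good_state c b' r' x' t'"
    and t: "0 \<le> t" "t \<le> x"
    and n: "1 \<le> \<bar>v\<bar>" and uv: "\<bar>v\<bar> \<le> \<bar>u\<bar>" and v': "\<bar>v\<bar> \<le> \<bar>next_v a u v\<bar>"
  shows "c \<le> approx_val b r x t u v"
proof -
  define \<sigma> where "\<sigma> = (if 0 < v then 1 else - 1 :: real)"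
  define m where "m = \<bar>v\<bar>"
  define w where "w = - \<sigma> * u"
  have \<sigma>: "\<sigma> = 1 \<or> \<sigma> = - 1" by (simp add: \<sigma>_def)
  have \<sigma>\<sigma>: "\<sigma> * \<sigma> = 1" using \<sigma> by auto
  have vm: "v = \<sigma> * m" and m1: "1 \<le> m" using n by (auto simp: \<sigma>_def m_def)
  have uw: "u = - \<sigma> * w" using \<sigma>\<sigma> by (simp add: w_def mult.assoc[symmetric])
  have wabs: "\<bar>w\<bar> = \<bar>u\<bar>" using \<sigma> by (auto simp: w_def)
  have den: "0 < 1 + x * b" "0 < 1 + x' * b'" by (rule den_pos')+
  have sc: "c \<le> approx_val b r x t (s1 * m) (s2 * m)" if "s1 = 1 \<or> s1 = - 1" "s2 = 1 \<or> s2 = - 1" for s1 s2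
    using good_state_scale[OF good m1 that] bs xs t den by simp
  have sc': "c \<le> approx_val b' r' x' t' (s1 * m) (s2 * m)" if "s1 = 1 \<or> s1 = - 1" "s2 = 1 \<or> s2 = - 1" for s1 s2
    using good_state_scale[OF good' m1 that] bs xs t's den by simp
  define p where "p = b * m - \<sigma> * r"
  define q where "q = m - \<sigma> * t"
  have val: "approx_val b r x t (- \<sigma> * z) v = \<bar>z + p\<bar> * \<bar>q - z * x\<bar> / (1 + x * b)" for z
  proof -
    have "\<bar>- \<sigma> * z - b * v + r\<bar> = \<bar>z + p\<bar>" using \<sigma> by (auto simp: vm p_def)
    moreover have "\<bar>- \<sigma> * z * x + v - t\<bar> = \<bar>q - z * x\<bar>" using \<sigma> by (auto simp: vm q_def)
    ultimately show ?thesis by (simp add: approx_val_def)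
  qed
  have mp: "0 \<le> m + p"
  proof -
    have "0 \<le> 1 + b - \<sigma> * r" using good_state_signs[OF good] \<sigma> by simp
    moreover have "1 + b \<le> (1 + b) * m" using m1 bs mult_left_mono[of 1 m "1 + b"] by simp
    ultimately show ?thesis by (simp add: p_def algebra_simps)
  qed
  have \<sigma>t: "\<sigma> * t \<le> x" "- (\<sigma> * t) \<le> x" using \<sigma> t xs by auto
  show ?thesis
  proof (cases "w \<le> 0")
    case True
    then have wm: "m \<le> - w" using uv wabs by (simp add: m_def)
    have "c \<le> approx_val b r x t (\<sigma> * m) (\<sigma> * m)" using sc \<sigma> by blast
    also have "\<dots> = \<bar>- m + p\<bar> * \<bar>q - (- m) * x\<bar> / (1 + x * b)" using val[of "- m"] by (simp add: vm)
    also have "\<dots> \<le> \<bar>w + p\<bar> * \<bar>q - w * x\<bar> / (1 + x * b)"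
    proof -
      have "0 \<le> 1 - b + \<sigma> * r" using good_state_signs[OF good] \<sigma> by simp
      moreover have "1 - b \<le> (1 - b) * m" using m1 bs mult_left_mono[of 1 m "1 - b"] by simp
      ultimately have "- m + p \<le> 0" by (simp add: p_def algebra_simps)
      then have 1: "\<bar>- m + p\<bar> \<le> \<bar>w + p\<bar>" using wm by linarith
      have "m * x \<le> (- w) * x" using wm xs by (intro mult_right_mono) auto
      moreover have "0 \<le> q" using \<sigma>t m1 xs by (simp add: q_def)
      moreover have "0 \<le> m * x" using m1 xs by simp
      ultimately have "\<bar>q - (- m) * x\<bar> \<le> \<bar>q - w * x\<bar>" by (simp add: abs_if)
      then show ?thesis using 1 den by (intro divide_right_mono mult_mono) auto
    qed
    also have "\<dots> = approx_val b r x t u v" using val[of w] uw by simp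
    finally show ?thesis .
  next
    case False
    then have wm: "m \<le> w" using uv wabs by (simp add: m_def)
    define B where "B = real_of_int a * m - \<sigma> * od"
    have nv: "next_v a (- \<sigma> * z) v = g * \<sigma> * (B - z)" for z
      using \<sigma> by (auto simp: next_v_def g_def od_def vm B_def algebra_simps)
    have nu: "next_u a \<epsilon> v = g * \<epsilon> * \<sigma> * m" by (simp add: next_u_def g_def vm)
    have gs: "g * \<epsilon> * \<sigma> = 1 \<or> g * \<epsilon> * \<sigma> = - 1" "g * \<sigma> = 1 \<or> g * \<sigma> = - 1" "- (g * \<sigma>) = 1 \<or> - (g * \<sigma>) = - 1"
      using g_cases \<epsilon> \<sigma> by auto
    have edge1: "c \<le> approx_val b r x t (- \<sigma> * (B - m)) v"
      using sc'[OF gs(1) gs(2)] approx_val_step[of v "- \<sigma> * (B - m)"] unfolding nv nu by simp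
    have edge2: "c \<le> approx_val b r x t (- \<sigma> * (B + m)) v"
      using sc'[OF gs(1) gs(3)] approx_val_step[of v "- \<sigma> * (B + m)"] unfolding nv nu by simp
    have Y: "q - z * x = x * (\<epsilon> * m * x' + (B - z) - g * \<sigma> * t')" for z
    proof -
      have "q - z * x = \<sigma> * (- \<sigma> * z * x + v - t)" using \<sigma> by (auto simp: q_def vm)
      also have "\<dots> = \<sigma> * (x * g * (g * \<epsilon> * \<sigma> * m * x' + g * \<sigma> * (B - z) - t'))"
        unfolding Y_step nu nv ..
      also have "\<dots> = x * (\<epsilon> * m * x' + (B - z) - g * \<sigma> * t')" using g_cases \<sigma> by auto
      finally show ?thesis .
    qed
    \<comment> \<open>As m x' and t' are at most m/2 and 1/2, and m \<ge> 1, the zero q / x of the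
      second factor lies between B - m and B + m.\<close>
    have mx: "m * x' \<le> m / 2" "0 \<le> m * x'" using m1 xs by auto
    have ex: "\<epsilon> * m * x' \<le> m / 2" "- (\<epsilon> * m * x') \<le> m / 2" using \<epsilon> mx by auto
    have gt: "g * \<sigma> * t' \<le> 1 / 2" "- (g * \<sigma> * t') \<le> 1 / 2" using gs(2) t's xs by auto
    have "\<bar>next_v a u v\<bar> = \<bar>B - w\<bar>" using nv[of w] uw g_cases \<sigma> by auto
    then consider "w \<le> B - m" | "B + m \<le> w" using v' m_def by linarith
    then show ?thesis
    proof cases
      case 1
      have q1: "0 \<le> q - (B - m) * x" unfolding Y using ex gt m1 xs by (intro mult_nonneg_nonneg) auto
      have q0: "0 \<le> q - m * x"
      proof -
        have "m * x \<le> (B - m) * x" using wm 1 xs by (intro mult_right_mono) auto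
        then show ?thesis using q1 by linarith
      qed
      have "c * (1 + x * b) \<le> (m + p) * (q - m * x)"
        using sc[of "- \<sigma>" \<sigma>] \<sigma> val[of m] mp q0 den by (auto simp: vm pos_le_divide_eq)
      moreover have "c * (1 + x * b) \<le> (B - m + p) * (q - (B - m) * x)"
        using edge1 mp wm 1 q1 den unfolding val by (simp add: pos_le_divide_eq)
      ultimately have "c * (1 + x * b) \<le> (w + p) * (q - w * x)"
        using concave_product[of m w "B - m" x "c * (1 + x * b)" p q] wm 1 xs by simp
      also have "\<dots> \<le> \<bar>w + p\<bar> * \<bar>q - w * x\<bar>" by (metis abs_ge_self abs_mult)
      finally show ?thesis using val[of w] uw den by (simp add: pos_le_divide_eq)
    next
      case 2
      have q1: "q - (B + m) * x \<le> 0"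
      proof -
        have "\<epsilon> * m * x' + (B - (B + m)) - g * \<sigma> * t' \<le> 0" using ex gt m1 by linarith
        then show ?thesis unfolding Y using xs by (intro mult_nonneg_nonpos) auto
      qed
      have "m \<le> B + m"
      proof -
        have "1 * 1 \<le> real_of_int a * m" using a2 m1 by (intro mult_mono) auto
        moreover have "\<sigma> * od \<le> 1" using \<sigma> by (auto simp: od_def)
        ultimately show ?thesis by (simp add: B_def)
      qed
      then have p1: "0 \<le> B + m + p" using mp by linarith
      have "(B + m) * x \<le> w * x" using 2 xs by (intro mult_right_mono) auto
      then have "\<bar>B + m + p\<bar> * \<bar>q - (B + m) * x\<bar> / (1 + x * b) \<le> \<bar>w + p\<bar> * \<bar>q - w * x\<bar> / (1 + x * b)"
        using p1 q1 2 den by (intro divide_right_mono mult_mono) auto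
      then show ?thesis using edge2 val[of w] val[of "B + m"] uw by simp
    qed
  qed
qed

end

section \<open>Nearest integer continued fractions\<close>

locale nicf =
  fixes \<alpha> :: real
  assumes \<alpha>_pos: "0 < \<alpha>" and \<alpha>_half: "\<alpha> < 1 / 2" and \<alpha>_irr: "\<alpha> \<notin> \<rat>"
begin

abbreviation x :: "nat \<Rightarrow> real" where "x \<equiv> nicf_rem \<alpha>"
text \<open>The shifts collect the data of one step: \<open>a k\<close> is the quotient of index k +
  1 and \<open>\<epsilon> k\<close> the sign of index k + 2, so that 1 / x_k = a k + \<epsilon> k
  x_{k+1}.\<close>

abbreviation a :: "nat \<Rightarrow> int" where "a k \<equiv> nicf_a \<alpha> (Suc k)"
abbreviation \<epsilon> :: "nat \<Rightarrow> int" where "\<epsilon> k \<equiv> nicf_eps \<alpha> (Suc (Suc k))"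

lemma rem_range: "0 < x k \<and> x k < 1 / 2 \<and> x k \<notin> \<rat>"
proof (induction k)
  case 0
  then show ?case using \<alpha>_pos \<alpha>_half \<alpha>_irr by simp
next
  case (Suc k)
  have "1 / x k \<notin> \<rat>"
  proof
    assume "1 / x k \<in> \<rat>"
    then have "1 / (1 / x k) \<in> \<rat>" by (rule Rats_divide[OF Rats_1])
    then show False using Suc by simp
  qed
  then show ?case using nint_dist_irrational by simp
qed

lemma x_pos: "0 < x k" and x_half: "x k < 1 / 2" and x_irr: "x k \<notin> \<rat>"
  using rem_range by auto

lemma eps_cases: "\<epsilon> k = 1 \<or> \<epsilon> k = - 1" by simp

lemma inverse_rem: "1 / x k = real_of_int (a k) + real_of_int (\<epsilon> k) * x (Suc k)"
proof -
  have irr: "1 / x k \<notin> \<rat>"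
  proof
    assume "1 / x k \<in> \<rat>"
    then have "1 / (1 / x k) \<in> \<rat>" by (rule Rats_divide[OF Rats_1])
    then show False using x_irr by simp
  qed
  then have zi: "1 / x k \<notin> \<int>" using Ints_subset_Rats by blast
  show ?thesis
  proof (cases "nint_dist (1 / x k) = frac (1 / x k)")
    case True
    then show ?thesis by (simp add: frac_def)
  next
    case False
    then have n: "nint_dist (1 / x k) = 1 - frac (1 / x k)" using nint_dist_cases[OF irr] by auto
    have "\<lceil>1 / x k\<rceil> = \<lfloor>1 / x k\<rfloor> + 1" using zi by (simp add: ceiling_altdef) (metis Ints_of_int)
    then show ?thesis using False n by (simp add: frac_def)
  qed
qed

declare nicf_rem.simps(2) [simp del] nicf_a.simps(2) [simp del] nicf_eps.simps(3) [simp del]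

lemma rem_eq: "x k * (real_of_int (a k) + real_of_int (\<epsilon> k) * x (Suc k)) = 1"
  using inverse_rem[of k] x_pos[of k] by (metis less_irrefl nonzero_eq_divide_eq mult.commute)

lemma a_ge2: "2 \<le> a k" and a_ge3: "\<epsilon> k = - 1 \<Longrightarrow> 3 \<le> a k"
proof -
  have z: "2 < 1 / x k" using x_pos[of k] x_half[of k] by (simp add: field_simps)
  show 3: "3 \<le> a k" if "\<epsilon> k = - 1"
  proof -
    have "1 / x k = real_of_int (a k) - x (Suc k)" using inverse_rem[of k] that by simp
    then have "2 < real_of_int (a k)" using z x_pos[of "Suc k"] by linarith
    then show ?thesis by linarith
  qed
  show "2 \<le> a k"
  proof (cases "\<epsilon> k = - 1")
    case True
    then show ?thesis using 3 by simp
  next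
    case False
    then have "\<epsilon> k = 1" using eps_cases by blast
    then have "1 / x k = real_of_int (a k) + x (Suc k)" using inverse_rem[of k] by simp
    then have "1 < real_of_int (a k)" using z x_half[of "Suc k"] by linarith
    then show ?thesis by linarith
  qed
qed

section \<open>Distances of the convergents and the normalised tails of the alternating
  series\<close>

definition W :: "nat \<Rightarrow> real" where "W k = (\<Prod>j<k. x j)"

lemma W_simps [simp]: "W 0 = 1" "W (Suc k) = W k * x k" by (simp_all add: W_def)

lemma W_pos: "0 < W k" by (simp add: W_def x_pos prod_pos)

lemma W_rec: "W k = real_of_int (a k) * W (Suc k) + real_of_int (\<epsilon> k) * W (Suc (Suc k))"
proof -
  have "W k = W k * (x k * (real_of_int (a k) + real_of_int (\<epsilon> k) * x (Suc k)))"
    using rem_eq by simp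
  then show ?thesis by (simp add: algebra_simps)
qed

primrec dsign :: "nat \<Rightarrow> real" where
  "dsign 0 = 1"
| "dsign (Suc k) = - real_of_int (\<epsilon> k) * dsign k"

lemma dsign_cases: "dsign k = 1 \<or> dsign k = - 1"
proof (induction k)
  case (Suc k)
  then show ?case using eps_cases[of k] by auto
qed simp

lemma convergent_diff:
  "real_of_int (nicf_q \<alpha> k) * \<alpha> - real_of_int (nicf_p \<alpha> k) = dsign k * W (Suc k) \<and>
   real_of_int (nicf_q \<alpha> (Suc k)) * \<alpha> - real_of_int (nicf_p \<alpha> (Suc k)) = dsign (Suc k) * W (Suc (Suc k))"
proof (induction k)
  case 0
  have "1 = real_of_int (a 0) * \<alpha> + real_of_int (\<epsilon> 0) * (\<alpha> * x (Suc 0))"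
    using W_rec[of 0] by simp
  then show ?case by (simp add: algebra_simps)
next
  case (Suc k)
  have "real_of_int (nicf_q \<alpha> (Suc (Suc k))) * \<alpha> - real_of_int (nicf_p \<alpha> (Suc (Suc k)))
     = real_of_int (a (Suc k)) * (real_of_int (nicf_q \<alpha> (Suc k)) * \<alpha> - real_of_int (nicf_p \<alpha> (Suc k)))
       + real_of_int (\<epsilon> k) * (real_of_int (nicf_q \<alpha> k) * \<alpha> - real_of_int (nicf_p \<alpha> k))"
    by (simp add: algebra_simps)
  also have "\<dots> = real_of_int (a (Suc k)) * (dsign (Suc k) * W (Suc (Suc k)))
       + real_of_int (\<epsilon> k) * (dsign k * W (Suc k))" using Suc by simp
  also have "real_of_int (\<epsilon> k) * (dsign k * W (Suc k)) = - dsign (Suc k) * W (Suc k)" by simp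
  also have "W (Suc k) = real_of_int (a (Suc k)) * W (Suc (Suc k)) + real_of_int (\<epsilon> (Suc k)) * W (Suc (Suc (Suc k)))"
    by (rule W_rec)
  finally show ?case using Suc by (simp add: algebra_simps)
qed

lemma nicf_D_eq: "nicf_D \<alpha> k = W (Suc k)"
proof -
  have "nicf_D \<alpha> k = \<bar>dsign k * W (Suc k)\<bar>" unfolding nicf_D_def using convergent_diff[of k] by simp
  also have "\<dots> = W (Suc k)" using dsign_cases[of k] W_pos[of "Suc k"] by auto
  finally show ?thesis .
qed

definition sg :: "nat \<Rightarrow> int" where "sg k = (- 1) ^ card {j \<in> {1..k}. odd (nicf_a \<alpha> j)}"

lemma sg_simps: "sg 0 = 1" "sg (Suc k) = (if odd (a k) then - sg k else sg k)"
proof -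
  show "sg 0 = 1" by (simp add: sg_def)
  have "{j \<in> {1..Suc k}. odd (nicf_a \<alpha> j)} =
    (if odd (a k) then insert (Suc k) {j \<in> {1..k}. odd (nicf_a \<alpha> j)} else {j \<in> {1..k}. odd (nicf_a \<alpha> j)})"
    by (auto simp: le_Suc_eq)
  then show "sg (Suc k) = (if odd (a k) then - sg k else sg k)" by (auto simp: sg_def)
qed

lemma sg_cases: "sg k = 1 \<or> sg k = - 1"
  by (induction k) (auto simp: sg_simps)

abbreviation lam :: "nat \<Rightarrow> int" where "lam k \<equiv> nicf_lam \<alpha> (Suc k)"

lemma lam_eq: "lam k = (if odd (a k) then sg (Suc k) else 0)"
  by (simp add: nicf_lam_def sg_def)

definition tail_term :: "nat \<Rightarrow> nat \<Rightarrow> real" where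
  "tail_term k i = real_of_int (lam (k + i)) * (\<Prod>j<Suc i. x (k + j))"

text \<open>The part of \<sigma> from index k on, divided by \<open>W k\<close>. The sign makes its
  first nonzero term positive.\<close>

definition \<tau> :: "nat \<Rightarrow> real" where
  "\<tau> k = - real_of_int (sg k) * (\<Sum>i. tail_term k i)"

lemma tail_term_bound: "norm (tail_term k i) \<le> (1 / 2) ^ Suc i"
proof -
  have "(\<Prod>j<Suc i. x (k + j)) \<le> (\<Prod>j<Suc i. 1 / 2)"
    using x_pos x_half by (intro prod_mono) (auto intro: less_imp_le)
  moreover have "0 \<le> (\<Prod>j<Suc i. x (k + j))" using x_pos by (intro prod_nonneg) (auto intro: less_imp_le)
  moreover have "\<bar>real_of_int (lam (k + i))\<bar> \<le> 1" using sg_cases[of "Suc (k + i)"] by (auto simp: lam_eq)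
  ultimately have "\<bar>real_of_int (lam (k + i))\<bar> * (\<Prod>j<Suc i. x (k + j)) \<le> 1 * (1 / 2) ^ Suc i"
    by (intro mult_mono) auto
  moreover have "norm (tail_term k i) = \<bar>real_of_int (lam (k + i))\<bar> * (\<Prod>j<Suc i. x (k + j))"
    unfolding tail_term_def real_norm_def abs_mult
    using \<open>0 \<le> (\<Prod>j<Suc i. x (k + j))\<close> by (simp only: abs_of_nonneg)
  ultimately show ?thesis by simp
qed

lemma tail_summable: "summable (tail_term k)"
proof (rule summable_comparison_test'[where N = 0])
  show "summable (\<lambda>i. (1 / 2 :: real) ^ Suc i)" by (simp add: summable_geometric)
qed (rule tail_term_bound)

lemma tail_bound: "\<bar>\<tau> k\<bar> \<le> 1"
proof -
  have "norm (\<Sum>i. tail_term k i) \<le> (\<Sum>i. (1 / 2 :: real) ^ Suc i)"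
    using tail_term_bound by (intro norm_suminf_le) (auto simp: summable_geometric)
  also have "\<dots> = 1" using sums_unique[OF power_half_series] by simp
  finally show ?thesis using sg_cases[of k] by (auto simp: \<tau>_def)
qed

lemma \<tau>_rec: "\<tau> k = (if odd (a k) then x k * (1 - \<tau> (Suc k)) else x k * \<tau> (Suc k))"
proof -
  have shift: "tail_term k (Suc i) = x k * tail_term (Suc k) i" for i
    unfolding tail_term_def prod.lessThan_Suc_shift[of _ "Suc i"] by (simp add: algebra_simps)
  have "(\<Sum>i. tail_term k i) = tail_term k 0 + (\<Sum>i. tail_term k (Suc i))"
    using suminf_split_head[OF tail_summable, of k] by simp
  also have "(\<Sum>i. tail_term k (Suc i)) = x k * (\<Sum>i. tail_term (Suc k) i)"
    unfolding shift using suminf_mult[OF tail_summable] by simp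
  finally have "(\<Sum>i. tail_term k i) = real_of_int (lam k) * x k + x k * (\<Sum>i. tail_term (Suc k) i)"
    by (simp add: tail_term_def)
  then show ?thesis using sg_cases[of k] by (auto simp: \<tau>_def lam_eq sg_simps algebra_simps)
qed

text \<open>By the recursion \<tau>_k and x_k - \<tau>_k are, in an order given by the parity, x_k
  \<tau>' and x_k (1 - \<tau>') with \<tau>' the next tail. Hence the two lower bounds follow from
  those at the next index with at most half the defect, starting from |\<tau>| \<le> 1.\<close>

lemma \<tau>_range: "0 \<le> \<tau> k" "\<tau> k \<le> x k"
proof -
  have *: "- (2 * (1 / 2) ^ n) \<le> \<tau> k \<and> - (2 * (1 / 2) ^ n) \<le> x k - \<tau> k" for n
  proof (induction n arbitrary: k)
    case 0
    then show ?case using tail_bound[of k] x_pos[of k] by auto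
  next
    case (Suc n)
    define c where "c = 2 * (1 / 2 :: real) ^ n"
    have c: "0 \<le> c" by (simp add: c_def)
    have IH: "- c \<le> \<tau> (Suc k)" "- c \<le> x (Suc k) - \<tau> (Suc k)" using Suc[of "Suc k"] by (auto simp: c_def)
    have b: "- (c / 2) \<le> x k * y" if "- c \<le> y" for y
    proof -
      have "x k * c \<le> c / 2" using mult_right_mono[of "x k" "1 / 2" c] c x_half[of k] by simp
      moreover have "x k * (- c) \<le> x k * y" using that x_pos[of k] by (intro mult_left_mono) auto
      ultimately show ?thesis by simp
    qed
    have 1: "- (c / 2) \<le> x k * \<tau> (Suc k)" using b IH by simp
    have 2: "- (c / 2) \<le> x k * (1 - \<tau> (Suc k))" using IH x_half[of "Suc k"] by (intro b) simp
    have "- (c / 2) \<le> \<tau> k \<and> - (c / 2) \<le> x k - \<tau> k"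
      using 1 2 \<tau>_rec[of k] by (auto simp: algebra_simps)
    then show ?case by (simp add: c_def)
  qed
  have lim: "(\<lambda>n. - (2 * (1 / 2 :: real) ^ n)) \<longlonglongrightarrow> - (2 * 0)"
    by (intro tendsto_intros LIMSEQ_power_zero) auto
  show "0 \<le> \<tau> k" using LIMSEQ_le_const2[OF lim, of "\<tau> k"] * by auto
  show "\<tau> k \<le> x k" using LIMSEQ_le_const2[OF lim, of "x k - \<tau> k"] * by auto
qed

lemma gamma_star_eq: "gamma_star \<alpha> = (1 + \<alpha> - \<tau> 0) / 2"
proof -
  \<comment> \<open>The differences of \<open>f\<close> are twice the summands of
    \<open>gamma_star\<close> without their \<lambda>-part.\<close>
  define f where "f i = W i + (real_of_int (nicf_eps \<alpha> (Suc i))) * W (Suc i)" for i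
  have W_le: "W n \<le> (1 / 2) ^ n" for n
  proof -
    have "W n \<le> (\<Prod>j<n. 1 / 2)" unfolding W_def
      using x_pos x_half by (intro prod_mono) (auto intro: less_imp_le)
    then show ?thesis by simp
  qed
  have W0: "W \<longlonglongrightarrow> 0"
  proof (rule tendsto_sandwich[of "\<lambda>_. 0" _ _ "\<lambda>n. (1 / 2) ^ n"])
    show "\<forall>\<^sub>F n in sequentially. 0 \<le> W n" using W_pos less_imp_le by (intro always_eventually) blast
    show "\<forall>\<^sub>F n in sequentially. W n \<le> (1 / 2) ^ n" using W_le by auto
  qed (auto intro: LIMSEQ_power_zero)
  have e1: "\<bar>real_of_int (nicf_eps \<alpha> (Suc i))\<bar> \<le> 1" for i
    by (cases i) (auto simp: nicf_eps.simps(3))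
  have "(\<lambda>i. real_of_int (nicf_eps \<alpha> (Suc i)) * W (Suc i)) \<longlonglongrightarrow> 0"
  proof (rule tendsto_rabs_zero_cancel, rule tendsto_sandwich[of "\<lambda>_. 0" _ _ "\<lambda>n. W (Suc n)"])
    show "\<forall>\<^sub>F n in sequentially. \<bar>real_of_int (nicf_eps \<alpha> (Suc n)) * W (Suc n)\<bar> \<le> W (Suc n)"
    proof (intro always_eventually allI)
      fix n
      have "\<bar>real_of_int (nicf_eps \<alpha> (Suc n))\<bar> * W (Suc n) \<le> 1 * W (Suc n)"
        by (intro mult_right_mono e1 less_imp_le[OF W_pos])
      then show "\<bar>real_of_int (nicf_eps \<alpha> (Suc n)) * W (Suc n)\<bar> \<le> W (Suc n)"
        using W_pos[of "Suc n"] unfolding abs_mult by simp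
    qed
    show "(\<lambda>n. W (Suc n)) \<longlonglongrightarrow> 0" using W0 by (rule LIMSEQ_Suc)
  qed auto
  then have "f \<longlonglongrightarrow> 0 + 0" unfolding f_def using W0 by (intro tendsto_add)
  then have "(\<lambda>i. f i - f (Suc i)) sums (f 0 - 0)" by (intro telescope_sums') simp
  moreover have "f i - f (Suc i) = real_of_int (a i - 1 + nicf_eps \<alpha> (Suc i)) * W (Suc i)" for i
    using W_rec[of i] by (simp add: f_def algebra_simps)
  moreover have "f 0 = 1 + \<alpha>" by (simp add: f_def)
  ultimately have 1: "(\<lambda>i. real_of_int (a i - 1 + nicf_eps \<alpha> (Suc i)) * W (Suc i)) sums (1 + \<alpha>)" by simp
  have "(\<lambda>i. tail_term 0 i) sums (\<Sum>i. tail_term 0 i)" using tail_summable by (rule summable_sums)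
  moreover have "tail_term 0 i = real_of_int (lam i) * W (Suc i)" for i
    by (simp add: tail_term_def W_def)
  moreover have "(\<Sum>i. tail_term 0 i) = - \<tau> 0" by (simp add: \<tau>_def sg_simps)
  ultimately have 2: "(\<lambda>i. real_of_int (lam i) * W (Suc i)) sums (- \<tau> 0)" by simp
  have "(\<lambda>i. 1 / 2 * (real_of_int (a i - 1 + nicf_eps \<alpha> (Suc i)) * W (Suc i) + real_of_int (lam i) * W (Suc i)))
     sums (1 / 2 * (1 + \<alpha> + - \<tau> 0))"
    by (intro sums_mult sums_add 1 2)
  moreover have "1 / 2 * (real_of_int (a i - 1 + nicf_eps \<alpha> (Suc i)) * W (Suc i) + real_of_int (lam i) * W (Suc i))
    = 1 / 2 * of_int (a i - 1 + nicf_eps \<alpha> (Suc i) + lam i) * nicf_D \<alpha> i" for i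
    by (simp add: nicf_D_eq algebra_simps)
  ultimately have "(\<lambda>i. 1 / 2 * of_int (a i - 1 + nicf_eps \<alpha> (Suc i) + lam i) * nicf_D \<alpha> i) sums (1 / 2 * (1 + \<alpha> + - \<tau> 0))"
    by (simp only:)
  then show ?thesis unfolding gamma_star_def by (simp add: sums_iff)
qed

end

section \<open>Approximation values along the expansion\<close>

context nicf
begin

text \<open>In terms of convergents this is q_{k-1} / q_k times the sign of index k + 1; the initial
  value 0 reflects q_{-1} = 0.\<close>

primrec bb :: "nat \<Rightarrow> real" where
  "bb 0 = 0"
| "bb (Suc k) = real_of_int (\<epsilon> k) / (real_of_int (a k) + bb k)"

primrec rr :: "nat \<Rightarrow> real" where
  "rr 0 = 0"
| "rr (Suc k) = (if odd (a k) then bb (Suc k) * (1 + rr k) else - bb (Suc k) * rr k)"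

lemma bb_range: "- (2 / 5) \<le> bb k" "bb k \<le> 5 / 8"
proof -
  have "- (2 / 5) \<le> bb k \<and> bb k \<le> 5 / 8"
  proof (induction k)
    case (Suc k)
    define z where "z = 1 / (real_of_int (a k) + bb k)"
    have a2: "2 \<le> real_of_int (a k)" using a_ge2[of k] by simp
    then have z: "0 < z" "z \<le> 5 / 8" using Suc by (auto simp: z_def field_simps)
    have "z \<le> 2 / 5" if "\<epsilon> k = - 1"
    proof -
      have "3 \<le> real_of_int (a k)" using a_ge3[OF that] by simp
      then show ?thesis using Suc by (simp add: z_def field_simps)
    qed
    moreover have "bb (Suc k) = real_of_int (\<epsilon> k) * z" by (simp add: z_def)
    ultimately show ?case using eps_cases[of k] z by auto
  qed simp
  then show "- (2 / 5) \<le> bb k" "bb k \<le> 5 / 8" by auto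
qed

lemma cf_step: "cf_step (bb k) (rr k) (x k) (\<tau> k) (bb (Suc k)) (rr (Suc k)) (x (Suc k)) (\<tau> (Suc k))
   (real_of_int (\<epsilon> k)) (a k)"
proof
  show "real_of_int (\<epsilon> k) = 1 \<or> real_of_int (\<epsilon> k) = - 1" using eps_cases[of k] by auto
qed (fact x_pos x_half \<tau>_range bb_range a_ge2 rem_eq \<tau>_rec bb.simps rr.simps)+

fun uv :: "int \<Rightarrow> int \<Rightarrow> nat \<Rightarrow> int \<times> int" where
  "uv U V 0 = (U, V)"
| "uv U V (Suc k) = (let u = fst (uv U V k); v = snd (uv U V k) in
     if odd (a k) then (- \<epsilon> k * v, - (u + a k * v - 1)) else (\<epsilon> k * v, u + a k * v))"

abbreviation uu :: "int \<Rightarrow> int \<Rightarrow> nat \<Rightarrow> real" where "uu U V k \<equiv> real_of_int (fst (uv U V k))"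
abbreviation vv :: "int \<Rightarrow> int \<Rightarrow> nat \<Rightarrow> real" where "vv U V k \<equiv> real_of_int (snd (uv U V k))"

lemma uv_next: "uu U V (Suc k) = next_u (a k) (real_of_int (\<epsilon> k)) (vv U V k)"
  "vv U V (Suc k) = next_v (a k) (uu U V k) (vv U V k)"
  by (simp_all add: next_u_def next_v_def Let_def)

lemma eps_odd: "odd (\<epsilon> k)" using eps_cases[of k] by auto

lemma uv_odd: "odd U \<Longrightarrow> odd V \<Longrightarrow> odd (fst (uv U V k)) \<and> odd (snd (uv U V k))"
  by (induction k) (auto simp: Let_def eps_odd)

definition state_val :: "nat \<Rightarrow> real \<Rightarrow> real \<Rightarrow> real" where
  "state_val k = approx_val (bb k) (rr k) (x k) (\<tau> k)"

lemma state_val_step: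
  "state_val (Suc k) (next_u (a k) (real_of_int (\<epsilon> k)) v) (next_v (a k) u v) = state_val k u v"
  unfolding state_val_def by (rule cf_step.approx_val_step[OF cf_step])

lemma state_val_const: "state_val k (uu U V k) (vv U V k) = \<bar>real_of_int U\<bar> * \<bar>real_of_int U * \<alpha> + real_of_int V - \<tau> 0\<bar>"
proof (induction k)
  case 0
  then show ?case by (simp add: state_val_def approx_val_def)
next
  case (Suc k)
  then show ?case unfolding uv_next state_val_step .
qed

text \<open>This product is 1 / q_k, so \<open>X_abs\<close> says that the first factor is |U| /
  q_k.\<close>

definition Bp :: "nat \<Rightarrow> real" where "Bp k = (\<Prod>j<k. \<bar>bb (Suc j)\<bar>)"

lemma bb_Suc_nonzero: "0 < \<bar>bb (Suc j)\<bar>"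
proof -
  have "2 \<le> real_of_int (a j)" using a_ge2[of j] by simp
  then have "0 < real_of_int (a j) + bb j" using bb_range[of j] by linarith
  then show ?thesis using eps_cases[of j] by auto
qed

lemma Bp_pos: "0 < Bp k" unfolding Bp_def using bb_Suc_nonzero by (intro prod_pos) blast

lemma Bp_le: "Bp k \<le> (5 / 8) ^ k"
proof -
  have "Bp k \<le> (\<Prod>j<k. 5 / 8)" unfolding Bp_def
  proof (intro prod_mono conjI)
    show "\<bar>bb (Suc i)\<bar> \<le> 5 / 8" for i using bb_range[of "Suc i"] unfolding abs_le_iff by linarith
  qed simp
  then show ?thesis by simp
qed

lemma X_abs: "\<bar>uu U V k - bb k * vv U V k + rr k\<bar> = \<bar>real_of_int U\<bar> * Bp k"
proof (induction k)
  case 0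
  then show ?case by (simp add: Bp_def)
next
  case (Suc k)
  interpret cf_step "bb k" "rr k" "x k" "\<tau> k" "bb (Suc k)" "rr (Suc k)" "x (Suc k)" "\<tau> (Suc k)"
    "real_of_int (\<epsilon> k)" "a k" by (rule cf_step)
  have "\<bar>g\<bar> = 1" using g_cases by auto
  then show ?case unfolding uv_next X_step abs_mult using Suc by (simp add: Bp_def)
qed

lemma Y_abs: "\<bar>uu U V k * x k + vv U V k - \<tau> k\<bar> * W k = \<bar>real_of_int U * \<alpha> + real_of_int V - \<tau> 0\<bar>"
proof (induction k)
  case 0
  then show ?case by simp
next
  case (Suc k)
  interpret cf_step "bb k" "rr k" "x k" "\<tau> k" "bb (Suc k)" "rr (Suc k)" "x (Suc k)" "\<tau> (Suc k)"
    "real_of_int (\<epsilon> k)" "a k" by (rule cf_step)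
  have "\<bar>g\<bar> = 1" using g_cases by auto
  then show ?case unfolding uv_next using Suc x_pos[of k] unfolding Y_step abs_mult
    by (simp add: mult.commute mult.left_commute)
qed

text \<open>A step is invertible over the integers because its sign is a unit, and its inverse keeps
  coordinates odd. The upper bound needs this: a corner at index k has to come from an actual
  point.\<close>

lemma uv_surj: "odd u \<Longrightarrow> odd v \<Longrightarrow> \<exists>U V. odd U \<and> odd V \<and> uv U V k = (u, v)"
proof (induction k arbitrary: u v)
  case 0
  then show ?case by auto
next
  case (Suc k)
  define v0 where "v0 = (if odd (a k) then - \<epsilon> k * u else \<epsilon> k * u)"
  define u0 where "u0 = (if odd (a k) then - v - a k * v0 + 1 else v - a k * v0)"
  have "odd v0" using Suc.prems eps_odd by (simp add: v0_def)
  moreover have "odd u0" using Suc.prems \<open>odd v0\<close> by (simp add: u0_def)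
  ultimately obtain U V where UV: "odd U" "odd V" "uv U V k = (u0, v0)" using Suc.IH by blast
  have "uv U V (Suc k) = (u, v)" using UV(3) eps_cases[of k] by (auto simp: u0_def v0_def)
  then show ?case using UV by blast
qed

text \<open>Odd integers have |v| \<ge> 1, so |v| cannot decrease forever after K. At the first
  index where it does not, |v| \<le> |u|: a step makes the old |v| the new |u|, and before that
  index |v| decreased. If that index is K itself, the size of U is what forces |v| < |u|.\<close>

lemma descent:
  assumes good: "\<And>k. K \<le> k \<Longrightarrow> good_state c (bb k) (rr k) (x k) (\<tau> k)"
  shows "\<exists>N0. \<forall>U V. odd U \<longrightarrow> odd V \<longrightarrow> N0 \<le> \<bar>real_of_int U\<bar> \<longrightarrow>
    \<bar>real_of_int U * \<alpha> + real_of_int V - \<tau> 0\<bar> \<le> 1 \<longrightarrow>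
    c \<le> \<bar>real_of_int U\<bar> * \<bar>real_of_int U * \<alpha> + real_of_int V - \<tau> 0\<bar>"
proof -
  define w where "w = 1 / W K"
  \<comment> \<open>If |u| \<le> |v| at K, the bound on the second factor gives |u| + |v| \<le> 4 w
    + 4; the constant excludes this after removal of \<open>rr K\<close>.\<close>
  define N0 where "N0 = (4 * w + 5 + \<bar>rr K\<bar>) / Bp K"
  have w: "0 < w" using W_pos by (simp add: w_def)
  have "c \<le> \<bar>real_of_int U\<bar> * \<bar>real_of_int U * \<alpha> + real_of_int V - \<tau> 0\<bar>"
    if U: "odd U" "odd V" and N0: "N0 \<le> \<bar>real_of_int U\<bar>"
      and Y: "\<bar>real_of_int U * \<alpha> + real_of_int V - \<tau> 0\<bar> \<le> 1" for U V
  proof -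
    have K: "\<bar>vv U V K\<bar> < \<bar>uu U V K\<bar>"
    proof -
      define u v where "u = uu U V K" and "v = vv U V K"
      have "\<bar>u * x K + v - \<tau> K\<bar> * W K \<le> 1" using Y_abs[of U V K] Y by (simp add: u_def v_def)
      then have "\<bar>u * x K + v - \<tau> K\<bar> \<le> w" using W_pos[of K] by (simp add: w_def pos_le_divide_eq)
      moreover have "\<bar>u * x K\<bar> \<le> \<bar>u\<bar> * (1 / 2)"
        unfolding abs_mult using x_pos[of K] x_half[of K] by (intro mult_left_mono) auto
      moreover have "\<bar>\<tau> K\<bar> \<le> 1" by (rule tail_bound)
      ultimately have v: "\<bar>v\<bar> \<le> w + 1 + \<bar>u\<bar> / 2" by linarith
      have "4 * w + 5 + \<bar>rr K\<bar> \<le> \<bar>real_of_int U\<bar> * Bp K"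
        using N0 Bp_pos[of K] by (simp add: N0_def pos_divide_le_eq)
      then have "4 * w + 5 + \<bar>rr K\<bar> \<le> \<bar>u - bb K * v + rr K\<bar>" using X_abs[of U V K] by (simp add: u_def v_def)
      moreover have "\<bar>bb K * v\<bar> \<le> 1 * \<bar>v\<bar>" unfolding abs_mult
        using bb_range[of K] by (intro mult_right_mono) auto
      ultimately have "4 * w + 5 \<le> \<bar>u\<bar> + \<bar>v\<bar>" by linarith
      then show ?thesis using v w unfolding u_def[symmetric] v_def[symmetric] by linarith
    qed
    have "\<exists>j. \<bar>snd (uv U V (K + j))\<bar> \<le> \<bar>snd (uv U V (Suc (K + j)))\<bar>"
    proof (rule ccontr)
      assume "\<not> ?thesis"
      then have "\<bar>snd (uv U V (K + Suc j))\<bar> < \<bar>snd (uv U V (K + j))\<bar>" for j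
        by (simp only: not_le not_ex add_Suc_right)
      then have "(nat \<bar>snd (uv U V (K + Suc j))\<bar>, nat \<bar>snd (uv U V (K + j))\<bar>) \<in> less_than" for j
        unfolding less_than_iff by (smt (verit) nat_less_eq_zless)
      then show False
        using wf_no_infinite_down_chainE[OF wf_less_than, of "\<lambda>j. nat \<bar>snd (uv U V (K + j))\<bar>"] by blast
    qed
    then obtain j where j: "\<bar>snd (uv U V (K + j))\<bar> \<le> \<bar>snd (uv U V (Suc (K + j)))\<bar>"
      and min: "\<And>i. i < j \<Longrightarrow> \<not> \<bar>snd (uv U V (K + i))\<bar> \<le> \<bar>snd (uv U V (Suc (K + i)))\<bar>"
      using exists_least_iff[of "\<lambda>j. \<bar>snd (uv U V (K + j))\<bar> \<le> \<bar>snd (uv U V (Suc (K + j)))\<bar>"] by blast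
    define k where "k = K + j"
    have uv: "\<bar>vv U V k\<bar> \<le> \<bar>uu U V k\<bar>"
    proof (cases j)
      case 0
      then show ?thesis using K by (simp add: k_def)
    next
      case (Suc i)
      have "\<bar>fst (uv U V (Suc (K + i)))\<bar> = \<bar>snd (uv U V (K + i))\<bar>"
        using eps_cases[of "K + i"] by (auto simp: Let_def)
      then show ?thesis using min[of i] Suc unfolding k_def by (simp only: add_Suc_right) linarith
    qed
    have "snd (uv U V k) \<noteq> 0" using uv_odd[OF U, of k] by auto
    then have v1: "1 \<le> \<bar>vv U V k\<bar>" by linarith
    have "\<bar>vv U V k\<bar> \<le> \<bar>vv U V (Suc k)\<bar>" using j unfolding k_def by linarith
    then have "c \<le> state_val k (uu U V k) (vv U V k)"
      unfolding state_val_def uv_next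
      using cf_step.approx_val_ge[OF cf_step good good, of k] uv v1 \<tau>_range by (simp add: k_def)
    then show ?thesis by (simp only: state_val_const)
  qed
  then show ?thesis by blast
qed

lemma nint_dist_value:
  assumes "U = 1 - 2 * n"
  shows "of_int \<bar>n\<bar> * \<bar>of_int n * \<alpha> - gamma_star \<alpha> - of_int m\<bar>
    = \<bar>1 - real_of_int U\<bar> * \<bar>real_of_int U * \<alpha> + real_of_int (2 * m + 1) - \<tau> 0\<bar> / 4"
proof -
  have n: "real_of_int n = (1 - real_of_int U) / 2" using assms by simp
  have "of_int n * \<alpha> - gamma_star \<alpha> - of_int m
     = - (real_of_int U * \<alpha> + real_of_int (2 * m + 1) - \<tau> 0) / 2"
    unfolding n gamma_star_eq by (simp add: field_simps)
  then have "\<bar>of_int n * \<alpha> - gamma_star \<alpha> - of_int m\<bar> = \<bar>real_of_int U * \<alpha> + real_of_int (2 * m + 1) - \<tau> 0\<bar> / 2"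
    by (simp only: abs_divide abs_minus_cancel abs_numeral)
  moreover have "real_of_int \<bar>n\<bar> = \<bar>1 - real_of_int U\<bar> / 2" using n by simp
  ultimately show ?thesis by (simp only: times_divide_times_eq numeral_times_numeral semiring_norm)
qed

lemma inhom_M_ge:
  assumes "\<And>c. c < T \<Longrightarrow> \<exists>K. \<forall>k\<ge>K. good_state c (bb k) (rr k) (x k) (\<tau> k)"
  shows "ereal (T / 4) \<le> inhom_M \<alpha> (gamma_star \<alpha>)"
  unfolding inhom_M_def le_Liminf_iff
proof (intro allI impI)
  fix y assume "y < ereal (T / 4)"
  then obtain y' where y': "y < ereal y'" "y' < T / 4" using ereal_dense2[of y "ereal (T / 4)"] by auto
  define c where "c = (4 * y' + T) / 2"
  have c: "4 * y' < c" "c < T" using y' by (auto simp: c_def)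
  obtain K where "\<forall>k\<ge>K. good_state c (bb k) (rr k) (x k) (\<tau> k)" using assms[OF c(2)] by blast
  then obtain N0 where N0: "\<And>U V. odd U \<Longrightarrow> odd V \<Longrightarrow> N0 \<le> \<bar>real_of_int U\<bar> \<Longrightarrow>
    \<bar>real_of_int U * \<alpha> + real_of_int V - \<tau> 0\<bar> \<le> 1 \<Longrightarrow>
    c \<le> \<bar>real_of_int U\<bar> * \<bar>real_of_int U * \<alpha> + real_of_int V - \<tau> 0\<bar>"
    using descent[of K c] by blast
  define d where "d = c - 4 * y'"
  have d: "0 < d" using c by (simp add: d_def)
  \<comment> \<open>The last entry makes |U| exceed |c| / d, so that passing from |U| to |U| - 1
    costs less than d.\<close>
  define N1 where "N1 = max N0 (max 1 (\<bar>c\<bar> / d + 1))"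
  show "\<forall>\<^sub>F n in filtercomap abs at_top. y < ereal (of_int \<bar>n\<bar> * nint_dist (of_int n * \<alpha> - gamma_star \<alpha>))"
    unfolding eventually_filtercomap_at_top_linorder
  proof (intro exI allI impI)
    fix n :: int assume n: "\<lceil>N1\<rceil> \<le> \<bar>n\<bar>"
    define m where "m = round (of_int n * \<alpha> - gamma_star \<alpha>)"
    define U where "U = 1 - 2 * n"
    define Y where "Y = \<bar>real_of_int U * \<alpha> + real_of_int (2 * m + 1) - \<tau> 0\<bar>"
    have nd: "nint_dist (of_int n * \<alpha> - gamma_star \<alpha>) = \<bar>of_int n * \<alpha> - gamma_star \<alpha> - of_int m\<bar>"
      by (simp add: nint_dist_def m_def)
    have N1n: "N1 \<le> \<bar>real_of_int n\<bar>" using n by linarith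
    moreover have N1: "1 \<le> N1" "N0 \<le> N1" "\<bar>c\<bar> / d < N1" by (auto simp: N1_def)
    ultimately have Un: "N1 \<le> \<bar>real_of_int U\<bar>" unfolding U_def by simp
    have "\<bar>of_int n * \<alpha> - gamma_star \<alpha> - of_int m\<bar> \<le> 1 / 2"
      unfolding m_def using of_int_round_abs_le by (metis abs_minus_commute)
    moreover have "of_int n * \<alpha> - gamma_star \<alpha> - of_int m = - (real_of_int U * \<alpha> + real_of_int (2 * m + 1) - \<tau> 0) / 2"
      unfolding gamma_star_eq U_def by (simp add: field_simps)
    ultimately have Y1: "Y \<le> 1" unfolding Y_def by simp
    have "odd U" "odd (2 * m + 1)" by (auto simp: U_def)
    then have cY: "c \<le> \<bar>real_of_int U\<bar> * Y" using N0[of U "2 * m + 1"] Un N1 Y1 unfolding Y_def by linarith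
    have Y0: "0 \<le> Y" by (simp add: Y_def)
    have U0: "1 \<le> \<bar>real_of_int U\<bar>" using Un N1 by linarith
    have "4 * y' < (\<bar>real_of_int U\<bar> - 1) * Y"
    proof -
      define t where "t = \<bar>real_of_int U\<bar>"
      have t: "\<bar>c\<bar> / d < t" "1 \<le> t" using Un N1 U0 unfolding t_def by linarith+
      have "\<bar>c\<bar> < d * t" using t d by (simp add: pos_divide_less_eq mult.commute)
      have "t * ((t - 1) * Y) = (t - 1) * (t * Y)" by simp
      also have "\<dots> \<ge> (t - 1) * c" using cY t unfolding t_def by (intro mult_left_mono) auto
      finally have "t * c - c \<le> t * ((t - 1) * Y)" by (simp add: algebra_simps)
      moreover have "c < t * c - t * (4 * y')" using \<open>\<bar>c\<bar> < d * t\<close> by (simp add: d_def algebra_simps)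
      ultimately have "t * (4 * y') < t * ((t - 1) * Y)" by linarith
      then show ?thesis using t unfolding t_def[symmetric] by (simp add: mult_less_cancel_left)
    qed
    also have "\<dots> \<le> \<bar>1 - real_of_int U\<bar> * Y" using Y0 by (intro mult_right_mono) auto
    finally have "y' < \<bar>1 - real_of_int U\<bar> * Y / 4" by simp
    also have "\<dots> = of_int \<bar>n\<bar> * nint_dist (of_int n * \<alpha> - gamma_star \<alpha>)"
      unfolding nd nint_dist_value[OF U_def] Y_def ..
    finally show "y < ereal (of_int \<bar>n\<bar> * nint_dist (of_int n * \<alpha> - gamma_star \<alpha>))"
      using y'(1) by (metis less_ereal.simps(1) less_trans)
  qed
qed

text \<open>The lower bound on the first factor gives |U| \<ge> d / \<open>Bp k\<close> \<ge> d
  (8/5)^k. Corners with small value at infinitely many k therefore yield arbitrarily large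
  |n|.\<close>

lemma inhom_M_le:
  assumes inf: "\<exists>\<^sub>\<infinity>k. state_val k (- 1) 1 \<le> c \<and> d \<le> \<bar>- 1 - bb k + rr k\<bar>" and d: "0 < d"
  shows "inhom_M \<alpha> (gamma_star \<alpha>) \<le> ereal (c / 4)"
proof (rule ccontr)
  assume "\<not> ?thesis"
  then have "ereal (c / 4) < inhom_M \<alpha> (gamma_star \<alpha>)" by simp
  then obtain y where y: "c / 4 < y" "ereal y < inhom_M \<alpha> (gamma_star \<alpha>)"
    using ereal_dense2[of "ereal (c / 4)" "inhom_M \<alpha> (gamma_star \<alpha>)"] by auto
  then have "\<forall>\<^sub>F n in filtercomap abs at_top. ereal y < ereal (of_int \<bar>n\<bar> * nint_dist (of_int n * \<alpha> - gamma_star \<alpha>))"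
    unfolding inhom_M_def by (intro less_LiminfD)
  then obtain N :: int where N: "\<And>n. N \<le> \<bar>n\<bar> \<Longrightarrow> y < of_int \<bar>n\<bar> * nint_dist (of_int n * \<alpha> - gamma_star \<alpha>)"
    unfolding eventually_filtercomap_at_top_linorder by auto
  define h where "h = 4 * y - c"
  have h: "0 < h" using y by (simp add: h_def)
  define L where "L = \<bar>real_of_int N\<bar> * 2 + 2 + \<bar>c\<bar> / h"
  have "(\<lambda>k. (5 / 8 :: real) ^ k) \<longlonglongrightarrow> 0" by (intro LIMSEQ_power_zero) auto
  moreover have L0: "0 < L"
  proof -
    have "0 \<le> \<bar>c\<bar> / h" using h by simp
    then show ?thesis unfolding L_def by linarith
  qed
  then have "0 < d / L" using d by simp
  ultimately have "\<forall>\<^sub>F k in sequentially. (5 / 8 :: real) ^ k < d / L" by (intro order_tendstoD(2))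
  then obtain k0 where k0: "\<And>k. k0 \<le> k \<Longrightarrow> (5 / 8 :: real) ^ k < d / L"
    unfolding eventually_sequentially by blast
  obtain k where k: "k0 \<le> k" "state_val k (- 1) 1 \<le> c" "d \<le> \<bar>- 1 - bb k + rr k\<bar>"
    using inf unfolding INFM_nat_le by blast
  obtain U V where UV: "odd U" "odd V" "uv U V k = (- 1, 1)" using uv_surj[of "- 1" 1 k] by auto
  define Y where "Y = \<bar>real_of_int U * \<alpha> + real_of_int V - \<tau> 0\<bar>"
  define t where "t = \<bar>real_of_int U\<bar>"
  have "d \<le> t * Bp k" using X_abs[of U V k] UV(3) k(3) by (simp add: t_def)
  also have "\<dots> \<le> t * (5 / 8) ^ k" using Bp_le by (intro mult_left_mono) (auto simp: t_def)
  also have "\<dots> \<le> t * (d / L)" using k0[OF k(1)] by (intro mult_left_mono) (auto simp: t_def)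
  finally have tL: "L \<le> t" using d L0 by (simp add: field_simps)
  have tY: "t * Y \<le> c" using state_val_const[of k U V] UV(3) k(2) by (simp add: t_def Y_def)
  obtain n where n: "U = 1 - 2 * n"
  proof -
    obtain j where "U = 2 * j + 1" using UV(1) by (rule oddE)
    then have "U = 1 - 2 * (- j)" by simp
    then show ?thesis by (rule that)
  qed
  obtain m where m: "V = 2 * m + 1" using UV(2) by (rule oddE)
  have "N \<le> \<bar>n\<bar>"
  proof -
    have "\<bar>real_of_int U\<bar> \<le> 1 + 2 * \<bar>real_of_int n\<bar>" using n by simp
    moreover have "0 \<le> \<bar>c\<bar> / h" using h by simp
    ultimately have "\<bar>real_of_int N\<bar> \<le> \<bar>real_of_int n\<bar>" using tL unfolding t_def L_def by linarith
    then show ?thesis by linarith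
  qed
  then have "y < of_int \<bar>n\<bar> * nint_dist (of_int n * \<alpha> - gamma_star \<alpha>)" by (rule N)
  also have "\<dots> \<le> of_int \<bar>n\<bar> * \<bar>of_int n * \<alpha> - gamma_star \<alpha> - of_int m\<bar>"
    by (intro mult_left_mono nint_dist_le) simp
  also have "\<dots> = \<bar>1 - real_of_int U\<bar> * Y / 4" unfolding nint_dist_value[OF n] Y_def m ..
  also have "\<dots> \<le> (1 + t) * Y / 4"
    by (intro divide_right_mono mult_right_mono) (auto simp: t_def Y_def)
  finally have "4 * y < Y + t * Y" by (simp add: algebra_simps)
  then have "h < Y" using tY by (simp add: h_def)
  have "c < h * t"
  proof -
    have "\<bar>c\<bar> / h < t" using tL unfolding L_def by linarith
    then show ?thesis using h by (simp add: pos_divide_less_eq mult.commute)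
  qed
  also have "\<dots> \<le> Y * t" using \<open>h < Y\<close> by (intro mult_right_mono) (auto simp: t_def)
  finally show False using tY by (simp add: mult.commute)
qed

end

section \<open>The lower bound\<close>

locale nicf_bounded = nicf \<alpha> + bound_params R for \<alpha> R +
  fixes K0 :: nat
  assumes a_ge_R: "K0 \<le> k \<Longrightarrow> int R \<le> a k"
begin

lemma admissible_k: "K0 \<le> k \<Longrightarrow> admissible (a k) (real_of_int (\<epsilon> k))"
  using a_ge_R[of k] a_ge3[of k] eps_cases[of k] by (auto simp: admissible_def)

lemma b_range_k: "K0 < k \<Longrightarrow> b_range (bb k)"
proof (cases k)
  case (Suc j)
  assume "K0 < k"
  then show ?thesis
    using b_range_step(3)[OF bb_range admissible_k, of j j] Suc by simp
qed simp

lemma x_upper: "K0 \<le> k \<Longrightarrow> x k * (real R - 1 / 2) \<le> 1"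
proof -
  assume k: "K0 \<le> k"
  have "real R \<le> real_of_int (a k)" using a_ge_R[OF k] by linarith
  then have "real R - 1 / 2 \<le> real_of_int (a k) + real_of_int (\<epsilon> k) * x (Suc k)"
    using eps_cases[of k] x_pos[of "Suc k"] x_half[of "Suc k"] by auto
  then show ?thesis
    using mult_left_mono[of "real R - 1 / 2" "real_of_int (a k) + real_of_int (\<epsilon> k) * x (Suc k)" "x k"]
      rem_eq[of k] x_pos[of k] by simp
qed

lemma \<eta>_A: "3 \<le> R \<Longrightarrow> 1 \<le> \<eta> * A" using \<eta>_eq by (simp add: algebra_simps)

text \<open>Meant for odd quotients, where x_k - \<tau>_k = x_k \<tau>_{k+1}. Both remainders are at
  most 1/(R - 1/2), while (R - 1/2)^2 \<ge> R + 1 \<ge> A and \<eta> \<ge> 1/A.\<close>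

lemma \<eta>_square:
  assumes "3 \<le> R" "K0 \<le> k"
  shows "x k * x (Suc k) \<le> \<eta>"
proof -
  define q where "q = real R - 1 / 2"
  have q: "5 / 2 \<le> q" using assms by (simp add: q_def)
  have x1: "x k \<le> 1 / q" "x (Suc k) \<le> 1 / q"
    using x_upper[of k] x_upper[of "Suc k"] assms q by (auto simp: q_def[symmetric] field_simps)
  have "x k * x (Suc k) \<le> 1 / q * (1 / q)"
    using x1 x_pos[of k] x_pos[of "Suc k"] q by (intro mult_mono) auto
  also have "\<dots> \<le> 1 / A"
  proof -
    have "A \<le> real R + 1" unfolding A_eq_sstar[OF assms(1)] by (simp add: R_sstar_def)
    also have "\<dots> \<le> q * q"
    proof -
      have "5 / 2 * q \<le> q * q" using q by (intro mult_right_mono) auto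
      then show ?thesis using q by (simp add: q_def)
    qed
    finally have "A \<le> q * q" .
    then have "1 / (q * q) \<le> 1 / A" using A4 by (intro divide_left_mono) auto
    then show ?thesis by simp
  qed
  also have "\<dots> \<le> \<eta>" using \<eta>_A[OF assms(1)] A4 by (simp add: field_simps)
  finally show ?thesis .
qed

text \<open>The worst future consists of quotients \<open>A\<close>, each followed by a minus sign,
  and \<eta> is the fixed point of that step. The bound at k uses the one at k + 1, so it is proved
  with an error halved at each step. For R = 2 it only says x - \<tau> \<le> 1/2.\<close>

lemma x_diff_\<tau>: "K0 \<le> k \<Longrightarrow> x k - \<tau> k \<le> \<eta>"
proof (cases "3 \<le> R")
  case False
  then have "\<eta> = 1 / 2" unfolding \<eta>_def theta2_def by simp
  then show ?thesis using x_half[of k] \<tau>_range[of k] by linarith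
next
  case R: True
  assume "K0 \<le> k"
  then have *: "x k - \<tau> k \<le> \<eta> + (1 / 2) ^ n" for n
  proof (induction n arbitrary: k)
    case 0
    then show ?case using x_half[of k] \<tau>_range[of k] \<eta>_pos by simp
  next
    case (Suc n)
    define M where "M = (1 / 2 :: real) ^ n"
    have M: "0 \<le> M" by (simp add: M_def)
    have IH: "x (Suc k) - \<tau> (Suc k) \<le> \<eta> + M" using Suc by (simp add: M_def)
    have "x k - \<tau> k \<le> \<eta> + M / 2"
    proof (cases "odd (a k)")
      case True
      then have "x k - \<tau> k = x k * \<tau> (Suc k)" using \<tau>_rec[of k] by (simp add: algebra_simps)
      also have "\<dots> \<le> x k * x (Suc k)" using \<tau>_range[of "Suc k"] x_pos[of k] by (intro mult_left_mono) auto
      also have "\<dots> \<le> \<eta>" by (rule \<eta>_square[OF R Suc.prems])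
      finally show ?thesis using M by simp
    next
      case False
      define Q where "Q = real_of_int (a k) + real_of_int (\<epsilon> k) * x (Suc k)"
      have xQ: "x k * Q = 1" using rem_eq by (simp add: Q_def)
      have "A \<le> real_of_int (a k)" using even_ge_A[OF a_ge_R[OF Suc.prems]] False a_ge_R[OF Suc.prems] R by simp
      then have QA: "A - x (Suc k) \<le> Q" using eps_cases[of k] x_pos[of "Suc k"] by (auto simp: Q_def)
      then have Q3: "3 \<le> Q" using A4 x_half[of "Suc k"] by linarith
      have "1 - \<tau> (Suc k) \<le> (\<eta> + M / 2) * Q"
      proof -
        have "\<eta> * (A - x (Suc k)) \<le> \<eta> * Q" using QA \<eta>_pos by (intro mult_left_mono) auto
        moreover have "\<eta> * (x (Suc k) - \<tau> (Suc k)) \<le> \<eta> * (\<eta> + M)" using IH \<eta>_pos by (intro mult_left_mono) auto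
        moreover have "\<eta> * \<tau> (Suc k) \<le> 1 * \<tau> (Suc k)" using \<tau>_range[of "Suc k"] \<eta>_half by (intro mult_right_mono) auto
        moreover have "\<eta> * M \<le> 1 * M" using M \<eta>_half by (intro mult_right_mono) auto
        moreover have "M / 2 * 3 \<le> M / 2 * Q" using M Q3 by (intro mult_left_mono) auto
        moreover have "\<eta> * (A - \<eta>) = 1" by (rule \<eta>_eq[OF R])
        ultimately show ?thesis using M by (simp add: algebra_simps)
      qed
      then have "x k * (1 - \<tau> (Suc k)) \<le> x k * ((\<eta> + M / 2) * Q)" using x_pos[of k] by (intro mult_left_mono) auto
      also have "\<dots> = (\<eta> + M / 2) * (x k * Q)" by simp
      also have "\<dots> = \<eta> + M / 2" by (simp add: xQ)
      finally show ?thesis using \<tau>_rec[of k] False by (simp add: algebra_simps)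
    qed
    then show ?case by (simp add: M_def)
  qed
  have "(\<lambda>n. \<eta> + (1 / 2 :: real) ^ n) \<longlonglongrightarrow> \<eta> + 0" by (intro tendsto_intros LIMSEQ_power_zero) auto
  then show ?thesis using LIMSEQ_le_const[of "\<lambda>n. \<eta> + (1 / 2) ^ n" "\<eta> + 0" "x k - \<tau> k"] * by auto
qed

text \<open>The worst case is a quotient \<open>s\<close>, a minus sign, then x' = \<eta> and
  \<tau>' = 0. For odd quotients x + \<tau> = x (2 - \<tau>'), and a positive \<tau>' gains more in
  this factor than it loses in x' \<le> \<eta> + \<tau>', because al \<le> 1/2.\<close>

lemma x_add_\<tau>: 
  assumes k: "K0 \<le> k"
  shows "x k + \<tau> k \<le> 2 * al"
proof -
  define Q where "Q = real_of_int (a k) + real_of_int (\<epsilon> k) * x (Suc k)"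
  have xQ: "x k * Q = 1" using rem_eq by (simp add: Q_def)
  have red: ?thesis if "x k + \<tau> k = x k * z" "z \<le> 2 * al * Q" for z
  proof -
    have "x k * z \<le> x k * (2 * al * Q)" using that x_pos[of k] by (intro mult_left_mono) auto
    also have "\<dots> = 2 * al * (x k * Q)" by simp
    finally show ?thesis using xQ that by simp
  qed
  have QQ: "real_of_int (a k) - x (Suc k) \<le> Q" using eps_cases[of k] x_pos[of "Suc k"] by (auto simp: Q_def)
  note t' = \<tau>_range[of "Suc k"]
  show ?thesis
  proof (cases "odd (a k)")
    case True
    have "s \<le> real_of_int (a k)" using odd_ge_s[OF a_ge_R[OF k] True] .
    then have "s - (\<eta> + \<tau> (Suc k)) \<le> Q" using QQ x_diff_\<tau>[of "Suc k"] k by simp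
    then have "al * (s - (\<eta> + \<tau> (Suc k))) \<le> al * Q" using al_pos by (intro mult_left_mono) auto
    moreover have "al * (s - (\<eta> + \<tau> (Suc k))) = 1 - al * \<tau> (Suc k)" using al_eq by (simp add: algebra_simps)
    moreover have "al * \<tau> (Suc k) \<le> 1 / 2 * \<tau> (Suc k)" using al_le t' by (intro mult_right_mono) auto
    ultimately have "2 - \<tau> (Suc k) \<le> 2 * al * Q" by linarith
    moreover have "x k + \<tau> k = x k * (2 - \<tau> (Suc k))" using \<tau>_rec[of k] True by (simp add: algebra_simps)
    ultimately show ?thesis by (rule red[rotated])
  next
    case False
    have "1 + \<tau> (Suc k) \<le> 2 * al * Q"
    proof (cases "a k = 2")
      case True
      then have "\<epsilon> k = 1" using a_ge3[of k] eps_cases[of k] by auto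
      then have Q: "Q = 2 + x (Suc k)" using True by (simp add: Q_def)
      have R: "R = 2" using a_ge_R[OF k] True R2 by simp
      then have "\<eta> = 1 / 2" unfolding \<eta>_def theta2_def by simp
      moreover have "s = 3" using small_R R by auto
      ultimately have s\<eta>: "s - \<eta> = 5 / 2" by simp
      have al: "al = 2 / 5" unfolding al_def s\<eta> by simp
      show ?thesis unfolding al Q using t' x_half[of "Suc k"] by simp
    next
      case ne: False
      have "3 \<le> a k" using ne a_ge2[of k] by linarith
      then have "A \<le> real_of_int (a k)" using even_ge_A[OF a_ge_R[OF k]] False by simp
      then have QA: "A - x (Suc k) \<le> Q" using QQ by linarith
      have als: "1 \<le> al * s" using al_eq al_pos \<eta>_pos mult_pos_pos[of al \<eta>] by (simp add: algebra_simps)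
      show ?thesis
      proof (cases "R \<le> 3")
        case True
        then have "1 / 3 \<le> al" "A = 4" using als small_R by auto
        moreover have "1 / 3 * (7 / 2) \<le> al * Q" using calculation QA x_half[of "Suc k"] by (intro mult_mono) auto
        ultimately show ?thesis using t' x_half[of "Suc k"] by simp
      next
        case R: False
        then have R4: "4 \<le> R" by simp
        have "x (Suc k) * (7 / 2) \<le> x (Suc k) * (real R - 1 / 2)"
          using R4 x_pos[of "Suc k"] by (intro mult_left_mono) auto
        then have x27: "x (Suc k) \<le> 2 / 7" using x_upper[of "Suc k"] k by simp
        have "s - 9 / 7 \<le> Q" using QA x27 large_R[OF R4] by auto
        then have "al * (s - 9 / 7) \<le> al * Q" using al_pos by (intro mult_left_mono) auto
        moreover have "al \<le> 22 / 100"
          using large_R[OF R4] \<eta>_large[OF R4] by (simp add: al_def field_simps)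
        moreover have "al * (s - 9 / 7) = al * s - 9 / 7 * al" by (simp add: algebra_simps)
        ultimately have "5 / 7 \<le> al * Q" using als by linarith
        then show ?thesis using t' x27 by linarith
      qed
    qed
    moreover have "x k + \<tau> k = x k * (1 + \<tau> (Suc k))" using \<tau>_rec[of k] False by (simp add: algebra_simps)
    ultimately show ?thesis by (rule red[rotated])
  qed
qed

lemma future_k: 
  assumes k: "K0 \<le> k"
  shows "future (x k) (\<tau> k)"
proof -
  have "x k \<le> 2 / 5" if "3 \<le> R"
  proof -
    have "x k * (5 / 2) \<le> x k * (real R - 1 / 2)" using that x_pos[of k] by (intro mult_left_mono) auto
    then show ?thesis using x_upper[OF k] by simp
  qed
  then show ?thesis unfolding future_def
    using x_pos[of k] x_half[of k] \<tau>_range[of k] x_diff_\<tau>[OF k] x_add_\<tau>[OF k] by auto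
qed

lemma region_eventually:
  assumes "0 < e"
  shows "\<exists>K\<ge>K0. \<forall>k\<ge>K. region e (bb k) (rr k)"
proof -
  define e0 where "e0 = \<bar>rr K0\<bar> + \<bar>rr K0 - \<kappa> * bb K0\<bar>"
  have e0: "0 \<le> e0" by (simp add: e0_def)
  have "region ((5 / 8) ^ n * e0) (bb (K0 + n)) (rr (K0 + n))" for n
  proof (induction n)
    case 0
    then show ?case using \<rho>_pos cc_bounds unfolding region_def e0_def by auto
  next
    case (Suc n)
    have "region (5 / 8 * ((5 / 8) ^ n * e0)) (bb (Suc (K0 + n))) (rr (Suc (K0 + n)))"
      by (rule region_step[OF bb_range admissible_k _ Suc]) (use e0 in auto)
    then show ?case by (simp add: mult.assoc)
  qed
  moreover have "(\<lambda>n. (5 / 8) ^ n * e0) \<longlonglongrightarrow> 0 * e0" by (intro tendsto_intros LIMSEQ_power_zero) auto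
  then have "\<forall>\<^sub>F n in sequentially. (5 / 8) ^ n * e0 < e" using assms by (intro order_tendstoD(2)) auto
  then obtain N where N: "\<And>n. N \<le> n \<Longrightarrow> (5 / 8) ^ n * e0 < e" unfolding eventually_sequentially by blast
  ultimately have "region e (bb (K0 + n)) (rr (K0 + n))" if "N \<le> n" for n
    using N[OF that] unfolding region_def by (smt (verit))
  then have "\<forall>k\<ge>K0 + N. region e (bb k) (rr k)"
    by (metis add_leD1 le_add_diff_inverse add_le_cancel_left)
  then show ?thesis by (intro exI[of _ "K0 + N"]) auto
qed

lemma state_val_signs:
  assumes "\<bar>bb k - rr k\<bar> \<le> 1" "\<bar>bb k + rr k\<bar> \<le> 1"
  shows "state_val k 1 1 = FA (bb k) (rr k) (x k) (\<tau> k)"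
    "state_val k (- 1) 1 = FB (bb k) (rr k) (x k) (\<tau> k)"
    "state_val k 1 (- 1) = FC (bb k) (rr k) (x k) (\<tau> k)"
    "state_val k (- 1) (- 1) = FD (bb k) (rr k) (x k) (\<tau> k)"
proof -
  have bs: "0 \<le> 1 - bb k + rr k" "0 \<le> 1 + bb k - rr k" "0 \<le> 1 + bb k + rr k" "0 \<le> 1 - bb k - rr k"
    using assms by auto
  have xs: "0 \<le> 1 + x k - \<tau> k" "0 \<le> 1 - x k - \<tau> k" "0 \<le> 1 - x k + \<tau> k" "0 \<le> 1 + x k + \<tau> k"
    using \<tau>_range[of k] x_pos[of k] x_half[of k] by auto
  show "state_val k 1 1 = FA (bb k) (rr k) (x k) (\<tau> k)"
    using bs(1) xs(1) by (simp add: state_val_def approx_val_def FA_def algebra_simps)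
  have "\<bar>- 1 - bb k * 1 + rr k\<bar> = 1 + bb k - rr k" "\<bar>- 1 * x k + 1 - \<tau> k\<bar> = 1 - x k - \<tau> k"
    using bs(2) xs(2) by linarith+
  then show "state_val k (- 1) 1 = FB (bb k) (rr k) (x k) (\<tau> k)"
    by (simp only: state_val_def approx_val_def FB_def)
  have "\<bar>1 - bb k * - 1 + rr k\<bar> = 1 + bb k + rr k" "\<bar>1 * x k + - 1 - \<tau> k\<bar> = 1 - x k + \<tau> k"
    using bs(3) xs(3) by linarith+
  then show "state_val k 1 (- 1) = FC (bb k) (rr k) (x k) (\<tau> k)"
    by (simp only: state_val_def approx_val_def FC_def)
  have "\<bar>- 1 - bb k * - 1 + rr k\<bar> = 1 - bb k - rr k" "\<bar>- 1 * x k + - 1 - \<tau> k\<bar> = 1 + x k + \<tau> k"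
    using bs(4) xs(4) by linarith+
  then show "state_val k (- 1) (- 1) = FD (bb k) (rr k) (x k) (\<tau> k)"
    by (simp only: state_val_def approx_val_def FD_def)
qed

lemma good_eventually:
  assumes e: "0 < e" "e \<le> 1 / 100"
  shows "\<exists>K. \<forall>k\<ge>K. good_state (T - e) (bb k) (rr k) (x k) (\<tau> k)"
proof -
  obtain K1 where K1: "K0 \<le> K1" and reg: "\<And>k. K1 \<le> k \<Longrightarrow> region e (bb k) (rr k)"
    using region_eventually[OF e(1)] by blast
  have os: "one_step R e (bb k) (rr k) (real_of_int (\<epsilon> k)) (x (Suc k)) (\<tau> (Suc k)) (a k)
      (bb (Suc k)) (rr (Suc k)) (real_of_int (a k) + bb k)" if k: "K1 < k" for k
  proof
    show "b_range (bb k)" using k K1 by (intro b_range_k) simp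
    show "region e (bb k) (rr k)" using k by (intro reg) simp
    show "admissible (a k) (real_of_int (\<epsilon> k))" using k K1 by (intro admissible_k) simp
    show "future (x (Suc k)) (\<tau> (Suc k))" using k K1 by (intro future_k) simp
  qed (use e in auto)
  have n: "\<bar>bb (Suc k) - rr (Suc k)\<bar> \<le> 1" "\<bar>bb (Suc k) + rr (Suc k)\<bar> \<le> 1" if "K1 < k" for k
    using one_step.factors_nonneg[OF os[OF that]] by auto
  have A: "T - e \<le> state_val (Suc k) 1 1" and B: "T - e \<le> state_val (Suc k) (- 1) 1" if "K1 < k" for k
    using one_step.FA_ge[OF os[OF that]] one_step.FB_ge[OF os[OF that]] state_val_signs[OF n[OF that]] by auto
  \<comment> \<open>The exceptional case of \<open>C\<close> falls back on \<open>B\<close> one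
    index earlier, that of \<open>D\<close> on \<open>C\<close> one index earlier; hence the
    staggered thresholds.\<close>
  have C: "T - e \<le> state_val (Suc k) 1 (- 1)" if k: "Suc K1 < k" for k
  proof (cases "a k = 3 \<and> \<epsilon> k = - 1")
    case True
    obtain j where j: "k = Suc j" using k by (cases k) auto
    have "state_val (Suc k) 1 (- 1) = state_val k (- 1) 1"
      using state_val_step[of k 1 "- 1"] True by (simp add: next_u_def next_v_def)
    then show ?thesis using B[of j] k j by simp
  next
    case False
    then have "\<not> (a k = 3 \<and> real_of_int (\<epsilon> k) = - 1)" by linarith
    then show ?thesis
      using one_step.FC_ge[OF os] state_val_signs(3)[OF n] k by simp
  qed
  have D: "T - e \<le> state_val (Suc k) (- 1) (- 1)" if k: "Suc (Suc K1) < k" for k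
  proof (cases "a k = 2")
    case True
    then have "\<epsilon> k = 1" using a_ge3[of k] eps_cases[of k] by auto
    obtain j where j: "k = Suc j" using k by (cases k) auto
    have "state_val (Suc k) (- 1) (- 1) = state_val k 1 (- 1)"
      using state_val_step[of k "- 1" 1] True \<open>\<epsilon> k = 1\<close> by (simp add: next_u_def next_v_def)
    then show ?thesis using C[of j] k j by simp
  next
    case False
    then show ?thesis
      using one_step.FD_ge[OF os] state_val_signs(4)[OF n] k by simp
  qed
  have "good_state (T - e) (bb k) (rr k) (x k) (\<tau> k)" if k: "K1 + 4 \<le> k" for k
  proof -
    obtain j where j: "k = Suc j" "Suc (Suc K1) < j" using k by (cases k) auto
    show ?thesis unfolding good_state_def
      using n[of j] A[of j] B[of j] C[of j] D[of j] j unfolding state_val_def by auto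
  qed
  then show ?thesis by blast
qed

theorem inhom_M_lower: "ereal (M1 R) \<le> inhom_M \<alpha> (gamma_star \<alpha>)"
  unfolding M1_eq
proof (rule inhom_M_ge)
  fix c assume c: "c < T"
  define e where "e = min (1 / 100) (T - c)"
  have e: "0 < e" "e \<le> 1 / 100" "c \<le> T - e" using c unfolding e_def by linarith+
  obtain K where "\<forall>k\<ge>K. good_state (T - e) (bb k) (rr k) (x k) (\<tau> k)" using good_eventually[OF e(1,2)] by blast
  then have "\<forall>k\<ge>K. good_state c (bb k) (rr k) (x k) (\<tau> k)"
    using good_state_mono[OF _ e(3)] by blast
  then show "\<exists>K. \<forall>k\<ge>K. good_state c (bb k) (rr k) (x k) (\<tau> k)" by blast
qed

end

section \<open>Existence and uniqueness of periodic expansions\<close>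

lemma cf_contract:
  fixes y z :: real
  assumes "2 \<le> m + \<sigma> * y" "2 \<le> m + \<sigma> * z" "\<sigma> = 1 \<or> \<sigma> = - 1"
  shows "\<bar>1 / (m + \<sigma> * y) - 1 / (m + \<sigma> * z)\<bar> \<le> \<bar>y - z\<bar> / 4"
proof -
  have "1 / (m + \<sigma> * y) - 1 / (m + \<sigma> * z) = \<sigma> * (z - y) / ((m + \<sigma> * y) * (m + \<sigma> * z))"
    using assms by (simp add: field_simps)
  also have "\<bar>\<dots>\<bar> = \<bar>y - z\<bar> / ((m + \<sigma> * y) * (m + \<sigma> * z))"
    using assms by (auto simp: abs_mult abs_minus_commute)
  also have "\<dots> \<le> \<bar>y - z\<bar> / (2 * 2)"
    using assms by (intro divide_left_mono mult_mono) auto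
  finally show ?thesis by simp
qed

lemma cf_den_ge2:
  fixes m :: int and \<sigma> y :: real
  assumes "2 \<le> m" "\<sigma> = 1 \<or> \<sigma> = - 1 \<and> 3 \<le> m" "0 \<le> y" "y \<le> 1 / 2"
  shows "2 \<le> real_of_int m + \<sigma> * y"
proof -
  have "2 \<le> real_of_int m" using assms by simp
  moreover have "\<sigma> = - 1 \<Longrightarrow> 3 \<le> real_of_int m" using assms by auto
  ultimately show ?thesis using assms by auto
qed

text \<open>The condition on entries of absolute value 2 is the nearest integer rule; positivity of
  the first entry reflects that the sign of index 1 is always 1.\<close>

locale signed_seq =
  fixes c :: "nat \<Rightarrow> int"
  assumes abs2: "2 \<le> \<bar>c i\<bar>" and c0: "0 < c 0"
    and after2: "\<bar>c i\<bar> = 2 \<Longrightarrow> 0 < c (Suc i)"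
begin

abbreviation sc :: "nat \<Rightarrow> real" where "sc i \<equiv> real_of_int (sgn (c i))"

lemma sc_cases: "sc i = 1 \<or> sc i = - 1" using abs2[of i] by (auto simp: sgn_if)

lemma den2: "0 \<le> y \<Longrightarrow> y \<le> 1 / 2 \<Longrightarrow> 2 \<le> real_of_int \<bar>c i\<bar> + sc (Suc i) * y"
proof (rule cf_den_ge2)
  show "sc (Suc i) = 1 \<or> sc (Suc i) = - 1 \<and> 3 \<le> \<bar>c i\<bar>"
    using abs2[of i] after2[of i] sc_cases[of "Suc i"] by (cases "\<bar>c i\<bar> = 2") (auto simp: sgn_if)
qed (use abs2 in auto)

text \<open>Truncations after n quotients of the fraction starting at position i. Denominators stay
  at least 2, so each level contracts by 1/4.\<close>

primrec ev :: "nat \<Rightarrow> nat \<Rightarrow> real" where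
  "ev 0 i = 0"
| "ev (Suc n) i = 1 / (real_of_int \<bar>c i\<bar> + sc (Suc i) * ev n (Suc i))"

lemma ev_range: "0 \<le> ev n i \<and> ev n i \<le> 1 / 2"
proof (induction n arbitrary: i)
  case (Suc n)
  define q where "q = real_of_int \<bar>c i\<bar> + sc (Suc i) * ev n (Suc i)"
  have "2 \<le> q" using den2[of "ev n (Suc i)" i] Suc[of "Suc i"] by (simp add: q_def)
  then have "0 \<le> 1 / q \<and> 1 / q \<le> 1 / 2" by (simp add: field_simps)
  then show ?case by (simp add: q_def)
qed simp

lemma ev_cauchy: "\<bar>ev (n + d) i - ev n i\<bar> \<le> (1 / 4) ^ n"
proof (induction n arbitrary: i)
  case 0
  then show ?case using ev_range[of d i] by simp
next
  case (Suc n)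
  have "\<bar>ev (Suc (n + d)) i - ev (Suc n) i\<bar> \<le> \<bar>ev (n + d) (Suc i) - ev n (Suc i)\<bar> / 4"
    unfolding ev.simps using ev_range den2 sc_cases by (intro cf_contract) auto
  also have "\<dots> \<le> (1 / 4) ^ n / 4" using Suc[of "Suc i"] by simp
  finally show ?case by simp
qed

lemma ev_Cauchy: "Cauchy (\<lambda>n. ev n i)"
proof (rule metric_CauchyI)
  fix e :: real assume e: "0 < e"
  have "(\<lambda>n. (1 / 4 :: real) ^ n) \<longlonglongrightarrow> 0" by (intro LIMSEQ_power_zero) auto
  then have "\<forall>\<^sub>F n in sequentially. (1 / 4 :: real) ^ n < e / 2" using e by (intro order_tendstoD(2)) auto
  then obtain M where M: "(1 / 4 :: real) ^ M < e / 2" unfolding eventually_sequentially by blast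
  have "\<bar>ev m i - ev M i\<bar> < e / 2" if "M \<le> m" for m
    using ev_cauchy[of M "m - M" i] M that by simp
  then have "dist (ev m i) (ev n i) < e" if "M \<le> m" "M \<le> n" for m n
    using that unfolding dist_real_def by (smt (verit) field_sum_of_halves)
  then show "\<exists>M. \<forall>m\<ge>M. \<forall>n\<ge>M. dist (ev m i) (ev n i) < e" by blast
qed

definition y :: "nat \<Rightarrow> real" where "y i = lim (\<lambda>n. ev n i)"

lemma ev_lim: "(\<lambda>n. ev n i) \<longlonglongrightarrow> y i"
  unfolding y_def using ev_Cauchy[of i] Cauchy_convergent_iff convergent_LIMSEQ_iff by blast

lemma y_range0: "0 \<le> y i" "y i \<le> 1 / 2"
proof -
  show "0 \<le> y i" using LIMSEQ_le_const[OF ev_lim] ev_range by blast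
  show "y i \<le> 1 / 2" using LIMSEQ_le_const2[OF ev_lim] ev_range by blast
qed

lemma y_rec: "y i = 1 / (real_of_int \<bar>c i\<bar> + sc (Suc i) * y (Suc i))"
proof -
  have "real_of_int \<bar>c i\<bar> + sc (Suc i) * y (Suc i) \<noteq> 0"
    using den2[OF y_range0, of i "Suc i"] by linarith
  then have "(\<lambda>n. ev (Suc n) i) \<longlonglongrightarrow> 1 / (real_of_int \<bar>c i\<bar> + sc (Suc i) * y (Suc i))"
    unfolding ev.simps by (intro tendsto_intros ev_lim)
  then show ?thesis using LIMSEQ_Suc[OF ev_lim] LIMSEQ_unique by blast
qed

lemma y_pos: "0 < y i"
  using y_rec[of i] den2[OF y_range0, of i "Suc i"] by (metis less_le_trans zero_less_divide_1_iff zero_less_numeral)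

lemma y_half: "y i < 1 / 2"
proof -
  have "2 < real_of_int \<bar>c i\<bar> + sc (Suc i) * y (Suc i)"
  proof (cases "sc (Suc i) = 1")
    case True
    have "2 \<le> real_of_int \<bar>c i\<bar>" using abs2[of i] by linarith
    then show ?thesis using True y_pos[of "Suc i"] by simp
  next
    case False
    then have s: "sc (Suc i) = - 1" using sc_cases by blast
    then have "\<bar>c i\<bar> \<noteq> 2" using after2[of i] by (auto simp: sgn_if)
    then have "3 \<le> \<bar>c i\<bar>" using abs2[of i] by linarith
    then have "3 \<le> real_of_int \<bar>c i\<bar>" by linarith
    then show ?thesis using s y_range0[of "Suc i"] by simp
  qed
  then have "1 / (real_of_int \<bar>c i\<bar> + sc (Suc i) * y (Suc i)) < 1 / 2"
    by (intro divide_strict_left_mono) auto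
  then show ?thesis using y_rec[of i] by simp
qed

lemma inverse_y: "1 / y i = real_of_int \<bar>c i\<bar> + sc (Suc i) * y (Suc i)"
  using y_rec[of i] by (metis div_by_1 divide_divide_eq_right mult_1)

text \<open>Infinite descent: if y_i = p / q, then y_{i+1} is a fraction with denominator p, and p <
  q.\<close>

lemma no_fraction: "y i \<noteq> real p / real q"
proof (induction q arbitrary: p i rule: less_induct)
  case (less q)
  show ?case
  proof
    assume eq: "y i = real p / real q"
    have p: "0 < real p" using eq y_pos[of i] by (cases p) auto
    have q: "0 < real q" using eq y_pos[of i] by (cases q) auto
    have "real p / real q < 1" using eq y_half[of i] by linarith
    then have pq: "p < q" using q by (simp add: field_simps)
    have "y (Suc i) = sc (Suc i) * (1 / y i - real_of_int \<bar>c i\<bar>)"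
      using inverse_y[of i] sc_cases[of "Suc i"] by auto
    also have "\<dots> = sc (Suc i) * (real q - real_of_int \<bar>c i\<bar> * real p) / real p"
      using p by (simp add: eq field_simps)
    also have "\<dots> = real_of_int (sgn (c (Suc i)) * (int q - \<bar>c i\<bar> * int p)) / real p" by simp
    finally have e: "y (Suc i) = real_of_int (sgn (c (Suc i)) * (int q - \<bar>c i\<bar> * int p)) / real p" .
    define z where "z = sgn (c (Suc i)) * (int q - \<bar>c i\<bar> * int p)"
    have "0 < real_of_int z / real p" using e y_pos[of "Suc i"] by (simp add: z_def)
    then have "0 \<le> z" using p by (simp add: zero_less_divide_iff)
    then have "y (Suc i) = real (nat z) / real p" using e by (simp add: z_def)
    then show False using less[OF pq] by blast
  qed
qed

lemma y_irrational: "y i \<notin> \<rat>"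
proof
  assume "y i \<in> \<rat>"
  then obtain m n :: nat where "n \<noteq> 0" "\<bar>y i\<bar> = real m / real n" using Rats_abs_nat_div_natE by metis
  then show False using no_fraction[of i m n] y_pos[of i] by simp
qed

lemma rem_y: "nicf_rem (y 0) k = y k"
proof (induction k)
  case (Suc k)
  then have "nicf_rem (y 0) (Suc k) = nint_dist (1 / y k)" by simp
  also have "\<dots> = y (Suc k)" unfolding inverse_y
    using nint_dist_int_add(1) y_pos y_half sc_cases by blast
  finally show ?case .
qed simp

lemma nicf_y: "nicf_eps (y 0) (Suc i) * nicf_a (y 0) (Suc i) = c i"
proof -
  have nd: "nint_dist (1 / y k) = y (Suc k)"
    and fr: "frac (1 / y k) = y (Suc k) \<longleftrightarrow> sc (Suc k) = 1"
    and fl: "sc (Suc k) = 1 \<Longrightarrow> \<lfloor>1 / y k\<rfloor> = \<bar>c k\<bar>"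
    and ce: "sc (Suc k) = - 1 \<Longrightarrow> \<lceil>1 / y k\<rceil> = \<bar>c k\<bar>" for k
    unfolding inverse_y
    using nint_dist_int_add[OF y_pos[of "Suc k"] y_half[of "Suc k"] sc_cases[of "Suc k"]] by blast+
  have a: "nicf_a (y 0) (Suc k) = \<bar>c k\<bar>" for k
    unfolding nicf_a.simps rem_y nd using fr[of k] fl[of k] ce[of k] sc_cases[of "Suc k"] by metis
  have "nicf_eps (y 0) (Suc (Suc k)) = sgn (c (Suc k))" for k
  proof -
    have "nicf_eps (y 0) (Suc (Suc k)) = (if sc (Suc k) = 1 then 1 else - 1)"
      unfolding nicf_eps.simps rem_y nd using fr[of k] by metis
    then show ?thesis using sc_cases[of "Suc k"] by auto
  qed
  then have "nicf_eps (y 0) (Suc k) = sgn (c k)" for k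
    using c0 by (cases k) auto
  then show ?thesis using a[of i] by (simp add: mult.commute abs_mult_sgn)
qed

end

lemma (in nicf) eps_cases': "nicf_eps \<alpha> (Suc k) = 1 \<or> nicf_eps \<alpha> (Suc k) = - 1"
  using eps_cases by (cases k) auto

lemma (in nicf) signed_quotients:
  assumes "nicf_eps \<alpha> (Suc k) * nicf_a \<alpha> (Suc k) = z"
  shows "a k = \<bar>z\<bar>" "nicf_eps \<alpha> (Suc k) = sgn z"
  using assms a_ge2[of k] eps_cases'[of k] by (auto simp: sgn_if)

text \<open>Equal signed quotients make each step of both expansions the same map, contracting by
  1/4, so the remainders at every index are arbitrarily close.\<close>

lemma nicf_unique:
  assumes "nicf \<alpha>" "nicf \<beta>"
    and eq: "\<And>i. nicf_eps \<alpha> (Suc i) * nicf_a \<alpha> (Suc i) = nicf_eps \<beta> (Suc i) * nicf_a \<beta> (Suc i)"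
  shows "\<alpha> = \<beta>"
proof -
  interpret A: nicf \<alpha> by fact
  interpret B: nicf \<beta> by fact
  have a: "nicf_a \<alpha> (Suc k) = nicf_a \<beta> (Suc k)" "nicf_eps \<alpha> (Suc k) = nicf_eps \<beta> (Suc k)" for k
    using A.signed_quotients[OF eq] B.signed_quotients[OF refl] by metis+
  have rec: "nicf_rem \<gamma> k = 1 / (real_of_int (nicf_a \<gamma> (Suc k)) + real_of_int (nicf_eps \<gamma> (Suc (Suc k))) * nicf_rem \<gamma> (Suc k))"
    if "nicf \<gamma>" for \<gamma> k
    using nicf.inverse_rem[OF that, of k] by (metis div_by_1 divide_divide_eq_right mult_1)
  have "\<bar>nicf_rem \<alpha> k - nicf_rem \<beta> k\<bar> \<le> (1 / 4) ^ n" for n k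
  proof (induction n arbitrary: k)
    case 0
    then show ?case using A.x_pos[of k] A.x_half[of k] B.x_pos[of k] B.x_half[of k] by simp
  next
    case (Suc n)
    have s: "real_of_int (nicf_eps \<beta> (Suc (Suc k))) = 1 \<or> real_of_int (nicf_eps \<beta> (Suc (Suc k))) = - 1 \<and> 3 \<le> nicf_a \<beta> (Suc k)"
      using B.eps_cases[of k] B.a_ge3[of k] by auto
    have "\<bar>nicf_rem \<alpha> k - nicf_rem \<beta> k\<bar> \<le> \<bar>nicf_rem \<alpha> (Suc k) - nicf_rem \<beta> (Suc k)\<bar> / 4"
      unfolding rec[OF assms(1), of k] rec[OF assms(2), of k] a
      using A.x_pos[of "Suc k"] A.x_half[of "Suc k"] B.x_pos[of "Suc k"] B.x_half[of "Suc k"] s B.a_ge2[of k]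
      by (intro cf_contract cf_den_ge2) auto
    then show ?case using Suc[of "Suc k"] by simp
  qed
  then have *: "\<bar>\<alpha> - \<beta>\<bar> \<le> (1 / 4) ^ n" for n by (metis nicf_rem.simps(1))
  have "(\<lambda>n. (1 / 4 :: real) ^ n) \<longlonglongrightarrow> 0" by (intro LIMSEQ_power_zero) auto
  then have "\<bar>\<alpha> - \<beta>\<bar> \<le> 0" using * by (intro LIMSEQ_le_const) auto
  then show ?thesis by simp
qed

lemma periodic_nicf_ex1:
  assumes "B \<noteq> []" and b2: "\<And>z. z \<in> set B \<Longrightarrow> 2 \<le> \<bar>z\<bar>" and b0: "0 < B ! 0"
    and after: "\<And>i. i < length B \<Longrightarrow> \<bar>B ! i\<bar> = 2 \<Longrightarrow> 0 < B ! (Suc i mod length B)"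
  shows "\<exists>!x. periodic_nicf B x"
proof -
  define c where "c i = B ! (i mod length B)" for i
  have L: "0 < length B" using assms by simp
  interpret signed_seq c
  proof
    show "2 \<le> \<bar>c i\<bar>" for i using L by (auto simp: c_def intro!: b2)
    show "0 < c 0" using b0 by (simp add: c_def)
    show "0 < c (Suc i)" if "\<bar>c i\<bar> = 2" for i
      using after[of "i mod length B"] that L by (simp add: c_def mod_Suc_eq)
  qed
  have per: "periodic_nicf B (y 0)"
    unfolding periodic_nicf_def using y_pos y_half y_irrational nicf_y c_def by metis
  show ?thesis
  proof (rule ex1I[of _ "y 0"])
    fix z assume z: "periodic_nicf B z"
    show "z = y 0"
    proof (rule nicf_unique)
      show "nicf z" "nicf (y 0)" using z per by (auto simp: nicf_def periodic_nicf_def)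
    qed (use z per in \<open>simp add: periodic_nicf_def\<close>)
  qed (rule per)
qed

lemma block_ge3_ex1: "3 \<le> R \<Longrightarrow> 1 \<le> k \<Longrightarrow> \<exists>!x. periodic_nicf (block_ge3 R k) x"
proof (rule periodic_nicf_ex1)
  assume R: "3 \<le> R" and k: "1 \<le> k"
  have 3: "3 \<le> \<bar>z\<bar>" if "z \<in> set (block_ge3 R k)" for z
    using that R by (auto simp: block_ge3_def R_star_def R_sstar_def split: if_splits)
  then show "2 \<le> \<bar>z\<bar>" if "z \<in> set (block_ge3 R k)" for z using that by fastforce
  show "0 < block_ge3 R k ! 0" using R k by (simp add: block_ge3_def nth_append R_star_def)
  show "0 < block_ge3 R k ! (Suc i mod length (block_ge3 R k))"
    if "i < length (block_ge3 R k)" "\<bar>block_ge3 R k ! i\<bar> = 2" for i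
    using 3[of "block_ge3 R k ! i"] that by simp
qed (simp add: block_ge3_def)

lemma block_2_nth:
  "j < k \<Longrightarrow> block_2 k A ! j = 3" "block_2 k A ! k = 4" "block_2 k A ! (k + 1) = - 3"
  "block_2 k A ! (k + 2) = - 2" "block_2 k A ! (k + 3) = int A" "length (block_2 k A) = k + 4"
  by (simp_all add: block_2_def nth_append)

lemma block_2_ex1: "1 \<le> k \<Longrightarrow> 2 \<le> A \<Longrightarrow> \<exists>!x. periodic_nicf (block_2 k A) x"
proof (rule periodic_nicf_ex1)
  assume k: "1 \<le> k" and A: "2 \<le> A"
  show "2 \<le> \<bar>z\<bar>" if "z \<in> set (block_2 k A)" for z
    using that A by (auto simp: block_2_def)
  show "0 < block_2 k A ! 0" using k block_2_nth(1)[of 0 k A] by simp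
  show "0 < block_2 k A ! (Suc i mod length (block_2 k A))"
    if i: "i < length (block_2 k A)" "\<bar>block_2 k A ! i\<bar> = 2" for i
  proof -
    consider "i < k" | "i = k" | "i = k + 1" | "i = k + 2" | "i = k + 3"
      using i(1) block_2_nth(6)[of k A] by linarith
    then show ?thesis
    proof cases
      case 4
      then have "Suc i mod (k + 4) = k + 3" by simp
      then show ?thesis using A unfolding block_2_nth(6) by (simp only: block_2_nth(5))
    next
      case 5
      then have "Suc i = k + 4" by simp
      then have "Suc i mod (k + 4) = 0" by (simp only: mod_self)
      then show ?thesis using k unfolding block_2_nth(6) by (simp only: block_2_nth(1))
    qed (use i(2) block_2_nth(1)[of i k A] block_2_nth(2,3)[of k A] in auto)
  qed
qed (simp add: block_2_def)

section \<open>Sharpness\<close>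

text \<open>The function is the value at the corner (-1, 1) after a quotient \<open>A\<close>
  followed by a minus sign; at (\<theta>, \<rho>, al, al) it equals \<open>T\<close>.\<close>

lemma (in bound_params) extremal_continuity:
  assumes "0 < e"
  obtains d where "0 < d" and "\<And>b r x t. \<bar>b - \<theta>\<bar> < d \<Longrightarrow> \<bar>r - \<rho>\<bar> < d \<Longrightarrow> \<bar>x - al\<bar> < d \<Longrightarrow> \<bar>t - al\<bar> < d
      \<Longrightarrow> (A + b - 1 - r) * (1 - x - t) / (A + b - x) < T + e"
proof -
  define f where "f z = (A + fst z - 1 - fst (snd z)) * (1 - fst (snd (snd z)) - snd (snd (snd z))) / (A + fst z - fst (snd (snd z)))"
    for z :: "real \<times> real \<times> real \<times> real"
  define z0 where "z0 = (\<theta>, \<rho>, al, al)"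
  have fz0: "f z0 = T" using den_pos by (simp add: f_def z0_def T_def G_def algebra_simps)
  have "isCont f z0" unfolding f_def using den_pos by (intro continuous_intros) (auto simp: z0_def)
  then have "(f \<longlongrightarrow> f z0) (nhds z0)" by (simp add: continuous_at tendsto_nhds_iff)
  then have "\<forall>\<^sub>F z in nhds z0. f z < T + e" using assms fz0 by (intro order_tendstoD(2)) auto
  then obtain d where d: "0 < d" "\<And>z. dist z z0 < d \<Longrightarrow> f z < T + e"
    unfolding eventually_nhds_metric by blast
  have dp: "dist (u, v) (u', v') \<le> dist u u' + dist v v'" for u u' :: "'p::metric_space" and v v' :: "'q::metric_space"
    unfolding dist_Pair_Pair by (rule sqrt_sum_squares_le_sum) auto
  show ?thesis
  proof (rule that[of "d / 4"])
    fix b r x t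
    assume h: "\<bar>b - \<theta>\<bar> < d / 4" "\<bar>r - \<rho>\<bar> < d / 4" "\<bar>x - al\<bar> < d / 4" "\<bar>t - al\<bar> < d / 4"
    have "dist (b, r, x, t) z0 \<le> dist b \<theta> + dist (r, x, t) (\<rho>, al, al)" unfolding z0_def by (rule dp)
    also have "dist (r, x, t) (\<rho>, al, al) \<le> dist r \<rho> + dist (x, t) (al, al)" by (rule dp)
    also have "dist (x, t) (al, al) \<le> dist x al + dist t al" by (rule dp)
    finally have "dist (b, r, x, t) z0 < d" using h unfolding dist_real_def by linarith
    then show "(A + b - 1 - r) * (1 - x - t) / (A + b - x) < T + e" using d(2) by (fastforce simp: f_def)
  qed (use d in simp)
qed

lemma (in bound_params) \<theta>_fix: "\<theta> = 1 / (s + 1 * \<theta>)"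
  using \<theta>_eq s3 \<theta>_pos by (simp add: field_simps)

lemma (in bound_params) \<eta>_fix: "3 \<le> R \<Longrightarrow> \<eta> = 1 / (A + - 1 * \<eta>)"
  using \<eta>_eq A4 \<eta>_half by (simp add: field_simps)

text \<open>The number 5/3 is the fixed point of z = 5/8 (1 + z).\<close>

lemma (in nicf) rr_bound: "\<bar>rr k\<bar> \<le> 5 / 3"
proof (induction k)
  case (Suc k)
  have b: "\<bar>bb (Suc k)\<bar> \<le> 5 / 8" using bb_range[of "Suc k"] unfolding abs_le_iff by linarith
  have "\<bar>rr (Suc k)\<bar> \<le> \<bar>bb (Suc k)\<bar> * (1 + \<bar>rr k\<bar>)"
  proof (cases "odd (a k)")
    case True
    then have "\<bar>rr (Suc k)\<bar> = \<bar>bb (Suc k)\<bar> * \<bar>1 + rr k\<bar>" by (simp del: bb.simps add: abs_mult)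
    also have "\<dots> \<le> \<bar>bb (Suc k)\<bar> * (1 + \<bar>rr k\<bar>)" by (intro mult_left_mono) auto
    finally show ?thesis .
  next
    case False
    then have "\<bar>rr (Suc k)\<bar> = \<bar>bb (Suc k)\<bar> * \<bar>rr k\<bar>" by (simp del: bb.simps add: abs_mult)
    also have "\<dots> \<le> \<bar>bb (Suc k)\<bar> * (1 + \<bar>rr k\<bar>)" by (intro mult_left_mono) auto
    finally show ?thesis .
  qed
  also have "\<dots> \<le> 5 / 8 * (1 + 5 / 3)" using b Suc by (intro mult_mono) auto
  finally show ?case by simp
qed simp

lemma (in nicf) rem_rec: "x k = 1 / (real_of_int (a k) + real_of_int (\<epsilon> k) * x (Suc k))"
  using inverse_rem[of k] by (metis div_by_1 divide_divide_eq_right mult_1)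

locale nicf_params = nicf \<alpha> + bound_params R for \<alpha> R
begin

text \<open>The error of \<open>rr\<close> is at most 3 times the new error of \<open>bb\<close>
  plus \<theta> < 1/3 times its old error. The constant 6 closes the induction, as 3/4 + 2 \<le>
  3.\<close>

lemma past_convergence:
  assumes "\<And>i. i < n \<Longrightarrow> a (q + i) = int (R_star R) \<and> \<epsilon> (q + i) = 1"
  shows "\<bar>bb (q + n) - \<theta>\<bar> \<le> (1 / 4) ^ n \<and> \<bar>rr (q + n) - \<rho>\<bar> \<le> 6 * (1 / 2) ^ n"
  using assms
proof (induction n)
  case 0
  have "\<bar>bb q - \<theta>\<bar> \<le> 1" using bb_range[of q] \<theta>_pos \<theta>_third unfolding abs_le_iff by linarith
  moreover have "\<bar>rr q - \<rho>\<bar> \<le> 6" using rr_bound[of q] \<rho>_pos \<rho>_less unfolding abs_le_iff by linarith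
  ultimately show ?case by simp
next
  case (Suc n)
  define k where "k = q + n"
  have IH: "\<bar>bb k - \<theta>\<bar> \<le> (1 / 4) ^ n" "\<bar>rr k - \<rho>\<bar> \<le> 6 * (1 / 2) ^ n" using Suc by (auto simp: k_def)
  have ak: "a k = int (R_star R)" "\<epsilon> k = 1" using Suc.prems[of n] by (auto simp: k_def)
  have as: "real_of_int (a k) = s" using ak by (simp add: s_def)
  have odd: "odd (a k)" using ak by (simp add: R_star_def)
  have b': "bb (Suc k) = 1 / (s + 1 * bb k)" using as ak by simp
  have "\<bar>bb (Suc k) - \<theta>\<bar> \<le> \<bar>bb k - \<theta>\<bar> / 4"
    unfolding b' by (subst \<theta>_fix, intro cf_contract) (use s3 bb_range[of k] \<theta>_pos in auto)
  then have 1: "\<bar>bb (Suc k) - \<theta>\<bar> \<le> (1 / 4) ^ Suc n" using IH by simp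
  have r': "rr (Suc k) = bb (Suc k) * (1 + rr k)" using odd by simp
  have "rr (Suc k) - \<rho> = (bb (Suc k) - \<theta>) * (1 + rr k) + \<theta> * (rr k - \<rho>)"
  proof -
    have "rr (Suc k) - \<rho> = bb (Suc k) * (1 + rr k) - \<theta> * (1 + \<rho>)" using r' \<rho>_eq by metis
    then show ?thesis by (simp add: algebra_simps del: bb.simps)
  qed
  then have "\<bar>rr (Suc k) - \<rho>\<bar> \<le> \<bar>bb (Suc k) - \<theta>\<bar> * \<bar>1 + rr k\<bar> + \<bar>\<theta>\<bar> * \<bar>rr k - \<rho>\<bar>"
    using abs_triangle_ineq[of "(bb (Suc k) - \<theta>) * (1 + rr k)" "\<theta> * (rr k - \<rho>)"] unfolding abs_mult by simp
  also have "\<dots> \<le> (1 / 4) ^ Suc n * 3 + 1 / 3 * (6 * (1 / 2) ^ n)"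
  proof (intro add_mono mult_mono)
    show "\<bar>1 + rr k\<bar> \<le> 3" using rr_bound[of k] unfolding abs_le_iff by linarith
    show "\<bar>\<theta>\<bar> \<le> 1 / 3" using \<theta>_pos \<theta>_third by simp
  qed (use 1 IH in auto)
  also have "\<dots> \<le> 6 * (1 / 2) ^ Suc n"
  proof -
    have "(1 / 4 :: real) ^ n \<le> (1 / 2) ^ n" by (intro power_mono) auto
    moreover have "(0 :: real) \<le> (1 / 2) ^ n" by simp
    ultimately show ?thesis unfolding power_Suc by linarith
  qed
  finally show ?case using 1 by (simp add: k_def del: bb.simps rr.simps)
qed

text \<open>The remainder converges by contraction, and even quotients only multiply the tail by x <
  1/2, so it vanishes in the limit.\<close>

lemma future_convergence:
  assumes "3 \<le> R" and "\<And>i. i < n \<Longrightarrow> a (q + i) = int (R_sstar R) \<and> \<epsilon> (q + i) = - 1"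
  shows "\<bar>x q - \<eta>\<bar> \<le> (1 / 4) ^ n \<and> \<tau> q \<le> (1 / 2) ^ n"
  using assms(2)
proof (induction n arbitrary: q)
  case 0
  then show ?case using x_pos[of q] x_half[of q] \<eta>_pos \<eta>_half \<tau>_range[of q] by auto
next
  case (Suc n)
  have IH: "\<bar>x (Suc q) - \<eta>\<bar> \<le> (1 / 4) ^ n" "\<tau> (Suc q) \<le> (1 / 2) ^ n"
  proof -
    have "a (Suc q + i) = int (R_sstar R) \<and> \<epsilon> (Suc q + i) = - 1" if "i < n" for i
      using Suc.prems[of "Suc i"] that by simp
    then show "\<bar>x (Suc q) - \<eta>\<bar> \<le> (1 / 4) ^ n" "\<tau> (Suc q) \<le> (1 / 2) ^ n" using Suc.IH[of "Suc q"] by auto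
  qed
  have aq: "a q = int (R_sstar R)" "\<epsilon> q = - 1" using Suc.prems[of 0] by auto
  have aA: "real_of_int (a q) = A" using aq A_eq_sstar[OF assms(1)] by simp
  have even: "even (a q)" using aq by (simp add: R_sstar_def)
  have x': "x q = 1 / (A + - 1 * x (Suc q))" using rem_rec[of q] aA aq by simp
  have "\<bar>x q - \<eta>\<bar> \<le> \<bar>x (Suc q) - \<eta>\<bar> / 4"
    unfolding x' by (subst \<eta>_fix[OF assms(1)], intro cf_contract)
      (use A4 x_half[of "Suc q"] x_pos[of "Suc q"] \<eta>_half \<eta>_pos in auto)
  moreover have "\<tau> q \<le> (1 / 2) ^ Suc n"
  proof -
    have "\<tau> q = x q * \<tau> (Suc q)" using \<tau>_rec[of q] even by simp
    also have "\<dots> \<le> 1 / 2 * (1 / 2) ^ n" using x_half[of q] x_pos[of q] IH \<tau>_range[of "Suc q"] by (intro mult_mono) auto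
    finally show ?thesis by simp
  qed
  ultimately show ?case using IH by simp
qed

text \<open>Position \<open>p\<close> carries the quotient \<open>A\<close>, and each sign belongs
  to the quotient after it. The future is prescribed from \<open>p + 2\<close> on, since \<eta> and
  tail 0 there give x and \<tau> near \<open>al\<close> at \<open>p + 1\<close>, where the corner is
  evaluated.\<close>

definition extremal :: "real \<Rightarrow> nat \<Rightarrow> bool" where
  "extremal d p \<longleftrightarrow> even (a p) \<and> real_of_int (a p) = A \<and> \<epsilon> p = - 1 \<and>
     a (Suc p) = int (R_star R) \<and> \<epsilon> (Suc p) = - 1 \<and>
     \<bar>bb p - \<theta>\<bar> < d \<and> \<bar>rr p - \<rho>\<bar> < d \<and> \<bar>x (Suc (Suc p)) - \<eta>\<bar> < d / 2 \<and> \<tau> (Suc (Suc p)) < d / 2"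

lemma extremal_value:
  assumes ext: "extremal d p" and d: "d \<le> 1 / 2"
    and cont: "\<And>b r x t. \<bar>b - \<theta>\<bar> < d \<Longrightarrow> \<bar>r - \<rho>\<bar> < d \<Longrightarrow> \<bar>x - al\<bar> < d \<Longrightarrow> \<bar>t - al\<bar> < d
      \<Longrightarrow> (A + b - 1 - r) * (1 - x - t) / (A + b - x) < c"
  shows "state_val (Suc p) (- 1) 1 \<le> c \<and> 1 / 4 \<le> \<bar>- 1 - bb (Suc p) + rr (Suc p)\<bar>"
proof -
  define P where "P = A + bb p"
  define X where "X = x (Suc p)"
  define t where "t = \<tau> (Suc p)"
  define r where "r = rr p"
  have r: "\<bar>r - \<rho>\<bar> < d" and b: "\<bar>bb p - \<theta>\<bar> < d" using ext by (auto simp: extremal_def r_def)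
  have r1: "r < 1" using r d \<rho>_less by linarith
  have P: "18 / 5 \<le> P" using A4 bb_range[of p] unfolding P_def by linarith
  have bS: "bb (Suc p) = - 1 / P" using ext by (simp add: extremal_def P_def)
  have rS: "rr (Suc p) = r / P" using ext bS by (simp add: extremal_def r_def del: bb.simps)
  have Xs: "0 < X" "X < 1 / 2" "0 \<le> t" "t \<le> X" using x_pos x_half \<tau>_range by (auto simp: X_def t_def)
  have Xal: "\<bar>X - al\<bar> < d / 8" and d0: "0 < d"
  proof -
    have "X = 1 / (s + - 1 * x (Suc (Suc p)))"
      using rem_rec[of "Suc p"] ext by (simp add: X_def extremal_def s_def)
    moreover have "al = 1 / (s + - 1 * \<eta>)" by (simp add: al_def)
    ultimately have "\<bar>X - al\<bar> \<le> \<bar>x (Suc (Suc p)) - \<eta>\<bar> / 4"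
      using cf_contract[of s "- 1" "x (Suc (Suc p))" \<eta>] s3 x_half[of "Suc (Suc p)"] \<eta>_half by simp
    then show "\<bar>X - al\<bar> < d / 8" using ext by (simp add: extremal_def)
    show "0 < d" using b by linarith
  qed
  have "odd (a (Suc p))" using ext by (simp add: extremal_def R_star_def)
  then have "t = X - X * \<tau> (Suc (Suc p))" using \<tau>_rec[of "Suc p"] by (simp add: t_def X_def algebra_simps)
  moreover have "X * \<tau> (Suc (Suc p)) \<le> 1 / 2 * (d / 2)"
    using Xs ext \<tau>_range[of "Suc (Suc p)"] by (intro mult_mono) (auto simp: extremal_def)
  moreover have "0 \<le> X * \<tau> (Suc (Suc p))" using Xs \<tau>_range[of "Suc (Suc p)"] by simp
  ultimately have tal: "\<bar>t - al\<bar> < d" using Xal d0 by linarith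
  have val: "(P - 1 - r) * (1 - X - t) / (P - X) < c"
    using cont[OF b r _ tal, of X] Xal d0 unfolding P_def by linarith
  have X1: "\<bar>- 1 - bb (Suc p) + rr (Suc p)\<bar> = (P - 1 - r) / P"
  proof -
    have "- 1 - bb (Suc p) + rr (Suc p) = - ((P - 1 - r) / P)"
      using P by (simp add: bS rS field_simps del: bb.simps rr.simps)
    then show ?thesis using P r1 by simp
  qed
  have "1 + X * bb (Suc p) = (P - X) / P" using P by (simp add: bS field_simps del: bb.simps)
  moreover have "\<bar>- 1 * X + 1 - t\<bar> = 1 - X - t" using Xs by simp
  ultimately have "state_val (Suc p) (- 1) 1 = (P - 1 - r) / P * (1 - X - t) / ((P - X) / P)"
    using X1 unfolding state_val_def approx_val_def X_def[symmetric] t_def[symmetric] by simp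
  also have "\<dots> = (P - 1 - r) * (1 - X - t) / (P - X)" using P by simp
  finally have "state_val (Suc p) (- 1) 1 \<le> c" using val by simp
  moreover have "1 / 4 \<le> (P - 1 - r) / P" using P r1 by (simp add: field_simps)
  ultimately show ?thesis using X1 by simp
qed

lemma inhom_M_upper:
  assumes inf: "\<And>m. \<exists>p\<ge>m. extremal d p" and d: "d \<le> 1 / 2"
    and cont: "\<And>b r x t. \<bar>b - \<theta>\<bar> < d \<Longrightarrow> \<bar>r - \<rho>\<bar> < d \<Longrightarrow> \<bar>x - al\<bar> < d \<Longrightarrow> \<bar>t - al\<bar> < d
      \<Longrightarrow> (A + b - 1 - r) * (1 - x - t) / (A + b - x) < c"
  shows "inhom_M \<alpha> (gamma_star \<alpha>) \<le> ereal (c / 4)"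
proof (rule inhom_M_le)
  show "\<exists>\<^sub>\<infinity>k. state_val k (- 1) 1 \<le> c \<and> 1 / 4 \<le> \<bar>- 1 - bb k + rr k\<bar>"
    unfolding INFM_nat_le
  proof
    fix m
    obtain p where "m \<le> p" "extremal d p" using inf by blast
    then show "\<exists>n\<ge>m. state_val n (- 1) 1 \<le> c \<and> 1 / 4 \<le> \<bar>- 1 - bb n + rr n\<bar>"
      using extremal_value[OF _ d cont] by (intro exI[of _ "Suc p"]) auto
  qed
qed simp

end

lemma (in nicf) periodic_quotients:
  assumes per: "periodic_nicf B \<alpha>" and i: "i < length B"
  shows "a (j * length B + i) = \<bar>B ! i\<bar>" "\<epsilon> (j * length B + i) = sgn (B ! (Suc i mod length B))"
proof -
  have "nicf_eps \<alpha> (Suc n) * a n = B ! (n mod length B)" for n using per by (simp add: periodic_nicf_def)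
  note q = signed_quotients[OF this]
  show "a (j * length B + i) = \<bar>B ! i\<bar>" using q(1)[of "j * length B + i"] i by simp
  have "Suc (j * length B + i) mod length B = Suc i mod length B"
    by (metis add_Suc_right mod_mult_self3)
  then show "\<epsilon> (j * length B + i) = sgn (B ! (Suc i mod length B))" using q(2)[of "Suc (j * length B + i)"] by simp
qed

lemma (in nicf) periodic_bound:
  assumes per: "periodic_nicf B \<alpha>" and B: "B \<noteq> []" "\<And>z. z \<in> set B \<Longrightarrow> m \<le> \<bar>z\<bar>"
  shows "m \<le> a k"
proof -
  have L: "k mod length B < length B" using B by simp
  have "a k = \<bar>B ! (k mod length B)\<bar>" using periodic_quotients(1)[OF per L, of "k div length B"] by simp
  then show ?thesis using B L by simp
qed

lemma tendsto_ereal_squeeze: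
  assumes "\<forall>\<^sub>F z in F. ereal M \<le> f z" and "\<And>e. 0 < e \<Longrightarrow> \<forall>\<^sub>F z in F. f z \<le> ereal (M + e)"
  shows "(f \<longlongrightarrow> ereal M) F"
proof (rule order_tendstoI)
  fix l assume "l < ereal M"
  then show "\<forall>\<^sub>F z in F. l < f z" using assms(1) by (auto elim!: eventually_mono)
next
  fix u assume "ereal M < u"
  then obtain u' where u': "M < u'" "ereal u' < u" using ereal_dense2[of "ereal M" u] by auto
  have "\<forall>\<^sub>F z in F. f z \<le> ereal (M + (u' - M))" using u' by (intro assms(2)) simp
  then show "\<forall>\<^sub>F z in F. f z < u" using u' by (auto elim!: eventually_mono)
qed

lemma block_ge3_nth:
  "j < k \<Longrightarrow> block_ge3 R k ! j = int (R_star R)" "block_ge3 R k ! k = int (R_sstar R)"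
  "block_ge3 R k ! Suc k = - int (R_star R)"
  "j < k \<Longrightarrow> block_ge3 R k ! (Suc (Suc k) + j) = - int (R_sstar R)"
  "length (block_ge3 R k) = Suc (Suc (k + k))"
  by (simp_all add: block_ge3_def nth_append)

lemma block_ge3_limit:
  assumes R: "3 \<le> R" and per: "\<And>k. 1 \<le> k \<Longrightarrow> periodic_nicf (block_ge3 R k) (\<beta> k)"
  shows "((\<lambda>k. inhom_M (\<beta> k) (gamma_star (\<beta> k))) \<longlongrightarrow> ereal (M1 R)) at_top"
proof (rule tendsto_ereal_squeeze)
  interpret bound_params R using R by unfold_locales simp
  have nicf: "nicf (\<beta> k)" if "1 \<le> k" for k
    using per[OF that] by (simp add: nicf_def periodic_nicf_def)
  have "ereal (M1 R) \<le> inhom_M (\<beta> k) (gamma_star (\<beta> k))" if k: "1 \<le> k" for k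
  proof -
    interpret nicf "\<beta> k" by (rule nicf[OF k])
    have "int R \<le> a i" for i
    proof (rule periodic_bound[OF per[OF k]])
      show "int R \<le> \<bar>z\<bar>" if "z \<in> set (block_ge3 R k)" for z
        using that by (auto simp: block_ge3_def R_star_def R_sstar_def split: if_splits)
    qed (simp add: block_ge3_def)
    then interpret nicf_bounded "\<beta> k" R 0 by unfold_locales
    show ?thesis by (rule inhom_M_lower)
  qed
  then show "\<forall>\<^sub>F k in at_top. ereal (M1 R) \<le> inhom_M (\<beta> k) (gamma_star (\<beta> k))"
    unfolding eventually_at_top_linorder by blast
  fix e :: real assume e: "0 < e"
  obtain d0 where d0: "0 < d0" "\<And>b r x t. \<bar>b - \<theta>\<bar> < d0 \<Longrightarrow> \<bar>r - \<rho>\<bar> < d0 \<Longrightarrow> \<bar>x - al\<bar> < d0 \<Longrightarrow> \<bar>t - al\<bar> < d0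
      \<Longrightarrow> (A + b - 1 - r) * (1 - x - t) / (A + b - x) < T + 4 * e"
    using extremal_continuity[of "4 * e"] e by auto
  define d where "d = min d0 (1 / 2)"
  have d: "0 < d" "d \<le> 1 / 2" "d \<le> d0" using d0 by (auto simp: d_def)
  \<comment> \<open>The factor 24 covers 6 (1/2)^k < d for the past and 2 (1/2)^k < d/2 for the
    future.\<close>
  have "(\<lambda>k. 24 * (1 / 2 :: real) ^ k) \<longlonglongrightarrow> 24 * 0" by (intro tendsto_intros LIMSEQ_power_zero) auto
  then have "\<forall>\<^sub>F k in at_top. 24 * (1 / 2 :: real) ^ k < d" using d by (intro order_tendstoD(2)) auto
  then show "\<forall>\<^sub>F k in at_top. inhom_M (\<beta> k) (gamma_star (\<beta> k)) \<le> ereal (M1 R + e)"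
    using eventually_ge_at_top[of "1 :: nat"]
  proof eventually_elim
    case (elim k)
    interpret nicf "\<beta> k" using elim by (intro nicf)
    interpret nicf_params "\<beta> k" R by unfold_locales
    define L where "L = Suc (Suc (k + k))"
    have L: "length (block_ge3 R k) = L" by (simp add: L_def block_ge3_nth)
    note q = periodic_quotients[OF per[OF elim(2)], unfolded L]
    have Rs: "0 < R_star R" "0 < R_sstar R" using R by (auto simp: R_star_def R_sstar_def)
    have "extremal d (j * L + k)" for j
    proof -
      have past: "a (j * L + i) = int (R_star R) \<and> \<epsilon> (j * L + i) = 1" if "i < k" for i
      proof -
        have "block_ge3 R k ! Suc i > 0"
          using that Rs block_ge3_nth(1)[of "Suc i" k R] block_ge3_nth(2)[of R k] by (cases "Suc i = k") auto
        then show ?thesis using q[of i j] that block_ge3_nth(1)[of i k R] by (simp add: L_def)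
      qed
      have pc: "\<bar>bb (j * L + k) - \<theta>\<bar> \<le> (1 / 4) ^ k" "\<bar>rr (j * L + k) - \<rho>\<bar> \<le> 6 * (1 / 2) ^ k"
        using past_convergence[of k "j * L"] past by auto
      \<comment> \<open>Only k - 1 of the k final quotients count: the last one is followed by the
        positive first entry of the next period.\<close>
      have fut: "a (Suc (Suc (j * L + k)) + i) = int (R_sstar R) \<and> \<epsilon> (Suc (Suc (j * L + k)) + i) = - 1" if "i < k - 1" for i
      proof -
        have e: "Suc (Suc (j * L + k)) + i = j * L + (Suc (Suc k) + i)" by simp
        have i: "Suc (Suc k) + i < L" and m: "Suc (Suc (Suc k) + i) mod L = Suc (Suc k) + Suc i"
          using that by (auto simp: L_def)
        have B: "block_ge3 R k ! (Suc (Suc k) + i) = - int (R_sstar R)"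
          "block_ge3 R k ! (Suc (Suc k) + Suc i) = - int (R_sstar R)"
          using that by (intro block_ge3_nth(4); simp)+
        show ?thesis unfolding e using q(1)[OF i, of j] q(2)[OF i, of j] Rs unfolding m B by simp
      qed
      have fc: "\<bar>x (Suc (Suc (j * L + k))) - \<eta>\<bar> \<le> (1 / 4) ^ (k - 1)" "\<tau> (Suc (Suc (j * L + k))) \<le> (1 / 2) ^ (k - 1)"
        using future_convergence[OF R, of "k - 1" "Suc (Suc (j * L + k))"] fut by auto
      have p: "(1 / 4 :: real) ^ n \<le> (1 / 2) ^ n" for n by (intro power_mono) auto
      have pk: "(1 / 2 :: real) ^ (k - 1) = 2 * (1 / 2) ^ k" using elim(2) by (cases k) auto
      have p0: "0 < (1 / 2 :: real) ^ k" by simp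
      have k: "a (j * L + k) = int (R_sstar R)" "\<epsilon> (j * L + k) = - 1"
        using q[of k j] block_ge3_nth(2,3)[of R k] Rs elim(2) by (auto simp: L_def)
      have k1: "a (Suc (j * L + k)) = int (R_star R)" "\<epsilon> (Suc (j * L + k)) = - 1"
        using q[of "Suc k" j] block_ge3_nth(3)[of R k] block_ge3_nth(4)[of 0 k R] Rs elim(2) by (auto simp: L_def)
      show ?thesis unfolding extremal_def
      proof (intro conjI)
        show "even (a (j * L + k))" using k by (simp add: R_sstar_def)
        show "real_of_int (a (j * L + k)) = A" using k A_eq_sstar[OF R] by simp
        show "\<bar>bb (j * L + k) - \<theta>\<bar> < d" using pc(1) p[of k] p0 elim(1) by linarith
        show "\<bar>rr (j * L + k) - \<rho>\<bar> < d" using pc(2) p0 elim(1) by linarith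
        show "\<bar>x (Suc (Suc (j * L + k))) - \<eta>\<bar> < d / 2" using fc(1) p[of "k - 1"] pk p0 elim(1) by linarith
        show "\<tau> (Suc (Suc (j * L + k))) < d / 2" using fc(2) pk p0 elim(1) by linarith
      qed (fact k k1)+
    qed
    moreover have "m \<le> m * L + k" for m by (simp add: L_def algebra_simps)
    ultimately have "\<exists>p\<ge>m. extremal d p" for m by blast
    then have "inhom_M (\<beta> k) (gamma_star (\<beta> k)) \<le> ereal ((T + 4 * e) / 4)"
      using d0(2) d by (intro inhom_M_upper[of d]) auto
    then show ?case unfolding M1_eq by (simp add: add_divide_distrib)
  qed
qed

text \<open>For R = 2 no remainder equals \<eta> = 1/2. The entries -2, \<open>A\<close> approximate
  it by 1/(2 + X) with X about 1/A, and as 2 is even the tail there is at most X.\<close>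

lemma block_2_limit:
  assumes per: "\<And>k n. 1 \<le> k \<Longrightarrow> 2 \<le> n \<Longrightarrow> periodic_nicf (block_2 k n) (\<beta> k n)"
  shows "((\<lambda>(k, n). inhom_M (\<beta> k n) (gamma_star (\<beta> k n))) \<longlongrightarrow> ereal (M1 2)) (at_top \<times>\<^sub>F at_top)"
proof (rule tendsto_ereal_squeeze)
  interpret bound_params 2 by unfold_locales simp
  have nicf: "nicf (\<beta> k n)" if "1 \<le> k" "2 \<le> n" for k n
    using per[OF that] by (simp add: nicf_def periodic_nicf_def)
  have "ereal (M1 2) \<le> inhom_M (\<beta> k n) (gamma_star (\<beta> k n))" if k: "1 \<le> k" "2 \<le> n" for k n
  proof -
    interpret nicf "\<beta> k n" by (rule nicf[OF k])
    have "int 2 \<le> a i" for i using a_ge2[of i] by simp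
    then interpret nicf_bounded "\<beta> k n" 2 0 by unfold_locales
    show ?thesis by (rule inhom_M_lower)
  qed
  moreover have "\<forall>\<^sub>F z in at_top \<times>\<^sub>F at_top. (1 :: nat) \<le> fst z \<and> (2 :: nat) \<le> snd z"
    by (intro eventually_prodI eventually_ge_at_top)
  ultimately show "\<forall>\<^sub>F z in at_top \<times>\<^sub>F at_top. ereal (M1 2) \<le> (case z of (k, n) \<Rightarrow> inhom_M (\<beta> k n) (gamma_star (\<beta> k n)))"
    by (auto elim!: eventually_mono)
  fix e :: real assume e: "0 < e"
  obtain d0 where d0: "0 < d0" "\<And>b r x t. \<bar>b - \<theta>\<bar> < d0 \<Longrightarrow> \<bar>r - \<rho>\<bar> < d0 \<Longrightarrow> \<bar>x - al\<bar> < d0 \<Longrightarrow> \<bar>t - al\<bar> < d0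
      \<Longrightarrow> (A + b - 1 - r) * (1 - x - t) / (A + b - x) < T + 4 * e"
    using extremal_continuity[of "4 * e"] e by auto
  define d where "d = min d0 (1 / 2)"
  have d: "0 < d" "d \<le> 1 / 2" "d \<le> d0" using d0 by (auto simp: d_def)
  have "(\<lambda>k. 6 * (1 / 2 :: real) ^ k) \<longlonglongrightarrow> 6 * 0" by (intro tendsto_intros LIMSEQ_power_zero) auto
  then have "\<forall>\<^sub>F k in at_top. 6 * (1 / 2 :: real) ^ k < d \<and> 1 \<le> k"
    using d by (intro eventually_conj order_tendstoD(2) eventually_ge_at_top) auto
  \<comment> \<open>The threshold makes N - 1/2 exceed 2/d, so that the remainder starting at the
    quotient N is below d/2.\<close>
  moreover have "\<forall>\<^sub>F n in at_top. max 2 (nat \<lceil>2 / d + 1\<rceil>) \<le> n" by (rule eventually_ge_at_top)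
  ultimately have "\<forall>\<^sub>F z in at_top \<times>\<^sub>F at_top. (6 * (1 / 2 :: real) ^ fst z < d \<and> 1 \<le> fst z) \<and> max 2 (nat \<lceil>2 / d + 1\<rceil>) \<le> snd z"
    by (rule eventually_prodI)
  then show "\<forall>\<^sub>F z in at_top \<times>\<^sub>F at_top. (case z of (k, n) \<Rightarrow> inhom_M (\<beta> k n) (gamma_star (\<beta> k n))) \<le> ereal (M1 2 + e)"
  proof eventually_elim
    case (elim z)
    obtain k N where z: "z = (k, N)" by (cases z)
    have k: "6 * (1 / 2 :: real) ^ k < d" "1 \<le> k" and N2: "2 \<le> N" and "nat \<lceil>2 / d + 1\<rceil> \<le> N" using elim z by auto
    then have N: "2 / d + 1 \<le> real N" by linarith
    interpret nicf "\<beta> k N" using k N2 by (intro nicf)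
    interpret nicf_params "\<beta> k N" 2 by unfold_locales
    have cst: "A = 4" "R_star 2 = 3" "\<eta> = 1 / 2" using small_R
      by (simp_all add: R_star_def \<eta>_def theta2_def)
    define L where "L = k + 4"
    have L: "length (block_2 k N) = L" by (simp add: L_def block_2_nth)
    note q = periodic_quotients[OF per[OF k(2) N2], unfolded L]
    have "extremal d (j * L + k)" for j
    proof -
      have past: "a (j * L + i) = int (R_star 2) \<and> \<epsilon> (j * L + i) = 1" if "i < k" for i
      proof -
        have "block_2 k N ! Suc i > 0"
          using that block_2_nth(1)[of "Suc i" k N] block_2_nth(2)[of k N] by (cases "Suc i = k") auto
        then show ?thesis using q[of i j] that block_2_nth(1)[of i k N] cst by (simp add: L_def)
      qed
      have pc: "\<bar>bb (j * L + k) - \<theta>\<bar> \<le> (1 / 4) ^ k" "\<bar>rr (j * L + k) - \<rho>\<bar> \<le> 6 * (1 / 2) ^ k"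
        using past_convergence[of k "j * L"] past by auto
      have p: "(1 / 4 :: real) ^ k \<le> (1 / 2) ^ k" by (intro power_mono) auto
      have p0: "0 < (1 / 2 :: real) ^ k" by simp
      define p where "p = j * L + k"
      have n: "block_2 k N ! k = 4" "block_2 k N ! Suc k = - 3" "block_2 k N ! Suc (Suc k) = - 2"
        "block_2 k N ! Suc (Suc (Suc k)) = int N"
        using block_2_nth(2-5)[of k N] by (simp_all add: numeral_eq_Suc)
      have a0: "a p = 4" "\<epsilon> p = - 1" using q[of k j] n by (auto simp: L_def p_def)
      have a1: "a (Suc p) = 3" "\<epsilon> (Suc p) = - 1" using q[of "Suc k" j] n by (auto simp: L_def p_def)
      have a2: "a (Suc (Suc p)) = 2" "\<epsilon> (Suc (Suc p)) = 1" using q[of "Suc (Suc k)" j] n N2 by (auto simp: L_def p_def)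
      have a3: "a (Suc (Suc (Suc p))) = int N" using q[of "Suc (Suc (Suc k))" j] n by (auto simp: L_def p_def)
      define X where "X = x (Suc (Suc (Suc p)))"
      have X: "0 < X" "X < d / 2"
      proof -
        show "0 < X" using x_pos by (simp add: X_def)
        define Q where "Q = real N + real_of_int (\<epsilon> (Suc (Suc (Suc p)))) * x (Suc (Suc (Suc (Suc p))))"
        have "real N - 1 / 2 \<le> Q"
          using eps_cases[of "Suc (Suc (Suc p))"] x_pos[of "Suc (Suc (Suc (Suc p)))"] x_half[of "Suc (Suc (Suc (Suc p)))"]
          by (auto simp: Q_def)
        then have "2 / d < Q" using N by linarith
        moreover have "0 < 2 / d" using d by simp
        ultimately have "0 < Q" "2 < Q * d" using d by (linarith, simp add: pos_divide_less_eq)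
        then have "1 / Q < d / 2" by (simp add: field_simps)
        moreover have "X = 1 / Q" using rem_rec[of "Suc (Suc (Suc p))"] a3 by (simp add: X_def Q_def)
        ultimately show "X < d / 2" by (simp only:)
      qed
      have x2: "x (Suc (Suc p)) = 1 / (2 + 1 * X)" using rem_rec[of "Suc (Suc p)"] a2 by (simp add: X_def)
      have "\<bar>x (Suc (Suc p)) - \<eta>\<bar> \<le> X / 4"
        using cf_contract[of 2 1 X 0] X unfolding x2 cst by simp
      then have 1: "\<bar>x (Suc (Suc p)) - \<eta>\<bar> < d / 2" using X by linarith
      have "\<tau> (Suc (Suc p)) = x (Suc (Suc p)) * \<tau> (Suc (Suc (Suc p)))" using \<tau>_rec[of "Suc (Suc p)"] a2 by simp
      also have "\<dots> \<le> 1 * X" using x_half[of "Suc (Suc p)"] \<tau>_range[of "Suc (Suc (Suc p))"] X unfolding X_def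
        by (intro mult_mono) auto
      finally have 2: "\<tau> (Suc (Suc p)) < d / 2" using X by simp
      show ?thesis unfolding extremal_def p_def[symmetric]
      proof (intro conjI)
        show "\<bar>bb p - \<theta>\<bar> < d" using pc(1) p p0 k(1) unfolding p_def by linarith
        show "\<bar>rr p - \<rho>\<bar> < d" using pc(2) k(1) unfolding p_def by linarith
        show "\<bar>x (Suc (Suc p)) - \<eta>\<bar> < d / 2" "\<tau> (Suc (Suc p)) < d / 2" by (fact 1 2)+
      qed (use a0 a1 cst(1,2) in simp_all)
    qed
    moreover have "m \<le> m * L + k" for m by (simp add: L_def algebra_simps)
    ultimately have "\<exists>p\<ge>m. extremal d p" for m by blast
    then have "inhom_M (\<beta> k N) (gamma_star (\<beta> k N)) \<le> ereal ((T + 4 * e) / 4)"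
      using d0(2) d by (intro inhom_M_upper[of d]) auto
    then show ?case unfolding M1_eq z by (simp add: add_divide_distrib)
  qed
qed

lemma inhom_M_lower_bound:
  assumes "0 < \<alpha>" "\<alpha> < 1 / 2" "\<alpha> \<notin> \<rat>"
    and lim: "liminf (\<lambda>i. ereal (of_int (nicf_a \<alpha> i))) = ereal (real R)"
  shows "ereal (M1 R) \<le> inhom_M \<alpha> (gamma_star \<alpha>)"
proof -
  interpret nicf \<alpha> by unfold_locales fact+
  have "2 \<le> R"
  proof -
    have "\<forall>\<^sub>F i in sequentially. ereal 2 \<le> ereal (of_int (nicf_a \<alpha> i))"
      unfolding eventually_sequentially
    proof (intro exI[of _ 1] allI impI)
      fix n :: nat assume "1 \<le> n"
      then obtain m where "n = Suc m" by (cases n) auto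
      then have "2 \<le> nicf_a \<alpha> n" using a_ge2[of m] by simp
      then show "ereal 2 \<le> ereal (of_int (nicf_a \<alpha> n))" by simp
    qed
    then have "ereal 2 \<le> liminf (\<lambda>i. ereal (of_int (nicf_a \<alpha> i)))" by (rule Liminf_bounded)
    then show ?thesis unfolding lim by simp
  qed
  \<comment> \<open>Quotients are integers, so being above R - 1/2 means being at least R.\<close>
  moreover have "\<forall>\<^sub>F i in sequentially. ereal (real R - 1 / 2) < ereal (of_int (nicf_a \<alpha> i))"
    by (rule less_LiminfD) (simp add: lim)
  then obtain K0 where K0: "\<And>i. K0 \<le> i \<Longrightarrow> real R - 1 / 2 < of_int (nicf_a \<alpha> i)"
    unfolding eventually_sequentially by auto
  have "int R \<le> a k" if "K0 \<le> k" for k using K0[of "Suc k"] that by linarith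
  ultimately interpret nicf_bounded \<alpha> R K0 by unfold_locales
  show ?thesis by (rule inhom_M_lower)
qed

text \<open>The existence and uniqueness clauses show that the families \<beta> exist and are
  determined at all indices considered, so the limits concern the intended numbers. The product
  filter lets both parameters grow independently.\<close>

theorem theorem4:
  shows "(\<forall>(\<alpha>::real) (R::nat).
            0 < \<alpha> \<and> \<alpha> < 1 / 2 \<and> \<alpha> \<notin> \<rat> \<and>
            liminf (\<lambda>i. ereal (of_int (nicf_a \<alpha> i))) = ereal (real R)
            \<longrightarrow> inhom_M \<alpha> (gamma_star \<alpha>) \<ge> ereal (M1 R))
       \<and> (\<forall>R\<ge>3.
            (\<forall>k\<ge>1. \<exists>!x. periodic_nicf (block_ge3 R k) x) \<and>
            (\<forall>\<beta> :: nat \<Rightarrow> real.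
               (\<forall>k\<ge>1. periodic_nicf (block_ge3 R k) (\<beta> k)) \<longrightarrow>
               ((\<lambda>k. inhom_M (\<beta> k) (gamma_star (\<beta> k))) \<longlongrightarrow> ereal (M1 R)) at_top))
       \<and> (\<forall>k\<ge>1. \<forall>A\<ge>2. \<exists>!x. periodic_nicf (block_2 k A) x)
       \<and> (\<forall>\<beta> :: nat \<Rightarrow> nat \<Rightarrow> real.
            (\<forall>k\<ge>1. \<forall>A\<ge>2. periodic_nicf (block_2 k A) (\<beta> k A)) \<longrightarrow>
            ((\<lambda>(k, A). inhom_M (\<beta> k A) (gamma_star (\<beta> k A))) \<longlongrightarrow> ereal (M1 2))
              (at_top \<times>\<^sub>F at_top))"
  using inhom_M_lower_bound block_ge3_ex1 block_ge3_limit block_2_ex1 block_2_limit by blast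

end
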